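(* Suppose that the data $(G,K,b,\sigma,\theta,\{X^u_0\},\{Y^u_0\})$ satisfy the conditions (RD) and (CO) stated in the context. Let $h>0$, $T>0$, $t_m=mh$, and let $M=T/h$ if $T/h\in\mathbb N$ and $M=\lfloor T/h\rfloor+1$ otherwise. Let $\bar X^u,\bar Y^u$ be the (continuous-time) Euler schemes with step $h$ defined in the context. Then for every convex function $F:(\mathbb R^d)^\infty\to\mathbb R$ with quadratic growth in the sense that there is $C>0$ with $$|F(x)|\le C\Big(1+\sum_{m=0}^\infty e^{-\lambda t_m}\frac{|x_m|^2+|x_{m+1}|^2}{2}\,h\Big)\qquad\forall x=x_{0:\infty}=(x_0,x_1,\dots)\in(\mathbb R^d)^\infty,$$ we have $$\mathbb E\big[F(\bar X^u_{t_0},\dots,\bar X^u_{t_{M-1}},\bar X^u_T,\bar X^u_T,\dots)\big]\le\mathbb E\big[F(\bar Y^u_{t_0},\dots,\bar Y^u_{t_{M-1}},\bar Y^u_T,\bar Y^u_T,\dots)\big],\qquad\forall u\in I.$$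
   Context: Notation. $I=[0,1]$. A graphon is a symmetric measurable function $I\times I\to I$. $|\cdot|$ is the Euclidean norm; for a $d\times q$ real matrix $A\in\mathbb M^{d\times q}(\mathbb R)$, $\|A\|=\sup_{|z|\le 1}|Az|$, and $A\preceq B$ means that $BB^\top-AA^\top$ is positive semi-definite. For $\mu,\nu$ probability measures on $\mathbb R^d$ with finite first moment, $\mu\preceq_{cv}\nu$ means $\int\varphi\,d\mu\le\int\varphi\,d\nu$ for all convex $\varphi:\mathbb R^d\to\mathbb R$; for random vectors, $X\preceq_{cv}Y$ means $\mathcal L(X)\preceq_{cv}\mathcal L(Y)$. $\mathcal P_2(\mathbb R^d)$ (resp. $\mathcal M_2(\mathbb R^d)$) is the set of Borel probability (resp. finite positive Borel) measures on $\mathbb R^d$ with finite second moment; $\mathcal W_2$ is the 2-Wasserstein distance. For $\mu\in\mathcal M_2(\mathbb R^d)$ let $m_\mu=\mu(\mathbb R^d)$; fix a reference point $x_0\in\mathbb R^d$, put $\overline\mu=\mu/m_\mu$ if $m_\mu>0$ and $\overline\mu=\delta_{x_0}$ otherwise, $T_a(x)=a(x-x_0)+x_0$, and $$\mathcal{WOP}_2^2(\mu,\nu)=(m_\mu-m_\nu)^2+\mathcal W_2^2\big(T_{m_\mu}\#\overline\mu,\,T_{m_\nu}\#\overline\nu\big),$$ where $\#$ denotes pushforward. $\mathcal H(\mathbb R^d)$ is the set of families $\boldsymbol\mu=\{\mu^u\}_{u\in I}\in\mathcal P_2(\mathbb R^d)^I$ such that $u\mapsto\mu^u(B)$ is measurable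 for every Borel $B$ and $\sup_{u\in I}\int|x|^2\mu^u(dx)<\infty$. For a graphon $G$ and $\boldsymbol\mu\in\mathcal H(\mathbb R^d)$, $[G\boldsymbol\mu]^u(dx):=\int_I G(u,v)\mu^v(dx)\,dv\in\mathcal M_2(\mathbb R^d)$. $\boldsymbol\delta_0$ is the family with $\delta_0^u=\delta_0$ for all $u$. $\lambda>0$ is a fixed constant. Data. $G,K$ are graphons, $b:\mathbb R_+\times\mathbb R^d\to\mathbb R^d$, $\sigma,\theta:\mathbb R_+\times\mathbb R^d\times\mathcal M_2(\mathbb R^d)\to\mathbb M^{d\times q}(\mathbb R)$. On a filtered probability space, $\{B^u\}_{u\in I}$ are i.i.d. $q$-dimensional standard Brownian motions and $\{X^u_0,Y^u_0,B^u:u\in I\}$ are mutually independent. Euler schemes. With step $h>0$ and $t_m=mh$: $\bar X^u_0=X^u_0$, $\bar Y^u_0=Y^u_0$ and for $m\in\mathbb N$, $t\in[t_m,t_{m+1}]$, $\bar X^u_t=\bar X^u_{t_m}+b(t_m,\bar X^u_{t_m})(t-t_m)+\sigma(t_m,\bar X^u_{t_m},[G\bar{\boldsymbol\mu}_{t_m}]^u)(B^u_t-B^u_{t_m})$, $\bar Y^u_t=\bar Y^u_{t_m}+b(t_m,\bar Y^u_{t_m})(t-t_m)+\theta(t_m,\bar Y^u_{t_m},[K\bar{\boldsymbol\nu}_{t_m}]^u)(B^u_t-B^u_{t_m})$, where $\bar{\boldsymbol\mu}_{t_m}=\{\mathcal L(\bar X^u_{t_m})\}_{u\in I}$ and $\bar{\boldsymbol\nu}_{t_m}=\{\mathcal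 L(\bar Y^u_{t_m})\}_{u\in I}$. Conditions (RD). (i) There are $\rho\in(0,1]$, $\tilde L>0$, $L>0$ such that for all $t\ge s\ge 0$, $x,y\in\mathbb R^d$, $\mu,\nu\in\mathcal M_2(\mathbb R^d)$: $|b(t,x)-b(s,x)|\vee\|\sigma(t,x,\mu)-\sigma(s,x,\mu)\|\vee\|\theta(t,x,\mu)-\theta(s,x,\mu)\|\le\tilde L(1+|x|+\mathcal{WOP}_2(\mu,m_\mu\delta_0))(t-s)^\rho$ and $|b(t,x)-b(t,y)|\vee\|\sigma(t,x,\mu)-\sigma(t,y,\nu)\|\vee\|\theta(t,x,\mu)-\theta(t,y,\nu)\|\le L(|x-y|+\mathcal{WOP}_2(\mu,\nu))$. (ii) $u\mapsto\mathcal L(X^u_0)$ and $u\mapsto\mathcal L(Y^u_0)$ are measurable from $I$ to $\mathcal P(\mathbb R^d)$, and $\sup_u\mathbb E|X_0^u|^2<\infty$, $\sup_u\mathbb E|Y_0^u|^2<\infty$. (iii) There is $c_0\in(0,\infty)$ with $(x_1-x_2)\cdot(b(t,x_1)-b(t,x_2))\le-c_0|x_1-x_2|^2$ for all $t\ge 0$, $x_1,x_2\in\mathbb R^d$, and $\kappa_1:=c_0-8L^2q>0$. (iv) $\kappa_2:=\sup_{t}|b(t,0)|\vee\sup_{t}\sup_{u}\|\sigma(t,0,[G\boldsymbol\delta_0]^u)\|\vee\sup_{t}\sup_{u}\|\theta(t,0,[K\boldsymbol\delta_0]^u)\|<\infty$. Conditions (CO). (i) $b$ is affine in $x$. (ii)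 For all $t\ge 0$, $\mu\in\mathcal M_2(\mathbb R^d)$, $x,y\in\mathbb R^d$, $r\in[0,1]$: $\sigma(t,rx+(1-r)y,\mu)\preceq r\sigma(t,x,\mu)+(1-r)\sigma(t,y,\mu)$. (iii) For all $(t,u,x)$ and all $\boldsymbol\mu,\boldsymbol\nu\in\mathcal H(\mathbb R^d)$ with $\mu^v\preceq_{cv}\nu^v$ for all $v\in I$: $\sigma(t,x,[G\boldsymbol\mu]^u)\preceq\sigma(t,x,[G\boldsymbol\nu]^u)$. (iv) For all $(t,u,x,\boldsymbol\mu)\in\mathbb R_+\times I\times\mathbb R^d\times\mathcal H(\mathbb R^d)$: $\sigma(t,x,[G\boldsymbol\mu]^u)\preceq\theta(t,x,[K\boldsymbol\mu]^u)$. (v) $X^u_0\preceq_{cv}Y^u_0$ for all $u\in I$. *)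

theory Defs
  imports "HOL-Probability.Probability"
begin

section \<open>Matrices\<close>

text \<open>A $d \times q$ matrix has type \<^typ>\<open>real^'q^'d\<close>; its norm is \<^term>\<open>onorm ((*v) A)\<close>.\<close>

lemma onorm_matrix_eq_SUP_cball:
  fixes A :: "real^'q^'d"
  shows "onorm ((*v) A) = (SUP z\<in>cball 0 1. norm (A *v z))"
proof (rule antisym)
  have bl: "bounded_linear ((*v) A)"
    by (simp add: matrix_vector_mul_bounded_linear)
  have bnd: "norm (A *v z) \<le> onorm ((*v) A)" if "z \<in> cball 0 1" for z
  proof -
    have "norm (A *v z) \<le> onorm ((*v) A) * norm z"
      by (rule onorm[OF bl])
    also have "\<dots> \<le> onorm ((*v) A) * 1"
      using that onorm_pos_le[OF bl] by (intro mult_left_mono) auto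
    finally show ?thesis by simp
  qed
  show "(SUP z\<in>cball 0 1. norm (A *v z)) \<le> onorm ((*v) A)"
    by (intro cSUP_least bnd) auto
  have bdd: "bdd_above ((\<lambda>z. norm (A *v z)) ` cball 0 1)"
    using bnd by (intro bdd_aboveI2)
  have nonneg: "0 \<le> (SUP z\<in>cball 0 1. norm (A *v z))"
    using cSUP_upper[OF _ bdd, of 0] by simp
  show "onorm ((*v) A) \<le> (SUP z\<in>cball 0 1. norm (A *v z))"
  proof (rule onorm_bound[OF nonneg])
    fix x :: "real^'q"
    show "norm (A *v x) \<le> (SUP z\<in>cball 0 1. norm (A *v z)) * norm x"
    proof (cases "x = 0")
      case False
      have "norm (A *v (inverse (norm x) *\<^sub>R x)) \<le> (SUP z\<in>cball 0 1. norm (A *v z))"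
        using False by (intro cSUP_upper[OF _ bdd]) simp
      then show ?thesis
        using False by (simp add: matrix_vector_mult_scaleR field_simps)
    qed simp
  qed
qed

definition pos_semidef :: "real^'n^'n \<Rightarrow> bool" where
  "pos_semidef A \<longleftrightarrow> transpose A = A \<and> (\<forall>x. 0 \<le> x \<bullet> (A *v x))"

definition mat_le :: "real^'q^'d \<Rightarrow> real^'q^'d \<Rightarrow> bool"  (infix "\<preceq>\<^sub>m" 50) where
  "A \<preceq>\<^sub>m B \<longleftrightarrow> pos_semidef (B ** transpose B - A ** transpose A)"


section \<open>Measures, convex order and transport distances\<close>

definition measures2 :: "'a::euclidean_space measure set" where
  "measures2 = {\<mu>. sets \<mu> = sets borel \<and> finite_measure \<mu> \<and>
    (\<integral>\<^sup>+x. ennreal ((norm x)\<^sup>2) \<partial>\<mu>) < \<infinity>}"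

definition prob1 :: "'a::euclidean_space measure set" where
  "prob1 = {\<mu>. sets \<mu> = sets borel \<and> prob_space \<mu> \<and> (\<integral>\<^sup>+x. ennreal (norm x) \<partial>\<mu>) < \<infinity>}"

definition prob2 :: "'a::euclidean_space measure set" where
  "prob2 = {\<mu> \<in> measures2. prob_space \<mu>}"

text \<open>A convex function need not be integrable, but its negative part is integrable under a
  probability measure with finite first moment, so its integral is well defined in
  $(-\infty,\infty]$. The Bochner integral would give 0 when the integral is infinite.\<close>

definition ext_integral :: "'a measure \<Rightarrow> ('a \<Rightarrow> real) \<Rightarrow> ereal" where
  "ext_integral \<mu> f = enn2ereal (\<integral>\<^sup>+x. ennreal (f x) \<partial>\<mu>) - enn2ereal (\<integral>\<^sup>+x. ennreal (- f x) \<partial>\<mu>)"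

definition cv_le :: "'a::euclidean_space measure \<Rightarrow> 'a measure \<Rightarrow> bool"  (infix "\<preceq>\<^sub>c\<^sub>v" 50) where
  "\<mu> \<preceq>\<^sub>c\<^sub>v \<nu> \<longleftrightarrow> \<mu> \<in> prob1 \<and> \<nu> \<in> prob1 \<and>
    (\<forall>\<phi>. convex_on UNIV \<phi> \<longrightarrow> ext_integral \<mu> \<phi> \<le> ext_integral \<nu> \<phi>)"

definition couplings :: "'a::euclidean_space measure \<Rightarrow> 'a measure \<Rightarrow> ('a \<times> 'a) measure set" where
  "couplings \<mu> \<nu> = {\<pi>. sets \<pi> = sets (borel \<Otimes>\<^sub>M borel) \<and> distr \<pi> borel fst = \<mu> \<and> distr \<pi> borel snd = \<nu>}"

definition W2 :: "'a::euclidean_space measure \<Rightarrow> 'a measure \<Rightarrow> real" where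
  "W2 \<mu> \<nu> = sqrt (enn2real (INF \<pi>\<in>couplings \<mu> \<nu>. \<integral>\<^sup>+(x, y). ennreal ((norm (x - y))\<^sup>2) \<partial>\<pi>))"

definition mass :: "'a measure \<Rightarrow> real" where
  "mass \<mu> = measure \<mu> (space \<mu>)"

definition normalized :: "'a::euclidean_space \<Rightarrow> 'a measure \<Rightarrow> 'a measure" where
  "normalized x\<^sub>0 \<mu> =
    (if mass \<mu> > 0 then scale_measure (ennreal (1 / mass \<mu>)) \<mu> else return borel x\<^sub>0)"

definition dilation :: "'a::euclidean_space \<Rightarrow> real \<Rightarrow> 'a \<Rightarrow> 'a" where
  "dilation x\<^sub>0 a x = a *\<^sub>R (x - x\<^sub>0) + x\<^sub>0"

definition WOP2 :: "'a::euclidean_space \<Rightarrow> 'a measure \<Rightarrow> 'a measure \<Rightarrow> real" where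
  "WOP2 x\<^sub>0 \<mu> \<nu> = sqrt ((mass \<mu> - mass \<nu>)\<^sup>2 +
    (W2 (distr (normalized x\<^sub>0 \<mu>) borel (dilation x\<^sub>0 (mass \<mu>)))
        (distr (normalized x\<^sub>0 \<nu>) borel (dilation x\<^sub>0 (mass \<nu>))))\<^sup>2)"


section \<open>Graphons\<close>

text \<open>The label space is the subset $[0,1]$ of \<^typ>\<open>real\<close>; values outside it are irrelevant.\<close>

definition graphon :: "(real \<Rightarrow> real \<Rightarrow> real) \<Rightarrow> bool" where
  "graphon G \<longleftrightarrow>
    (\<lambda>(u, v). G u v) \<in> borel_measurable (restrict_space borel ({0..1} \<times> {0..1})) \<and>
    (\<forall>u\<in>{0..1}. \<forall>v\<in>{0..1}. G u v \<in> {0..1} \<and> G u v = G v u)"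

definition families :: "(real \<Rightarrow> 'a::euclidean_space measure) set" where
  "families = {\<mu>. (\<forall>u\<in>{0..1}. \<mu> u \<in> prob2) \<and>
    (\<forall>A\<in>sets borel. (\<lambda>u. emeasure (\<mu> u) A) \<in> borel_measurable (restrict_space borel {0..1})) \<and>
    (SUP u\<in>{0..1}. \<integral>\<^sup>+x. ennreal ((norm x)\<^sup>2) \<partial>\<mu> u) < \<infinity>}"

definition graphon_mix ::
    "(real \<Rightarrow> real \<Rightarrow> real) \<Rightarrow> (real \<Rightarrow> 'a::euclidean_space measure) \<Rightarrow> real \<Rightarrow> 'a measure" where
  "graphon_mix G \<mu> u = measure_of UNIV (sets borel)
    (\<lambda>A. \<integral>\<^sup>+v\<in>{0..1}. ennreal (G u v) * emeasure (\<mu> v) A \<partial>lborel)"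

lemma borel_measurable_graphon_section:
  assumes "graphon G" "u \<in> {0..1}"
  shows "(\<lambda>v. G u v) \<in> borel_measurable (restrict_space borel {0..1})"
proof -
  have "(\<lambda>v. (u, v)) \<in> restrict_space borel {0..1} \<rightarrow>\<^sub>M restrict_space borel ({0..1} \<times> {0..1})"
    using assms(2)
    by (intro measurable_restrict_space2 measurable_restrict_space1 borel_measurable_continuous_onI
          continuous_intros) (auto simp: space_restrict_space)
  from measurable_compose[OF this, of "\<lambda>(u, v). G u v" borel] assms(1) show ?thesis
    by (simp add: graphon_def)
qed

text \<open>\<^const>\<open>measure_of\<close> returns the null measure unless its argument is a measure.\<close>

lemma emeasure_graphon_mix:
  fixes \<mu> :: "real \<Rightarrow> 'a::euclidean_space measure"
  assumes G: "graphon G" and u: "u \<in> {0..1}" and \<mu>: "\<mu> \<in> families" and A: "A \<in> sets borel"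
  shows "emeasure (graphon_mix G \<mu> u) A =
    (\<integral>\<^sup>+v\<in>{0..1}. ennreal (G u v) * emeasure (\<mu> v) A \<partial>lborel)"
proof (rule emeasure_measure_of[OF graphon_mix_def])
  let ?m = "\<lambda>A. \<integral>\<^sup>+v\<in>{0..1}. ennreal (G u v) * emeasure (\<mu> v) A \<partial>lborel"
  let ?R = "restrict_space lborel {0..1::real}"
  have m_R: "?m A = (\<integral>\<^sup>+v. ennreal (G u v) * emeasure (\<mu> v) A \<partial>?R)" for A
    by (subst nn_integral_restrict_space) auto
  have R: "sets ?R = sets (restrict_space borel {0..1})"
    by (simp add: sets_restrict_space)
  have meas: "(\<lambda>v. ennreal (G u v) * emeasure (\<mu> v) A) \<in> borel_measurable ?R"
    if "A \<in> sets borel" for A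
  proof -
    have "(\<lambda>v. emeasure (\<mu> v) A) \<in> borel_measurable ?R"
      using \<mu> that by (simp add: families_def measurable_cong_sets[OF R refl])
    moreover have "(\<lambda>v. G u v) \<in> borel_measurable ?R"
      using borel_measurable_graphon_section[OF G u] by (simp add: measurable_cong_sets[OF R refl])
    ultimately show ?thesis by measurable
  qed
  show "A \<in> sets (graphon_mix G \<mu> u)"
    using A by (simp add: graphon_mix_def sets.sigma_sets_eq[of borel, simplified])
  show "sets borel \<subseteq> Pow (UNIV :: 'a set)" by simp
  show "positive (sets (graphon_mix G \<mu> u)) ?m" by (simp add: positive_def)
  show "countably_additive (sets (graphon_mix G \<mu> u)) ?m"
  proof (rule countably_additiveI)
    fix S :: "nat \<Rightarrow> 'a set"
    assume S: "range S \<subseteq> sets (graphon_mix G \<mu> u)" "disjoint_family S"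
    have Sb: "range S \<subseteq> sets borel"
      using S(1) by (simp add: graphon_mix_def sets.sigma_sets_eq[of borel, simplified])
    have "(\<Sum>i. ?m (S i)) = (\<integral>\<^sup>+v. (\<Sum>i. ennreal (G u v) * emeasure (\<mu> v) (S i)) \<partial>?R)"
      unfolding m_R using Sb by (intro nn_integral_suminf[symmetric] meas) auto
    also have "\<dots> = (\<integral>\<^sup>+v. ennreal (G u v) * emeasure (\<mu> v) (\<Union>i. S i) \<partial>?R)"
    proof (rule nn_integral_cong)
      fix v assume "v \<in> space ?R"
      then have "sets (\<mu> v) = sets borel"
        using \<mu> by (auto simp: families_def prob2_def measures2_def space_restrict_space)
      then have "(\<Sum>i. emeasure (\<mu> v) (S i)) = emeasure (\<mu> v) (\<Union>i. S i)"
        using Sb S(2) by (intro suminf_emeasure) auto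
      then show "(\<Sum>i. ennreal (G u v) * emeasure (\<mu> v) (S i))
          = ennreal (G u v) * emeasure (\<mu> v) (\<Union>i. S i)"
        by (simp add: ennreal_suminf_cmult)
    qed
    finally show "(\<Sum>i. ?m (S i)) = ?m (\<Union>i. S i)" by (simp add: m_R)
  qed
qed


section \<open>Driving noise\<close>

text \<open>The index type \<^typ>\<open>real\<close> of a filtration is larger than $[0,\infty)$; only nonnegative times matter.\<close>

definition filtered_prob_space :: "'w measure \<Rightarrow> (real \<Rightarrow> 'w measure) \<Rightarrow> bool" where
  "filtered_prob_space P Fil \<longleftrightarrow>
    prob_space P \<and> filtration (space P) Fil \<and> (\<forall>t. subalgebra P (Fil t))"

text \<open>The density below is that of the centred Gaussian law on $\mathbb{R}^q$ with covariance
  $(t-s)$ times the identity.\<close>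

definition std_brownian :: "'w measure \<Rightarrow> (real \<Rightarrow> 'w \<Rightarrow> real^'q) \<Rightarrow> bool" where
  "std_brownian P W \<longleftrightarrow>
    (\<forall>t\<ge>0. W t \<in> borel_measurable P) \<and>
    (AE \<omega> in P. W 0 \<omega> = 0) \<and>
    (\<forall>n \<tau>. 0 \<le> \<tau> 0 \<and> incseq \<tau> \<longrightarrow>
      prob_space.indep_vars P (\<lambda>_. borel) (\<lambda>i \<omega>. W (\<tau> (Suc i)) \<omega> - W (\<tau> i) \<omega>) {..<n}) \<and>
    (\<forall>s t. 0 \<le> s \<and> s < t \<longrightarrow>
      distributed P lborel (\<lambda>\<omega>. W t \<omega> - W s \<omega>)
        (\<lambda>x. ennreal (\<Prod>i\<in>UNIV. normal_density 0 (sqrt (t - s)) (x $ i)))) \<and>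
    (AE \<omega> in P. continuous_on {0..} (\<lambda>t. W t \<omega>))"

datatype source = InitX real | InitY real | Noise real

text \<open>Mutual independence is independence of the generated $\sigma$-algebras, since the initial
  values and the paths live in different spaces and \<^const>\<open>prob_space.indep_vars\<close> needs one type.\<close>

definition indep_sources ::
    "'w measure \<Rightarrow> (real \<Rightarrow> 'w \<Rightarrow> real^'d) \<Rightarrow> (real \<Rightarrow> 'w \<Rightarrow> real^'d) \<Rightarrow>
     (real \<Rightarrow> real \<Rightarrow> 'w \<Rightarrow> real^'q) \<Rightarrow> bool" where
  "indep_sources P X\<^sub>0 Y\<^sub>0 B \<longleftrightarrow>
    (\<forall>u\<in>{0..1}. X\<^sub>0 u \<in> borel_measurable P \<and> Y\<^sub>0 u \<in> borel_measurable P) \<and>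
    prob_space.indep_sets P
      (\<lambda>s. case s of
          InitX u \<Rightarrow> sets (vimage_algebra (space P) (X\<^sub>0 u) borel)
        | InitY u \<Rightarrow> sets (vimage_algebra (space P) (Y\<^sub>0 u) borel)
        | Noise u \<Rightarrow> sets (vimage_algebra (space P)
            (\<lambda>\<omega>. \<lambda>t\<in>{0..}. B u t \<omega>) (PiM {0..} (\<lambda>_. borel))))
      (InitX ` {0..1} \<union> InitY ` {0..1} \<union> Noise ` {0..1})"


section \<open>The conditions (RD) and (CO)\<close>

type_synonym ('d, 'q) coeff = "real \<Rightarrow> real^'d \<Rightarrow> (real^'d) measure \<Rightarrow> real^'q^'d"

definition RD ::
    "real^'d \<Rightarrow> 'w measure \<Rightarrow> (real \<Rightarrow> real \<Rightarrow> real) \<Rightarrow> (real \<Rightarrow> real \<Rightarrow> real) \<Rightarrow>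
     (real \<Rightarrow> real^'d \<Rightarrow> real^'d) \<Rightarrow> ('d::finite, 'q::finite) coeff \<Rightarrow> ('d::finite, 'q::finite) coeff \<Rightarrow>
     (real \<Rightarrow> 'w \<Rightarrow> real^'d) \<Rightarrow> (real \<Rightarrow> 'w \<Rightarrow> real^'d) \<Rightarrow> bool" where
  "RD x\<^sub>0 P G K b \<sigma> \<theta> X\<^sub>0 Y\<^sub>0 \<longleftrightarrow>
    (\<exists>\<rho> L' L c\<^sub>0. 0 < \<rho> \<and> \<rho> \<le> 1 \<and> 0 < L' \<and> 0 < L \<and> 0 < c\<^sub>0 \<and>
      (\<forall>s t x. \<forall>\<mu>\<in>measures2. 0 \<le> s \<and> s \<le> t \<longrightarrow>
        max (norm (b t x - b s x))
          (max (onorm ((*v) (\<sigma> t x \<mu> - \<sigma> s x \<mu>))) (onorm ((*v) (\<theta> t x \<mu> - \<theta> s x \<mu>))))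
        \<le> L' * (1 + norm x + WOP2 x\<^sub>0 \<mu> (scale_measure (ennreal (mass \<mu>)) (return borel 0)))
            * (t - s) powr \<rho>) \<and>
      (\<forall>t x y. \<forall>\<mu>\<in>measures2. \<forall>\<nu>\<in>measures2. 0 \<le> t \<longrightarrow>
        max (norm (b t x - b t y))
          (max (onorm ((*v) (\<sigma> t x \<mu> - \<sigma> t y \<nu>))) (onorm ((*v) (\<theta> t x \<mu> - \<theta> t y \<nu>))))
        \<le> L * (norm (x - y) + WOP2 x\<^sub>0 \<mu> \<nu>)) \<and>
      (\<forall>t x y. 0 \<le> t \<longrightarrow> (x - y) \<bullet> (b t x - b t y) \<le> - c\<^sub>0 * (norm (x - y))\<^sup>2) \<and>
      c\<^sub>0 - 8 * L\<^sup>2 * real CARD('q) > 0) \<and>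
    (\<lambda>u. distr P borel (X\<^sub>0 u)) \<in> restrict_space borel {0..1} \<rightarrow>\<^sub>M prob_algebra borel \<and>
    (\<lambda>u. distr P borel (Y\<^sub>0 u)) \<in> restrict_space borel {0..1} \<rightarrow>\<^sub>M prob_algebra borel \<and>
    (SUP u\<in>{0..1}. \<integral>\<^sup>+\<omega>. ennreal ((norm (X\<^sub>0 u \<omega>))\<^sup>2) \<partial>P) < \<infinity> \<and>
    (SUP u\<in>{0..1}. \<integral>\<^sup>+\<omega>. ennreal ((norm (Y\<^sub>0 u \<omega>))\<^sup>2) \<partial>P) < \<infinity> \<and>
    max (SUP t\<in>{0..}. ennreal (norm (b t 0)))
      (max
        (SUP t\<in>{0..}. SUP u\<in>{0..1}.
          ennreal (onorm ((*v) (\<sigma> t 0 (graphon_mix G (\<lambda>_. return borel 0) u)))))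
        (SUP t\<in>{0..}. SUP u\<in>{0..1}.
          ennreal (onorm ((*v) (\<theta> t 0 (graphon_mix K (\<lambda>_. return borel 0) u))))))
      < \<infinity>"

definition CO ::
    "'w measure \<Rightarrow> (real \<Rightarrow> real \<Rightarrow> real) \<Rightarrow> (real \<Rightarrow> real \<Rightarrow> real) \<Rightarrow>
     (real \<Rightarrow> real^'d \<Rightarrow> real^'d) \<Rightarrow> ('d::finite, 'q::finite) coeff \<Rightarrow> ('d::finite, 'q::finite) coeff \<Rightarrow>
     (real \<Rightarrow> 'w \<Rightarrow> real^'d) \<Rightarrow> (real \<Rightarrow> 'w \<Rightarrow> real^'d) \<Rightarrow> bool" where
  "CO P G K b \<sigma> \<theta> X\<^sub>0 Y\<^sub>0 \<longleftrightarrow>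
    (\<forall>t\<ge>0. \<exists>l c. linear l \<and> (\<forall>x. b t x = l x + c)) \<and>
    (\<forall>t\<ge>0. \<forall>\<mu>\<in>measures2. \<forall>x y. \<forall>r\<in>{0..1}.
      \<sigma> t (r *\<^sub>R x + (1 - r) *\<^sub>R y) \<mu> \<preceq>\<^sub>m r *\<^sub>R \<sigma> t x \<mu> + (1 - r) *\<^sub>R \<sigma> t y \<mu>) \<and>
    (\<forall>t\<ge>0. \<forall>u\<in>{0..1}. \<forall>x. \<forall>\<mu>\<in>families. \<forall>\<nu>\<in>families. (\<forall>v\<in>{0..1}. \<mu> v \<preceq>\<^sub>c\<^sub>v \<nu> v) \<longrightarrow>
      \<sigma> t x (graphon_mix G \<mu> u) \<preceq>\<^sub>m \<sigma> t x (graphon_mix G \<nu> u)) \<and>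
    (\<forall>t\<ge>0. \<forall>u\<in>{0..1}. \<forall>x. \<forall>\<mu>\<in>families.
      \<sigma> t x (graphon_mix G \<mu> u) \<preceq>\<^sub>m \<theta> t x (graphon_mix K \<mu> u)) \<and>
    (\<forall>u\<in>{0..1}. distr P borel (X\<^sub>0 u) \<preceq>\<^sub>c\<^sub>v distr P borel (Y\<^sub>0 u))"


section \<open>Euler schemes and path functionals\<close>

definition euler_scheme ::
    "'w measure \<Rightarrow> real \<Rightarrow> (real \<Rightarrow> real \<Rightarrow> real) \<Rightarrow> (real \<Rightarrow> real^'d \<Rightarrow> real^'d) \<Rightarrow> ('d::finite, 'q::finite) coeff \<Rightarrow>
     (real \<Rightarrow> real \<Rightarrow> 'w \<Rightarrow> real^'q) \<Rightarrow> (real \<Rightarrow> 'w \<Rightarrow> real^'d) \<Rightarrow>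
     (real \<Rightarrow> real \<Rightarrow> 'w \<Rightarrow> real^'d) \<Rightarrow> bool" where
  "euler_scheme P h G b \<sigma> B X\<^sub>0 X \<longleftrightarrow>
    (\<forall>u\<in>{0..1}. \<forall>\<omega>\<in>space P. X u 0 \<omega> = X\<^sub>0 u \<omega> \<and>
      (\<forall>m::nat. \<forall>t\<in>{real m * h..real (Suc m) * h}.
        X u t \<omega> = X u (real m * h) \<omega>
          + (t - real m * h) *\<^sub>R b (real m * h) (X u (real m * h) \<omega>)
          + \<sigma> (real m * h) (X u (real m * h) \<omega>)
              (graphon_mix G (\<lambda>v. distr P borel (X v (real m * h))) u)
            *v (B u t \<omega> - B u (real m * h) \<omega>)))"

definition num_steps :: "real \<Rightarrow> real \<Rightarrow> nat" where
  "num_steps T h = (if T / h \<in> \<nat> then nat \<lfloor>T / h\<rfloor> else nat \<lfloor>T / h\<rfloor> + 1)"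

definition sampled_path :: "real \<Rightarrow> real \<Rightarrow> (real \<Rightarrow> 'a) \<Rightarrow> nat \<Rightarrow> 'a" where
  "sampled_path T h x m = (if m < num_steps T h then x (real m * h) else x T)"

text \<open>\<^const>\<open>convex_on\<close> does not apply, because function spaces are not an instance of
  \<^class>\<open>real_vector\<close>.\<close>

definition convex_path_functional :: "((nat \<Rightarrow> real^'d) \<Rightarrow> real) \<Rightarrow> bool" where
  "convex_path_functional F \<longleftrightarrow> (\<forall>x y. \<forall>r\<in>{0..1}.
    F (\<lambda>m. r *\<^sub>R x m + (1 - r) *\<^sub>R y m) \<le> r * F x + (1 - r) * F y)"

text \<open>The series may diverge, in which case it is $\infty$ and the bound is void.\<close>

definition quadratic_growth :: "real \<Rightarrow> real \<Rightarrow> ((nat \<Rightarrow> real^'d) \<Rightarrow> real) \<Rightarrow> bool" where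
  "quadratic_growth l h F \<longleftrightarrow> (\<exists>C>0. \<forall>x.
    ennreal \<bar>F x\<bar> \<le> ennreal C *
      (1 + (\<Sum>m. ennreal (exp (- l * (real m * h)) * (((norm (x m))\<^sup>2 + (norm (x (Suc m)))\<^sup>2) / 2) * h))))"

end

theory Submission
  imports Defs
begin

text \<open>The laws of the first \<open>n\<close> steps of the two schemes are compared on all convex functions of quadratic
  growth, for all labels at once, by induction on \<open>n\<close>. Integrating a convex function \<open>f\<close> of \<open>n + 1\<close>
  steps over the next Gaussian increment gives a function of \<open>n\<close> steps which is again convex,
  because the drift is affine and \<open>\<sigma>\<close> is convex for the order \<open>\<preceq>\<^sub>m\<close>, and which increases when
  \<open>\<sigma>\<close> is replaced by \<open>\<theta>\<close>. Both facts rest on \<open>E f(AZ) \<le> E f(BZ)\<close> for \<open>A \<preceq>\<^sub>m B\<close>: by Douglas' lemma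
  \<open>A = BR\<close> for a contraction \<open>R\<close>, by the Krein--Milman theorem \<open>R\<close> is a convex combination of orthogonal
  matrices, and the law of \<open>Z\<close> is invariant under these.

  The hypotheses on \<open>\<sigma>\<close> apply only to measurable families of laws. That \<open>u \<mapsto> \<sigma>(t, x, [G\<mu>]\<^sup>u)\<close> is
  measurable follows from its continuity for the pseudometric \<open>\<integral>|G(u,v) - G(u',v)| dv\<close>, which is
  separable since \<open>L\<^sup>1([0,1])\<close> is.\<close>

subsection \<open>Contractions and Gaussian integrals of convex functions\<close>

text \<open>The induction step is asymmetric. With \<open>g\<close> the integral of \<open>f\<close>
  over one step driven by \<open>\<sigma>\<close>, and \<open>g'\<close> the one driven by
  \<open>\<theta>\<close>, it reads
  \<open>E f(X) = E g(X) \<le> E g(Y) \<le> E g'(Y) = E f(Y)\<close>. The induction hypothesis is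
  applied to \<open>g\<close>, so only \<open>g\<close> has to be convex, and (CO) demands convexity
  in \<open>x\<close> of \<open>\<sigma>\<close> alone. All labels advance together because the
  coefficient at one label depends on the laws at all of them. Three obstacles shape the rest. The
  convex order quantifies over all convex functions, while the induction handles those of quadratic
  growth, whose integrals are finite; the order has to be recovered from these. The laws enter
  through mixtures whose mass varies with the label, and \<open>WOP2\<close> normalises them, which
  degenerates where the mass vanishes; so the estimates in the label are only pointwise and zero
  mass is a separate case. Finally \<open>F\<close> sees infinitely many coordinates: freezing the
  path at the last step leaves finitely many, and the exponential weight makes the tail a geometric
  series.\<close>

abbreviation moment2 :: "'a::euclidean_space measure \<Rightarrow> ennreal" where
  "moment2 \<mu> \<equiv> (\<integral>\<^sup>+x. ennreal ((norm x)\<^sup>2) \<partial>\<mu>)"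

text \<open>The image measure is translation invariant because the map is linear and onto, and it
  gives the unit ball its Lebesgue measure because the map preserves norms. Two invariant measures
  that agree on one set of finite positive measure are equal.\<close>

lemma lborel_orthogonal_invariant:
  fixes f :: "'a::euclidean_space \<Rightarrow> 'a"
  assumes f: "orthogonal_transformation f"
  shows "distr lborel borel f = lborel"
proof (rule measure_eqI)
  show "sets (distr lborel borel f) = sets lborel" by simp
  define \<mu> where "\<mu> = distr lborel borel f"
  have lin: "linear f" using f by (rule orthogonal_transformation_linear)
  have fm [measurable]: "f \<in> borel_measurable borel"
    using lin by (intro borel_measurable_continuous_onI linear_continuous_on) (simp add: linear_conv_bounded_linear)
  have finv: "bij f" using f by (rule orthogonal_transformation_bij)
  have trans: "(\<integral>\<^sup>+y. g (x + y) \<partial>(lborel::'a measure)) = (\<integral>\<^sup>+y. g y \<partial>lborel)"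
    if [measurable]: "g \<in> borel_measurable borel" for g :: "'a \<Rightarrow> ennreal" and x
    by (subst (2) lborel_distr_plus[of x, symmetric]) (simp add: nn_integral_distr)
  have mu_trans: "(\<integral>\<^sup>+y. g (x + y) \<partial>\<mu>) = (\<integral>\<^sup>+y. g y \<partial>\<mu>)"
    if [measurable]: "g \<in> borel_measurable borel" for g :: "'a \<Rightarrow> ennreal" and x
  proof -
    obtain z where z: "x = f z" using finv by (metis bij_pointE)
    have "(\<integral>\<^sup>+y. g (x + y) \<partial>\<mu>) = (\<integral>\<^sup>+y. g (f (z + y)) \<partial>lborel)"
      unfolding \<mu>_def z using lin by (subst nn_integral_distr) (auto simp: linear_add)
    also have "\<dots> = (\<integral>\<^sup>+y. g (f y) \<partial>lborel)" by (rule trans) simp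
    finally show ?thesis by (simp add: \<mu>_def nn_integral_distr)
  qed
  let ?U = "ball (0::'a) 1"
  have norm_f: "norm (f y) = norm y" for y using f by (simp add: orthogonal_transformation_norm)
  have ballU: "emeasure \<mu> ?U = emeasure lborel ?U"
    unfolding \<mu>_def by (subst emeasure_distr) (auto simp: norm_f intro!: arg_cong[where f="emeasure lborel"])
  \<comment> \<open>Needed for Fubini: centred balls are their own preimages, so they keep their
    finite measure, and they exhaust the space.\<close>
  have sf: "sigma_finite_measure \<mu>"
  proof
    let ?A = "range (\<lambda>n::nat. ball (0::'a) (real n))"
    have "emeasure \<mu> (ball 0 (real n)) \<noteq> \<infinity>" for n
    proof -
      have "emeasure \<mu> (ball 0 (real n)) = emeasure lborel (ball (0::'a) (real n))"
        unfolding \<mu>_def by (subst emeasure_distr) (auto simp: norm_f intro!: arg_cong[where f="emeasure lborel"])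
      then show ?thesis using emeasure_lborel_ball_finite[of "0::'a" "real n"] by simp
    qed
    moreover have "\<Union>?A = space \<mu>"
      by (auto simp: \<mu>_def) (meson reals_Archimedean2)
    ultimately show "\<exists>A. countable A \<and> A \<subseteq> sets \<mu> \<and> \<Union> A = space \<mu> \<and> (\<forall>a\<in>A. emeasure \<mu> a \<noteq> \<infinity>)"
      by (intro exI[of _ ?A]) (auto simp: \<mu>_def)
  qed
  interpret pair_sigma_finite lborel \<mu>
    using sf by (simp add: pair_sigma_finite_def sigma_finite_lborel)
  have sets_mu [measurable_cong]: "sets \<mu> = sets borel" by (simp add: \<mu>_def)
  fix A assume "A \<in> sets (distr lborel borel f)"
  then have A[measurable]: "A \<in> sets borel" by simp
  have m1: "(\<lambda>p. fst p + snd p) \<in> lborel \<Otimes>\<^sub>M \<mu> \<rightarrow>\<^sub>M borel" by measurable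
  have m2: "(\<lambda>p. fst p - snd p) \<in> lborel \<Otimes>\<^sub>M \<mu> \<rightarrow>\<^sub>M borel" by measurable
  txt \<open>Uniqueness of Haar measure: compute the double integral of \<open>1\<^sub>U(x) 1\<^sub>A(x + y)\<close> in both orders.\<close>
  have "emeasure \<mu> A * emeasure lborel ?U
      = (\<integral>\<^sup>+x. indicator ?U x * (\<integral>\<^sup>+y. indicator A (x + y) \<partial>\<mu>) \<partial>lborel)"
    by (subst mu_trans) (simp_all add: sets_mu mult.commute[of "indicator _ _"] nn_integral_cmult_indicator)
  also have "\<dots> = (\<integral>\<^sup>+x. (\<integral>\<^sup>+y. indicator ?U x * indicator A (x + y) \<partial>\<mu>) \<partial>lborel)"
    by (simp add: nn_integral_cmult)
  also have "\<dots> = (\<integral>\<^sup>+y. (\<integral>\<^sup>+x. indicator ?U x * indicator A (x + y) \<partial>lborel) \<partial>\<mu>)"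
  proof (rule Fubini'[symmetric])
    have "(\<lambda>p. indicator ?U (fst p) * indicator A (fst p + snd p) :: ennreal) \<in> borel_measurable (lborel \<Otimes>\<^sub>M \<mu>)"
      by (intro borel_measurable_times_ennreal measurable_compose[OF m1 borel_measurable_indicator]
          measurable_compose[OF measurable_fst borel_measurable_indicator]) simp_all
    then show "(\<lambda>(x, y). indicator ?U x * indicator A (x + y) :: ennreal) \<in> borel_measurable (lborel \<Otimes>\<^sub>M \<mu>)"
      by (simp add: split_beta')
  qed
  also have "\<dots> = (\<integral>\<^sup>+y. (\<integral>\<^sup>+x. indicator ?U (x - y) * indicator A x \<partial>lborel) \<partial>\<mu>)"
  proof (rule nn_integral_cong)
    fix y
    show "(\<integral>\<^sup>+x. indicator ?U x * indicator A (x + y) \<partial>lborel) = (\<integral>\<^sup>+x. indicator ?U (x - y) * indicator A x \<partial>lborel)"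
    proof -
      have "(\<lambda>x. indicator ?U (x - y) * indicator A x :: ennreal) \<in> borel_measurable borel"
      proof (rule borel_measurable_times_ennreal)
        have "(indicator ?U :: 'a \<Rightarrow> ennreal) \<in> borel_measurable borel"
          by (intro borel_measurable_indicator borel_open open_ball)
        then show "(\<lambda>x. indicator ?U (x - y) :: ennreal) \<in> borel_measurable borel"
          by (rule measurable_compose[rotated]) simp
      qed (rule borel_measurable_indicator[OF A])
      from trans[OF this, of y] show ?thesis by (simp add: add.commute)
    qed
  qed
  also have "\<dots> = (\<integral>\<^sup>+x. (\<integral>\<^sup>+y. indicator ?U (x - y) * indicator A x \<partial>\<mu>) \<partial>lborel)"
  proof (rule Fubini')
    have "(\<lambda>p. indicator ?U (fst p - snd p) * indicator A (fst p) :: ennreal) \<in> borel_measurable (lborel \<Otimes>\<^sub>M \<mu>)"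
      by (intro borel_measurable_times_ennreal measurable_compose[OF m2 borel_measurable_indicator]
          measurable_compose[OF measurable_fst borel_measurable_indicator]) simp_all
    then show "(\<lambda>(x, y). indicator ?U (x - y) * indicator A x :: ennreal) \<in> borel_measurable (lborel \<Otimes>\<^sub>M \<mu>)"
      by (simp add: split_beta')
  qed
  also have "\<dots> = (\<integral>\<^sup>+x. emeasure \<mu> ?U * indicator A x \<partial>lborel)"
  proof (rule nn_integral_cong)
    fix x
    have [measurable]: "?U \<in> sets borel" by simp
    \<comment> \<open>The ball is symmetric, so \<open>x - y\<close> may be replaced by
      \<open>- x + y\<close>, to which invariance of \<open>\<mu>\<close> applies.\<close>
    have "(\<integral>\<^sup>+y. indicator ?U (x - y) * indicator A x \<partial>\<mu>) = (\<integral>\<^sup>+y. indicator ?U (- x + y) \<partial>\<mu>) * indicator A x"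
      by (subst nn_integral_multc[symmetric]) (auto intro!: nn_integral_cong simp: indicator_def norm_minus_commute)
    also have "(\<integral>\<^sup>+y. indicator ?U (- x + y) \<partial>\<mu>) = emeasure \<mu> ?U"
      by (subst mu_trans) (simp_all add: sets_mu borel_measurable_indicator)
    finally show "(\<integral>\<^sup>+y. indicator ?U (x - y) * indicator A x \<partial>\<mu>) = emeasure \<mu> ?U * indicator A x" .
  qed
  also have "\<dots> = emeasure lborel A * emeasure lborel ?U"
    by (subst nn_integral_cmult_indicator) (simp_all add: ballU mult.commute)
  finally have "emeasure \<mu> A * emeasure lborel ?U = emeasure lborel A * emeasure lborel ?U" .
  moreover have "emeasure lborel ?U \<noteq> \<infinity>" using emeasure_lborel_ball_finite[of "0::'a" 1] by simp
  moreover have "emeasure lborel ?U \<noteq> 0"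
  proof
    assume "emeasure lborel ?U = 0"
    then have "?U \<in> null_sets lborel" by (auto intro!: null_setsI)
    then have "?U \<in> null_sets lebesgue" by (rule null_sets_completionI)
    then have "negligible ?U" by (simp add: negligible_iff_null_sets)
    then show False using open_not_negligible[of ?U] by simp
  qed
  ultimately have "emeasure \<mu> A = emeasure lborel A"
    by (metis ennreal_mult_cancel_left infinity_ennreal_def mult.commute)
  then show "emeasure (distr lborel borel f) A = emeasure lborel A" by (simp add: \<mu>_def)
qed

section \<open>Centred Gaussian laws, parametrised by the standard deviation\<close>

definition gauss :: "real \<Rightarrow> (real^'q) measure" where
  "gauss s = density lborel (\<lambda>x. ennreal (\<Prod>i\<in>UNIV. normal_density 0 s (x $ i)))"

lemma sets_gauss [measurable_cong, simp]: "sets (gauss s) = sets borel"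
  and space_gauss [simp]: "space (gauss s) = UNIV"
  by (simp_all add: gauss_def)

text \<open>The product of the one-dimensional densities is a function of the norm of
  \<open>x\<close> alone, so an orthogonal map preserves both the density and Lebesgue
  measure.\<close>

lemma gauss_orthogonal_invariant:
  fixes f :: "real^'q \<Rightarrow> real^'q"
  assumes f: "orthogonal_transformation f"
  shows "distr (gauss s) borel f = gauss s"
proof -
  have lin: "linear f" using f by (rule orthogonal_transformation_linear)
  have fm [measurable]: "f \<in> borel_measurable borel"
    using lin by (intro borel_measurable_continuous_onI linear_continuous_on) (simp add: linear_conv_bounded_linear)
  define c where "c = (1 / sqrt (2 * pi * s\<^sup>2)) ^ CARD('q)"
  have dens: "(\<Prod>i\<in>UNIV. normal_density 0 s (x $ i)) = c * exp (- ((norm x)\<^sup>2 / (2 * s\<^sup>2)))" for x :: "real^'q"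
    by (simp add: normal_density_def prod.distrib prod_dividef c_def exp_sum[symmetric] sum_negf norm_vec_def L2_set_def
        sum_nonneg sum_divide_distrib power_one_over)
  define g :: "real^'q \<Rightarrow> ennreal" where "g = (\<lambda>x. ennreal (\<Prod>i\<in>UNIV. normal_density 0 s (x $ i)))"
  have gm [measurable]: "g \<in> borel_measurable borel" unfolding g_def by measurable
  have gf: "g (f x) = g x" for x
    using f by (simp add: g_def dens orthogonal_transformation_norm)
  show ?thesis
  proof (rule measure_eqI)
    fix A assume "A \<in> sets (distr (gauss s) borel f)"
    then have [measurable]: "A \<in> sets borel" by simp
    have "emeasure (distr (gauss s) borel f) A = emeasure (gauss s) (f -` A)"
      by (simp add: emeasure_distr)
    also have "\<dots> = (\<integral>\<^sup>+x. g x * indicator (f -` A) x \<partial>lborel)"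
      unfolding gauss_def g_def[symmetric] by (rule emeasure_density) (simp_all add: measurable_sets_borel[OF fm])
    also have "\<dots> = (\<integral>\<^sup>+x. g (f x) * indicator A (f x) \<partial>lborel)"
      by (auto simp: gf indicator_def intro!: nn_integral_cong)
    also have "\<dots> = (\<integral>\<^sup>+x. g x * indicator A x \<partial>distr lborel borel f)"
      by (simp add: nn_integral_distr)
    also have "\<dots> = emeasure (gauss s) A"
      by (simp add: lborel_orthogonal_invariant[OF f] gauss_def g_def[symmetric] emeasure_density)
    finally show "emeasure (distr (gauss s) borel f) A = emeasure (gauss s) A" .
  qed simp
qed

lemma nn_integral_lborel_vec_prod:
  fixes f :: "'q::finite \<Rightarrow> real \<Rightarrow> ennreal"
  assumes [measurable]: "\<And>i. f i \<in> borel_measurable borel"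
  shows "(\<integral>\<^sup>+x. (\<Prod>i\<in>UNIV. f i (x $ i)) \<partial>(lborel::(real^'q) measure)) = (\<Prod>i\<in>UNIV. \<integral>\<^sup>+x. f i x \<partial>lborel)"
proof -
  \<comment> \<open>Passes from coordinates to basis vectors as indices: each element of
    \<open>Basis\<close> is \<open>axis i 1\<close> for exactly one \<open>i\<close>, which the
    choice operator recovers.\<close>
  define h where "h b = f (SOME i. b = axis i (1::real))" for b :: "real^'q"
  have B: "Basis = range (\<lambda>i. axis i (1::real) :: real^'q)" by (auto simp: Basis_vec_def)
  have inj: "inj (\<lambda>i. axis i (1::real) :: real^'q)" by (auto simp: inj_def axis_eq_axis)
  have ai: "(SOME j. axis i (1::real) = (axis j 1 :: real^'q)) = i" for i
    by (auto simp: axis_eq_axis)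
  have [measurable]: "h b \<in> borel_measurable borel" for b by (simp add: h_def)
  have "(\<integral>\<^sup>+x. (\<Prod>b\<in>Basis. h b (x \<bullet> b)) \<partial>(lborel::(real^'q) measure)) = (\<Prod>b\<in>Basis. \<integral>\<^sup>+x. h b x \<partial>lborel)"
    by (rule nn_integral_lborel_prod) auto
  then show ?thesis
    unfolding B by (simp add: prod.reindex[OF inj] h_def ai inner_axis)
qed

lemma prob_space_gauss:
  assumes "0 < s" shows "prob_space (gauss s :: (real^'q) measure)"
proof
  have "emeasure (gauss s) (space (gauss s :: (real^'q) measure))
      = (\<integral>\<^sup>+x. (\<Prod>i\<in>UNIV. ennreal (normal_density 0 s (x $ i))) \<partial>(lborel::(real^'q) measure))"
    by (simp add: gauss_def emeasure_density prod_ennreal)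
  also have "\<dots> = 1"
    using prob_space.emeasure_space_1[OF prob_space_normal_density[OF assms, of 0]]
    by (subst nn_integral_lborel_vec_prod) (simp_all add: emeasure_density)
  finally show "emeasure (gauss s) (space (gauss s :: (real^'q) measure)) = 1" .
qed

text \<open>The squared norm is a sum over coordinates, and the square of one coordinate can be
  absorbed into its own factor of the density. Only the one-dimensional second moment remains, the
  other factors integrating to 1.\<close>

lemma gauss_second_moment:
  assumes s: "0 < s"
  shows "moment2 (gauss s :: (real^'q) measure) < \<infinity>"
proof -
  have 1: "(\<integral>\<^sup>+x. ennreal (normal_density 0 s x) \<partial>lborel) = 1"
    using prob_space.emeasure_space_1[OF prob_space_normal_density[OF s, of 0]] by (simp add: emeasure_density)
  have 2: "(\<integral>\<^sup>+x. ennreal (x\<^sup>2 * normal_density 0 s x) \<partial>lborel) < \<infinity>"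
  proof -
    have "integrable lborel (\<lambda>x. normal_density 0 s x * (x - 0)^2)"
      using s by (rule integrable_normal_moment)
    then have "(\<integral>\<^sup>+x. ennreal (norm (normal_density 0 s x * (x - 0)^2)) \<partial>lborel) < \<infinity>"
      by (simp add: integrable_iff_bounded)
    then show ?thesis by (simp add: mult.commute abs_mult)
  qed
  have comp: "(\<integral>\<^sup>+x. ennreal ((x $ i)\<^sup>2) \<partial>(gauss s :: (real^'q) measure)) < \<infinity>" for i
  proof -
    define f where "f j = (\<lambda>y. ennreal (if j = i then y\<^sup>2 * normal_density 0 s y else normal_density 0 s y))" for j
    have f: "f j = (if j = i then (\<lambda>y. ennreal (y\<^sup>2 * normal_density 0 s y)) else (\<lambda>y. ennreal (normal_density 0 s y)))" for j
      by (auto simp: f_def)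
    have [measurable]: "f j \<in> borel_measurable borel" for j by (auto simp: f)
    have eq: "ennreal (\<Prod>j\<in>UNIV. normal_density 0 s (x $ j)) * ennreal ((x $ i)\<^sup>2) = (\<Prod>j\<in>UNIV. f j (x $ j))" for x
    proof -
      have "(\<Prod>j\<in>UNIV. f j (x $ j)) = ennreal (\<Prod>j\<in>UNIV. (if j = i then (x$j)\<^sup>2 else 1) * normal_density 0 s (x $ j))"
        unfolding f_def by (subst prod_ennreal) (auto intro!: arg_cong[where f=ennreal] prod.cong)
      also have "\<dots> = ennreal ((x$i)\<^sup>2 * (\<Prod>j\<in>UNIV. normal_density 0 s (x $ j)))"
        by (simp add: prod.distrib)
      finally show ?thesis by (simp add: ennreal_mult'' mult.commute prod_nonneg)
    qed
    have "(\<integral>\<^sup>+x. ennreal ((x $ i)\<^sup>2) \<partial>(gauss s :: (real^'q) measure)) = (\<Prod>j\<in>UNIV. \<integral>\<^sup>+x. f j x \<partial>lborel)"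
      unfolding gauss_def by (subst nn_integral_density) (simp_all add: eq nn_integral_lborel_vec_prod)
    also have "\<dots> < \<infinity>"
    proof -
      have fin: "(\<integral>\<^sup>+x. f j x \<partial>lborel) < \<infinity>" for j
        using 1 2 by (auto simp: f)
      have "(\<Prod>j\<in>J. \<integral>\<^sup>+x. f j x \<partial>lborel) < \<infinity>" for J
        using fin by (induction J rule: infinite_finite_induct) (auto simp: ennreal_mult_less_top)
      then show ?thesis .
    qed
    finally show ?thesis .
  qed
  have "(\<integral>\<^sup>+x. ennreal ((norm x)\<^sup>2) \<partial>(gauss s :: (real^'q) measure))
      = (\<integral>\<^sup>+x. (\<Sum>i\<in>UNIV. ennreal ((x $ i)\<^sup>2)) \<partial>(gauss s :: (real^'q) measure))"
    by (simp add: sum_ennreal norm_vec_def L2_set_def sum_nonneg)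
  also have "\<dots> = (\<Sum>i\<in>UNIV. \<integral>\<^sup>+x. ennreal ((x $ i)\<^sup>2) \<partial>(gauss s :: (real^'q) measure))"
    by (rule nn_integral_sum) simp
  also have "\<dots> < \<infinity>" using comp by (simp add: less_top)
  finally show ?thesis .
qed

section \<open>Matrices of operator norm at most 1 and orthogonal matrices\<close>

lemma all_quadratic_nonneg_imp_zero:
  fixes a b :: real
  assumes "\<And>t. 0 \<le> 2 * t * a + t\<^sup>2 * b"
  shows "a = 0"
proof (rule ccontr)
  assume a: "a \<noteq> 0"
  \<comment> \<open>At \<open>t = - e * a\<close> the quadratic equals
    \<open>e * a^2 * (e * b - 2)\<close>, which is negative once \<open>e * b < 2\<close>; this
    \<open>e\<close> makes \<open>e * |b|\<close> even less than 1.\<close>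
  define e where "e = 1 / (1 + \<bar>b\<bar>)"
  have e: "0 < e" "e * \<bar>b\<bar> < 1" by (auto simp: e_def field_simps)
  have "0 \<le> 2 * (- e * a) * a + (- e * a)\<^sup>2 * b" by (rule assms)
  also have "\<dots> = e * a\<^sup>2 * (e * b - 2)" by (simp add: power2_eq_square algebra_simps)
  also have "\<dots> < 0"
  proof -
    have "e * b \<le> e * \<bar>b\<bar>" using e by (intro mult_left_mono) auto
    then have "e * b - 2 < 0" using e by linarith
    moreover have "0 < e * a\<^sup>2" using e a by simp
    ultimately show ?thesis by (rule mult_pos_neg[rotated])
  qed
  finally show False by simp
qed

lemma matrix_outer_mult_vec: "(\<chi> i j. w $ i * v $ j) *v x = (v \<bullet> x) *\<^sub>R (w :: real^'q)"
  by (simp add: vec_eq_iff matrix_vector_mult_def inner_vec_def sum_distrib_left mult_ac)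

lemma norm_orthogonal_sum_sq: "x \<bullet> y = 0 \<Longrightarrow> (norm (x + y))\<^sup>2 = (norm x)\<^sup>2 + (norm (y::'a::real_inner))\<^sup>2"
  by (simp add: power2_norm_eq_inner inner_add_left inner_add_right inner_commute)

text \<open>An extreme point \<open>R\<close> of the unit ball is an isometry: if \<open>v\<close> minimises \<open>|Rv|\<close> over the unit
  sphere and \<open>|Rv| < 1\<close>, then \<open>Rv\<close> is orthogonal to \<open>R(v\<^sup>\<bottom>)\<close>, so \<open>R\<close> can be perturbed in both
  directions along a rank one matrix \<open>w v\<^sup>T\<close>.\<close>

lemma contraction_extreme_point_isometry:
  fixes R :: "real^'q^'q"
  assumes ext: "R extreme_point_of {R. \<forall>x. norm (R *v x) \<le> norm x}"
  shows "orthogonal_transformation ((*v) R)"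
proof (rule ccontr)
  assume not_orth: "\<not> orthogonal_transformation ((*v) R)"
  have contr: "norm (R *v x) \<le> norm x" for x using ext by (auto simp: extreme_point_of_def)
  have cont: "continuous_on S (\<lambda>x. norm (R *v x))" for S
    by (intro continuous_intros linear_continuous_on) (simp add: matrix_vector_mul_bounded_linear)
  obtain v where v: "norm v = 1" and vmin: "\<And>x. norm x = 1 \<Longrightarrow> norm (R *v v) \<le> norm (R *v x)"
  proof -
    obtain k :: 'q where True by simp
    have "sphere (0::real^'q) 1 \<noteq> {}" using norm_axis_1[of k] by (metis dist_0_norm empty_iff mem_sphere)
    then show ?thesis
      using that continuous_attains_inf[OF compact_sphere _ cont, of "0::real^'q" 1] by (auto simp: dist_norm)
  qed
  define c where "c = norm (R *v v)"
  have c_le: "c * norm x \<le> norm (R *v x)" for x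
  proof (cases "x = 0")
    case False
    have "c \<le> norm (R *v (x /\<^sub>R norm x))" unfolding c_def using False by (intro vmin) simp
    then show ?thesis using False by (simp add: matrix_vector_mult_scaleR field_simps)
  qed simp
  have c0: "0 \<le> c" by (simp add: c_def)
  have c1: "c < 1"
  proof (rule ccontr)
    assume "\<not> c < 1"
    then have "norm (R *v x) = norm x" for x
      using c_le[of x] contr[of x] mult_right_mono[of 1 c "norm x"] by simp
    then show False using not_orth by (simp add: orthogonal_transformation)
  qed
  \<comment> \<open>First-order condition: \<open>c * |x|\<close> is a lower bound for
    \<open>|R x|\<close> that is attained at \<open>v\<close>, so along \<open>v + t y\<close> the
    difference of the squares has a minimum at \<open>t = 0\<close>.\<close>
  have Rorth: "(R *v v) \<bullet> (R *v y) = 0" if y: "v \<bullet> y = 0" for y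
  proof (rule all_quadratic_nonneg_imp_zero)
    fix t :: real
    have "(c * norm (v + t *\<^sub>R y))\<^sup>2 \<le> (norm (R *v (v + t *\<^sub>R y)))\<^sup>2"
      using c_le[of "v + t *\<^sub>R y"] c0 by (intro power_mono) auto
    moreover have "(norm (v + t *\<^sub>R y))\<^sup>2 = 1 + t\<^sup>2 * (norm y)\<^sup>2"
      using y v by (subst norm_orthogonal_sum_sq) (auto simp: power_mult_distrib)
    moreover have "(norm (R *v (v + t *\<^sub>R y)))\<^sup>2 = c\<^sup>2 + 2 * t * ((R *v v) \<bullet> (R *v y)) + t\<^sup>2 * (norm (R *v y))\<^sup>2"
      unfolding matrix_vector_right_distrib matrix_vector_mult_scaleR c_def power2_norm_eq_inner
      by (simp add: inner_add_left inner_add_right inner_commute power2_eq_square algebra_simps)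
    ultimately show "0 \<le> 2 * t * ((R *v v) \<bullet> (R *v y)) + t\<^sup>2 * ((norm (R *v y))\<^sup>2 - c\<^sup>2 * (norm y)\<^sup>2)"
      by (simp add: power_mult_distrib algebra_simps)
  qed
  obtain w where w: "norm w = 1" and Rv: "R *v v = c *\<^sub>R w" and worth: "\<And>y. v \<bullet> y = 0 \<Longrightarrow> w \<bullet> (R *v y) = 0"
  proof (cases "c = 0")
    case False
    show ?thesis
    proof (rule that[of "(R *v v) /\<^sub>R c"])
      show "norm ((R *v v) /\<^sub>R c) = 1" using False c0 by (simp add: c_def)
    qed (use False Rorth in auto)
  next
    \<comment> \<open>Now \<open>R\<close> annihilates \<open>v\<close>, so it is not onto, and a
      unit vector orthogonal to its range can serve as \<open>w\<close>.\<close>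
    case True
    then have Rv0: "R *v v = 0" by (simp add: c_def)
    have lin: "linear ((*v) R)" by simp
    have "\<not> inj ((*v) R)"
      using Rv0 v by (metis injD matrix_vector_mult_0_right norm_zero zero_neq_one)
    then have "\<not> surj ((*v) R)" using linear_surjective_imp_injective[OF lin] by blast
    moreover have "span (range ((*v) R)) = range ((*v) R)"
      using linear_subspace_image[OF lin subspace_UNIV] by (simp only: span_eq_iff)
    ultimately have "span (range ((*v) R)) \<subset> span UNIV"
      by (metis psubsetI span_UNIV subset_UNIV)
    then obtain z where z: "z \<noteq> 0" "\<And>y. y \<in> span (range ((*v) R)) \<Longrightarrow> orthogonal z y"
      by (rule orthogonal_to_subspace_exists_gen) blast
    show ?thesis
    proof (rule that[of "z /\<^sub>R norm z"])
      show "(z /\<^sub>R norm z) \<bullet> (R *v y) = 0" for y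
        using z(2)[of "R *v y"] by (simp add: orthogonal_def span_base)
    qed (use z Rv0 True in auto)
  qed
  define P :: "real^'q^'q" where "P = (\<chi> i j. w $ i * v $ j)"
  have Pv: "P *v x = (v \<bullet> x) *\<^sub>R w" for x unfolding P_def by (rule matrix_outer_mult_vec)
  \<comment> \<open>The perturbation changes the factor on \<open>v\<close> from \<open>c\<close> to
    \<open>c + e = 1\<close> or to \<open>c - e = 2 c - 1\<close>; both lie in
    \<open>[-1, 1]\<close> since \<open>0 \<le> c < 1\<close>.\<close>
  define e where "e = 1 - c"
  have in_ball: "norm ((R + s *\<^sub>R P) *v x) \<le> norm x" if s: "\<bar>c + s\<bar> \<le> 1" for s x
  proof -
    define a where "a = v \<bullet> x"
    define y where "y = x - a *\<^sub>R v"
    have vv: "v \<bullet> v = 1" using v by (simp add: norm_eq_1)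
    have y: "v \<bullet> y = 0" by (simp add: y_def a_def inner_diff_right vv)
    have x: "x = a *\<^sub>R v + y" by (simp add: y_def)
    have "(R + s *\<^sub>R P) *v x = ((c + s) * a) *\<^sub>R w + R *v y"
      by (simp add: x matrix_vector_mult_add_rdistrib scaleR_matrix_vector_assoc[symmetric] Pv
          matrix_vector_right_distrib matrix_vector_mult_scaleR Rv inner_add_right vv y algebra_simps)
    then have "(norm ((R + s *\<^sub>R P) *v x))\<^sup>2 = ((c + s) * a)\<^sup>2 + (norm (R *v y))\<^sup>2"
      using worth[OF y] w by (simp add: norm_orthogonal_sum_sq power_mult_distrib)
    also have "\<dots> \<le> a\<^sup>2 + (norm y)\<^sup>2"
    proof (rule add_mono)
      have "\<bar>(c + s) * a\<bar> \<le> 1 * \<bar>a\<bar>" unfolding abs_mult using s by (rule mult_right_mono) simp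
      then show "((c + s) * a)\<^sup>2 \<le> a\<^sup>2" by (simp add: abs_le_square_iff)
      show "(norm (R *v y))\<^sup>2 \<le> (norm y)\<^sup>2" using contr[of y] by (intro power_mono) auto
    qed
    also have "\<dots> = (norm x)\<^sup>2"
      unfolding x using y v by (subst norm_orthogonal_sum_sq) (auto simp: power_mult_distrib)
    finally show ?thesis by (rule power2_le_imp_le) simp
  qed
  have "R + e *\<^sub>R P \<in> {R. \<forall>x. norm (R *v x) \<le> norm x}" "R + (- e) *\<^sub>R P \<in> {R. \<forall>x. norm (R *v x) \<le> norm x}"
    using c0 c1 by (auto intro!: in_ball simp only: mem_Collect_eq) (auto simp: e_def)
  moreover have "R \<in> open_segment (R + e *\<^sub>R P) (R + (- e) *\<^sub>R P)"
  proof -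
    have "P \<noteq> 0"
    proof
      assume "P = 0"
      then have "w = 0" using Pv[of v] v by auto
      then show False using w by simp
    qed
    then have "R + e *\<^sub>R P \<noteq> R + (- e) *\<^sub>R P" using c1 by (auto simp: e_def)
    moreover have "R = midpoint (R + e *\<^sub>R P) (R + (- e) *\<^sub>R P)"
      by (simp add: midpoint_def algebra_simps flip: scaleR_2)
    ultimately show ?thesis using midpoint_in_open_segment by metis
  qed
  ultimately show False using ext unfolding extreme_point_of_def by blast
qed

lemma convex_contractions: "convex {R :: real^'q^'q. \<forall>x. norm (R *v x) \<le> norm x}"
proof (rule convexI, safe)
  fix A B :: "real^'q^'q" and u v :: real and x
  assume A: "\<forall>x. norm (A *v x) \<le> norm x" and B: "\<forall>x. norm (B *v x) \<le> norm x"
    and uv: "0 \<le> u" "0 \<le> v" "u + v = 1"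
  have "norm ((u *\<^sub>R A + v *\<^sub>R B) *v x) \<le> u * norm (A *v x) + v * norm (B *v x)"
    using uv norm_triangle_ineq[of "u *\<^sub>R (A *v x)" "v *\<^sub>R (B *v x)"]
    by (simp add: matrix_vector_mult_add_rdistrib scaleR_matrix_vector_assoc[symmetric])
  also have "\<dots> \<le> u * norm x + v * norm x"
    using A B uv by (intro add_mono mult_left_mono) auto
  finally show "norm ((u *\<^sub>R A + v *\<^sub>R B) *v x) \<le> norm x"
    using uv by (simp flip: distrib_right)
qed

text \<open>In finite dimension a compact convex set is the convex hull of its extreme points
  without taking a closure, so no limit has to be exchanged with an integral later.\<close>

lemma contraction_in_convex_hull_orthogonal:
  fixes R :: "real^'q^'q"
  assumes "\<And>x. norm (R *v x) \<le> norm x"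
  shows "R \<in> convex hull {Q. orthogonal_transformation ((*v) Q)}"
proof -
  let ?S = "{R :: real^'q^'q. \<forall>x. norm (R *v x) \<le> norm x}"
  have lin: "bounded_linear (\<lambda>A :: real^'q^'q. A *v x)" for x
    unfolding linear_conv_bounded_linear[symmetric]
    by (rule linearI) (simp_all add: matrix_vector_mult_add_rdistrib scaleR_matrix_vector_assoc)
  have "closed ?S"
    by (intro closed_Collect_all closed_Collect_le continuous_intros linear_continuous_on lin)
  moreover have "bounded ?S"
  proof (rule boundedI)
    fix R :: "real^'q^'q" assume R: "R \<in> ?S"
    have "\<bar>R $ i $ j\<bar> \<le> 1" for i j
    proof -
      have "\<bar>(R *v axis j 1) $ i\<bar> \<le> norm (R *v axis j 1)" by (rule component_le_norm_cart)
      also have "\<dots> \<le> norm (axis j 1 :: real^'q)" using R by blast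
      finally show ?thesis by (simp add: matrix_vector_mult_basis column_def)
    qed
    then have "norm (R $ i) \<le> real CARD('q)" for i
      using order_trans[OF norm_le_l1_cart[of "R $ i"] sum_mono[of UNIV "\<lambda>j. \<bar>R $ i $ j\<bar>" "\<lambda>_. 1"]] by simp
    then show "norm R \<le> (\<Sum>i\<in>(UNIV::'q set). real CARD('q))"
      unfolding norm_vec_def[of R] by (intro order_trans[OF L2_set_le_sum sum_mono]) auto
  qed
  ultimately have "compact ?S" by (simp add: compact_eq_bounded_closed)
  moreover have "convex ?S" by (rule convex_contractions)
  ultimately have "?S = convex hull {x. x extreme_point_of ?S}" by (rule Krein_Milman_Minkowski)
  also have "\<dots> \<subseteq> convex hull {Q. orthogonal_transformation ((*v) Q)}"
    using contraction_extreme_point_isometry by (intro hull_mono) auto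
  finally show ?thesis using assms by auto
qed

text \<open>Douglas' lemma: \<open>R\<^sup>T\<close> maps \<open>B\<^sup>T x\<close> to \<open>A\<^sup>T x\<close> on the range of \<open>B\<^sup>T\<close>, and vanishes on its
  orthogonal complement.\<close>

lemma mat_le_imp_contraction_factor:
  fixes A B :: "real^'q^'d"
  assumes le: "A \<preceq>\<^sub>m B"
  obtains R :: "real^'q^'q" where "\<And>x. norm (R *v x) \<le> norm x" "A = B ** R"
proof -
  let ?At = "transpose A" and ?Bt = "transpose B"
  \<comment> \<open>The matrix order compares the quadratic forms \<open>|A^T x|^2\<close> and
    \<open>|B^T x|^2\<close>.\<close>
  have quad: "norm (?At *v x) \<le> norm (?Bt *v x)" for x
  proof -
    have "x \<bullet> ((M ** transpose M) *v x) = (norm (transpose M *v x))\<^sup>2" for M :: "real^'q^'d"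
      by (simp add: matrix_vector_mul_assoc[symmetric] dot_lmul_matrix[symmetric] power2_norm_eq_inner
          transpose_matrix_vector)
    then have "(norm (?At *v x))\<^sup>2 \<le> (norm (?Bt *v x))\<^sup>2"
      using le unfolding mat_le_def pos_semidef_def
      by (metis matrix_vector_mult_diff_rdistrib inner_diff_right diff_ge_0_iff_ge)
    then show ?thesis by (rule power2_le_imp_le) simp
  qed
  have lB: "linear ((*v) ?Bt)" by simp
  obtain g where g: "linear g" "\<And>y. y \<in> range ((*v) ?Bt) \<Longrightarrow> ?Bt *v g y = y"
    using linear_exists_right_inverse_on[OF lB subspace_UNIV] by auto
  obtain E where E: "pairwise orthogonal E" "\<And>e. e \<in> E \<Longrightarrow> norm e = 1" "independent E"
      "span E = range ((*v) ?Bt)"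
    using orthonormal_basis_subspace[OF linear_subspace_image[OF lB subspace_UNIV]] by metis
  have finE: "finite E" using E(3) by (rule independent_imp_finite)
  \<comment> \<open>The orthogonal projection onto the range of \<open>?Bt\<close>.\<close>
  define p where "p y = (\<Sum>e\<in>E. (e \<bullet> y) *\<^sub>R e)" for y
  have linp: "linear p"
    unfolding p_def by (intro linear_compose_sum ballI linearI) (auto simp: inner_add_right scaleR_add_left)
  have p_in: "p y \<in> range ((*v) ?Bt)" for y
    unfolding E(4)[symmetric] p_def by (intro span_sum span_scale span_base)
  have orth_E: "e \<bullet> (y - p y) = 0" if e: "e \<in> E" for e y
  proof -
    have "e \<bullet> p y = (\<Sum>e'\<in>E. if e' = e then e \<bullet> y else 0)"
      unfolding p_def inner_sum_right using E(1,2) e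
      by (intro sum.cong) (auto simp: pairwise_def orthogonal_def norm_eq_1)
    then show ?thesis using finE e by (simp add: inner_diff_right)
  qed
  have orth: "z \<bullet> (y - p y) = 0" if "z \<in> range ((*v) ?Bt)" for z y
    using that orthogonal_to_span[of z E "y - p y"] orth_E unfolding E(4)[symmetric]
    by (simp add: orthogonal_def inner_commute)
  have p_norm: "norm (p y) \<le> norm y" for y
  proof -
    have "(norm (p y + (y - p y)))\<^sup>2 = (norm (p y))\<^sup>2 + (norm (y - p y))\<^sup>2"
      by (rule norm_orthogonal_sum_sq[OF orth[OF p_in]])
    then have "(norm (p y))\<^sup>2 \<le> (norm y)\<^sup>2" by simp
    then show ?thesis by (rule power2_le_imp_le) simp
  qed
  have p_id: "p y = y" if "y \<in> range ((*v) ?Bt)" for y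
  proof -
    have "y - p y \<in> range ((*v) ?Bt)"
      using that p_in[of y] linear_subspace_image[OF lB subspace_UNIV] subspace_diff by blast
    from orth[OF this, of y] show ?thesis by simp
  qed
  \<comment> \<open>Project to the range of \<open>?Bt\<close>, take a preimage, apply
    \<open>?At\<close>. The choice of the preimage is immaterial: by \<open>quad\<close>,
    \<open>?At\<close> vanishes wherever \<open>?Bt\<close> does.\<close>
  define k where "k y = ?At *v g (p y)" for y
  have link: "linear k"
    unfolding k_def using linear_compose[OF linear_compose[OF linp g(1)], of "(*v) ?At"] by (simp add: o_def)
  have k_norm: "norm (k y) \<le> norm y" for y
    unfolding k_def using quad[of "g (p y)"] g(2)[OF p_in[of y]] p_norm[of y] by simp
  have k_B: "k (?Bt *v x) = ?At *v x" for x
  proof -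
    have "?Bt *v (g (?Bt *v x) - x) = 0" using g(2)[of "?Bt *v x"] by (simp add: matrix_vector_mult_diff_distrib)
    then have "?At *v (g (?Bt *v x) - x) = 0" using quad[of "g (?Bt *v x) - x"] by simp
    then show ?thesis unfolding k_def by (simp add: p_id matrix_vector_mult_diff_distrib)
  qed
  define R where "R = transpose (matrix k)"
  have Rt: "transpose R *v y = k y" for y
    unfolding R_def using link by (simp add: matrix_works)
  have "?At = transpose R ** ?Bt"
    unfolding matrix_eq by (simp only: matrix_vector_mul_assoc[symmetric] Rt k_B simp_thms)
  then have "A = B ** R"
    by (metis matrix_transpose_mul transpose_transpose)
  \<comment> \<open>A matrix inherits the norm bound of its transpose, by Cauchy-Schwarz applied to
    \<open>|R x|^2 = x \<bullet> R^T (R x)\<close>.\<close>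
  moreover have "norm (R *v x) \<le> norm x" for x
  proof -
    have "(norm (R *v x))\<^sup>2 = x \<bullet> (transpose R *v (R *v x))"
      by (simp add: power2_norm_eq_inner dot_lmul_matrix[symmetric] transpose_matrix_vector inner_commute)
    also have "\<dots> \<le> norm x * norm (transpose R *v (R *v x))" by (rule norm_cauchy_schwarz)
    also have "\<dots> \<le> norm x * norm (R *v x)"
      unfolding Rt using k_norm by (intro mult_left_mono) auto
    finally show ?thesis by (cases "R *v x = 0") (auto simp: power2_eq_square)
  qed
  ultimately show thesis using that by blast
qed

section \<open>Gaussian integrals of convex functions and the matrix order\<close>

lemma convex_on_borel_measurable:
  fixes f :: "'a::euclidean_space \<Rightarrow> real"
  assumes "convex_on UNIV f" shows "f \<in> borel_measurable borel"
  using convex_on_continuous[OF open_UNIV assms] by (rule borel_measurable_continuous_onI)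

lemma convex_on_comp_linear:
  assumes "convex_on UNIV f" "linear l"
  shows "convex_on UNIV (\<lambda>z. f (a + l z))"
proof (rule convex_onI)
  fix t :: real and x y assume t: "0 < t" "t < 1"
  have "a + l ((1 - t) *\<^sub>R x + t *\<^sub>R y) = (1 - t) *\<^sub>R (a + l x) + t *\<^sub>R (a + l y)"
    unfolding linear_add[OF assms(2)] linear_scale[OF assms(2)] by (simp add: algebra_simps)
  then show "f (a + l ((1 - t) *\<^sub>R x + t *\<^sub>R y)) \<le> (1 - t) * f (a + l x) + t * f (a + l y)"
    using convex_onD[OF assms(1), of t "a + l x" "a + l y"] t by simp
qed simp

text \<open>The contractions satisfying the inequality form a convex set, since \<open>f\<close> is
  convex, and it contains the orthogonal matrices, with equality, since the Gaussian law is
  invariant. The bound on the norm is kept as part of the set \<open>?K\<close> so that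
  integrability is available when two of its members are mixed.\<close>

lemma integral_contraction_le:
  fixes f :: "real^'q \<Rightarrow> real" and R :: "real^'q^'q"
  assumes f: "convex_on UNIV f"
    and int: "\<And>R :: real^'q^'q. (\<And>x. norm (R *v x) \<le> norm x) \<Longrightarrow> integrable (gauss s) (\<lambda>z. f (R *v z))"
    and R: "\<And>x. norm (R *v x) \<le> norm x"
  shows "(\<integral>z. f (R *v z) \<partial>gauss s) \<le> (\<integral>z. f z \<partial>gauss s)"
proof -
  have [measurable]: "f \<in> borel_measurable borel"
    by (rule convex_on_borel_measurable[OF f])
  let ?K = "{R :: real^'q^'q. (\<forall>x. norm (R *v x) \<le> norm x) \<and> (\<integral>z. f (R *v z) \<partial>gauss s) \<le> (\<integral>z. f z \<partial>gauss s)}"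
  have "convex hull {Q. orthogonal_transformation ((*v) Q)} \<subseteq> ?K"
  proof (rule hull_minimal)
    show "{Q. orthogonal_transformation ((*v) Q)} \<subseteq> ?K"
    proof safe
      fix Q :: "real^'q^'q" assume Q: "orthogonal_transformation ((*v) Q)"
      then show "norm (Q *v x) \<le> norm x" for x by (simp add: orthogonal_transformation)
      have [measurable]: "(*v) Q \<in> borel_measurable borel"
        by (intro borel_measurable_continuous_onI linear_continuous_on matrix_vector_mul_bounded_linear)
      have "(\<integral>z. f z \<partial>gauss s) = (\<integral>z. f z \<partial>distr (gauss s) borel ((*v) Q))"
        using gauss_orthogonal_invariant[OF Q] by simp
      also have "\<dots> = (\<integral>z. f (Q *v z) \<partial>gauss s)"
        by (rule integral_distr) auto
      finally show "(\<integral>z. f (Q *v z) \<partial>gauss s) \<le> (\<integral>z. f z \<partial>gauss s)" by simp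
    qed
    show "convex ?K"
    proof (rule convexI, safe)
      fix A B :: "real^'q^'q" and u v :: real and x
      assume A: "\<forall>x. norm (A *v x) \<le> norm x" and B: "\<forall>x. norm (B *v x) \<le> norm x"
        and iA: "(\<integral>z. f (A *v z) \<partial>gauss s) \<le> (\<integral>z. f z \<partial>gauss s)"
        and iB: "(\<integral>z. f (B *v z) \<partial>gauss s) \<le> (\<integral>z. f z \<partial>gauss s)"
        and uv: "0 \<le> u" "0 \<le> v" "u + v = 1"
      have eq: "(u *\<^sub>R A + v *\<^sub>R B) *v x = u *\<^sub>R (A *v x) + v *\<^sub>R (B *v x)" for x
        by (simp add: matrix_vector_mult_add_rdistrib scaleR_matrix_vector_assoc[symmetric])
      have n: "norm ((u *\<^sub>R A + v *\<^sub>R B) *v x) \<le> norm x" for x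
        using convexD[OF convex_contractions, of A B u v] A B uv by auto
      then show "norm ((u *\<^sub>R A + v *\<^sub>R B) *v x) \<le> norm x" .
      have "(\<integral>z. f ((u *\<^sub>R A + v *\<^sub>R B) *v z) \<partial>gauss s) \<le> (\<integral>z. u * f (A *v z) + v * f (B *v z) \<partial>gauss s)"
      proof (rule integral_mono)
        show "integrable (gauss s) (\<lambda>z. f ((u *\<^sub>R A + v *\<^sub>R B) *v z))" by (intro int n)
        show "integrable (gauss s) (\<lambda>z. u * f (A *v z) + v * f (B *v z))"
          using int[of A] int[of B] A B by auto
        show "f ((u *\<^sub>R A + v *\<^sub>R B) *v z) \<le> u * f (A *v z) + v * f (B *v z)" for z
          unfolding eq using f uv by (simp add: convex_on_def)
      qed
      also have "\<dots> = u * (\<integral>z. f (A *v z) \<partial>gauss s) + v * (\<integral>z. f (B *v z) \<partial>gauss s)"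
        using int[of A] int[of B] A B by simp
      also have "\<dots> \<le> u * (\<integral>z. f z \<partial>gauss s) + v * (\<integral>z. f z \<partial>gauss s)"
        using uv iA iB by (intro add_mono mult_left_mono)
      finally show "(\<integral>z. f ((u *\<^sub>R A + v *\<^sub>R B) *v z) \<partial>gauss s) \<le> (\<integral>z. f z \<partial>gauss s)"
        using uv by (simp flip: distrib_right)
    qed
  qed
  then show ?thesis using contraction_in_convex_hull_orthogonal[OF R] by auto
qed

lemma integrable_gauss_quadratic:
  fixes g :: "real^'q \<Rightarrow> real"
  assumes s: "0 < s" and [measurable]: "g \<in> borel_measurable borel"
    and bd: "\<And>z. \<bar>g z\<bar> \<le> C * (1 + (norm z)\<^sup>2)"
  shows "integrable (gauss s) g"
proof -
  interpret prob_space "gauss s :: (real^'q) measure" using s by (rule prob_space_gauss)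
  have "integrable (gauss s :: (real^'q) measure) (\<lambda>z. (norm z)\<^sup>2)"
    using gauss_second_moment[OF s, where 'q='q] by (intro integrableI_bounded) auto
  then have "integrable (gauss s :: (real^'q) measure) (\<lambda>z. C * (1 + (norm z)\<^sup>2))" by simp
  then show ?thesis
  proof (rule Bochner_Integration.integrable_bound)
    show "AE z in gauss s. norm (g z) \<le> norm (C * (1 + (norm z)\<^sup>2))"
      using bd by (intro AE_I2) (simp add: order_trans[OF bd abs_ge_self])
  qed simp
qed

text \<open>After the factorisation \<open>A = B ** R\<close> this is the contraction inequality for
  the convex function \<open>z \<mapsto> f (a + B *v z)\<close>. The quadratic bound on
  \<open>f\<close> supplies the integrability for every contraction.\<close>

lemma integral_gauss_mat_le_mono:
  fixes f :: "real^'d \<Rightarrow> real" and A B :: "real^'q^'d"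
  assumes s: "0 < s" and f: "convex_on UNIV f"
    and bd: "\<And>y. \<bar>f y\<bar> \<le> C * (1 + (norm y)\<^sup>2)"
    and le: "A \<preceq>\<^sub>m B"
  shows "(\<integral>z. f (a + A *v z) \<partial>gauss s) \<le> (\<integral>z. f (a + B *v z) \<partial>gauss s)"
proof -
  obtain R where R: "\<And>x. norm (R *v x) \<le> norm x" and A: "A = B ** R"
    using mat_le_imp_contraction_factor[OF le] by blast
  have C: "0 \<le> C" using bd[of 0] by simp
  have [measurable]: "f \<in> borel_measurable borel"
    by (rule convex_on_borel_measurable[OF f])
  have [measurable]: "(*v) M \<in> borel_measurable borel" for M :: "real^'n^'m"
    by (intro borel_measurable_continuous_onI linear_continuous_on matrix_vector_mul_bounded_linear)
  define b where "b = onorm ((*v) B)"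
  have b: "norm (B *v x) \<le> b * norm x" for x
    unfolding b_def by (rule onorm) (rule matrix_vector_mul_bounded_linear)
  have b0: "0 \<le> b" unfolding b_def by (rule onorm_pos_le) (rule matrix_vector_mul_bounded_linear)
  have "(\<integral>z. f (a + B *v (R *v z)) \<partial>gauss s) \<le> (\<integral>z. f (a + B *v z) \<partial>gauss s)"
  proof (rule integral_contraction_le[where f="\<lambda>z. f (a + B *v z)"])
    show "convex_on UNIV (\<lambda>z. f (a + B *v z))" by (rule convex_on_comp_linear[OF f]) simp
    fix Q :: "real^'q^'q" assume Q: "\<And>x. norm (Q *v x) \<le> norm x"
    show "integrable (gauss s) (\<lambda>z. f (a + B *v (Q *v z)))"
    proof (rule integrable_gauss_quadratic[OF s])
      fix z
      have "norm (a + B *v (Q *v z)) \<le> norm a + b * norm z"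
        using norm_triangle_ineq[of a "B *v (Q *v z)"] b[of "Q *v z"] mult_left_mono[OF Q[of z] b0] by linarith
      then have "(norm (a + B *v (Q *v z)))\<^sup>2 \<le> (norm a + b * norm z)\<^sup>2" by (intro power_mono) auto
      also have "\<dots> \<le> 2 * (norm a)\<^sup>2 + 2 * b\<^sup>2 * (norm z)\<^sup>2"
        using sum_squares_bound[of "norm a" "b * norm z"] by (simp add: power2_sum power_mult_distrib)
      finally have "1 + (norm (a + B *v (Q *v z)))\<^sup>2 \<le> 1 + (2 * (norm a)\<^sup>2 + 2 * b\<^sup>2 * (norm z)\<^sup>2)" by simp
      also have "\<dots> \<le> (1 + 2 * (norm a)\<^sup>2 + 2 * b\<^sup>2) * (1 + (norm z)\<^sup>2)"
        by (simp add: algebra_simps)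
      finally have "1 + (norm (a + B *v (Q *v z)))\<^sup>2 \<le> (1 + 2 * (norm a)\<^sup>2 + 2 * b\<^sup>2) * (1 + (norm z)\<^sup>2)" .
      from order_trans[OF bd mult_left_mono[OF this C]]
      show "\<bar>f (a + B *v (Q *v z))\<bar> \<le> (C * (1 + 2 * (norm a)\<^sup>2 + 2 * b\<^sup>2)) * (1 + (norm z)\<^sup>2)"
        by (simp add: mult.assoc)
    qed simp
  qed (rule R)
  then show ?thesis by (simp add: A matrix_vector_mul_assoc)
qed


subsection \<open>Convex functionals of paths\<close>

text \<open>Approximating \<open>y\<close> by simple functions leaves finitely many values of the
  second argument, for which measurability in the first is enough. Continuity in \<open>y\<close>
  then passes to the limit.\<close>

lemma caratheodory_measurable:
  fixes f :: "'a \<Rightarrow> 'b::{metric_space, second_countable_topology} \<Rightarrow> 'c::metric_space"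
  assumes meas: "\<And>y. (\<lambda>x. f x y) \<in> borel_measurable M"
    and cont: "\<And>x. x \<in> space M \<Longrightarrow> continuous_on UNIV (f x)"
  shows "(\<lambda>p. f (fst p) (snd p)) \<in> borel_measurable (M \<Otimes>\<^sub>M borel)"
proof -
  obtain F :: "nat \<Rightarrow> 'b \<Rightarrow> 'b" where F: "\<And>i. simple_function borel (F i)" "\<And>y. (\<lambda>i. F i y) \<longlonglongrightarrow> y"
    using borel_measurable_implies_sequence_metric[of "\<lambda>y::'b. y" borel undefined] by auto
  show ?thesis
  proof (rule borel_measurable_LIMSEQ_metric)
    fix i
    have fin: "finite (range (F i))" using simple_functionD(1)[OF F(1)[of i]] by simp
    have g: "(\<lambda>p. F i (snd p)) \<in> measurable (M \<Otimes>\<^sub>M borel) (count_space (range (F i)))"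
    proof (rule measurable_compose[OF measurable_snd])
      show "F i \<in> borel \<rightarrow>\<^sub>M count_space (range (F i))"
        using simple_functionD(2)[OF F(1)[of i]] fin by (subst measurable_count_space_eq2) auto
    qed
    show "(\<lambda>p. f (fst p) (F i (snd p))) \<in> borel_measurable (M \<Otimes>\<^sub>M borel)"
      using fin by (intro measurable_compose_countable'[OF _ g, where f="\<lambda>y p. f (fst p) y"]
          measurable_compose[OF measurable_fst meas]) (auto intro: countable_finite)
  next
    fix p assume "p \<in> space (M \<Otimes>\<^sub>M (borel :: 'b measure))"
    then have "continuous_on UNIV (f (fst p))" by (intro cont) (auto simp: space_pair_measure)
    then show "(\<lambda>i. f (fst p) (F i (snd p))) \<longlonglongrightarrow> f (fst p) (snd p)"
      by (rule continuous_on_tendsto_compose[OF _ F(2)]) auto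
  qed
qed

lemma borel_measurable_matrix_vector_mult:
  fixes A :: "'a \<Rightarrow> real^'q^'d"
  assumes "A \<in> borel_measurable M" "z \<in> borel_measurable M"
  shows "(\<lambda>x. A x *v z x) \<in> borel_measurable M"
  by (rule borel_measurable_continuous_Pair[OF assms])
     (auto simp: matrix_vector_mult_def intro!: continuous_intros)

abbreviation paths :: "(nat \<Rightarrow> real^'d) measure" where
  "paths \<equiv> PiM UNIV (\<lambda>_. borel)"

text \<open>Functions of the first \<open>n\<close> positions are kept on the space of whole
  sequences, so that the number of steps can change during the induction while the type does
  not.\<close>

definition depends_below :: "nat \<Rightarrow> ((nat \<Rightarrow> 'a) \<Rightarrow> 'b) \<Rightarrow> bool" where
  "depends_below n f \<longleftrightarrow> (\<forall>x y. (\<forall>i<n. x i = y i) \<longrightarrow> f x = f y)"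

text \<open>The test functions of the induction. Quadratic growth is what second moments can
  integrate, and it survives the integration of one step because the coefficients grow at most
  linearly.\<close>

definition path_class :: "nat \<Rightarrow> ((nat \<Rightarrow> real^'d) \<Rightarrow> real) \<Rightarrow> bool" where
  "path_class n f \<longleftrightarrow> convex_path_functional f \<and> depends_below n f \<and>
    (\<exists>C. \<forall>x. \<bar>f x\<bar> \<le> C * (1 + (\<Sum>i<n. (norm (x i))\<^sup>2)))"

lemma convex_path_functional_slice:
  assumes "convex_path_functional f"
  shows "convex_on UNIV (\<lambda>y. f (x(n := y)))"
proof (rule convex_onI)
  fix t :: real and y z :: "real^'a" assume t: "0 < t" "t < 1"
  have eq: "x(n := (1 - t) *\<^sub>R y + t *\<^sub>R z) = (\<lambda>m. (1 - t) *\<^sub>R (x(n := y)) m + (1 - (1 - t)) *\<^sub>R (x(n := z)) m)"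
    by (auto simp: fun_eq_iff scaleR_left_distrib[symmetric])
  have "1 - t \<in> {0..1}" using t by simp
  then have "f (\<lambda>m. (1 - t) *\<^sub>R (x(n := y)) m + (1 - (1 - t)) *\<^sub>R (x(n := z)) m)
      \<le> (1 - t) * f (x(n := y)) + (1 - (1 - t)) * f (x(n := z))"
    using assms unfolding convex_path_functional_def by blast
  then show "f (x(n := (1 - t) *\<^sub>R y + t *\<^sub>R z)) \<le> (1 - t) * f (x(n := y)) + t * f (x(n := z))"
    unfolding eq by simp
qed simp

text \<open>In each coordinate a convex function is continuous, so measurability follows by induction
  on the number of coordinates.\<close>

lemma convex_path_functional_measurable:
  assumes "convex_path_functional f" "depends_below n f"
  shows "f \<in> borel_measurable paths"
  using assms
proof (induction n arbitrary: f)
  case 0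
  then have "f = (\<lambda>x. f undefined)" by (auto simp: depends_below_def fun_eq_iff)
  then show ?case by (metis measurable_const space_borel UNIV_I)
next
  case (Suc n)
  have 1: "(\<lambda>p. f ((fst p)(n := snd p))) \<in> borel_measurable (paths \<Otimes>\<^sub>M borel)"
  proof (rule caratheodory_measurable[where f="\<lambda>x y. f (x(n := y))"])
    fix y
    show "(\<lambda>x. f (x(n := y))) \<in> borel_measurable paths"
    proof (rule Suc.IH)
      have *: "(\<lambda>m. r *\<^sub>R x m + (1 - r) *\<^sub>R x' m)(n := y)
          = (\<lambda>m. r *\<^sub>R (x(n := y)) m + (1 - r) *\<^sub>R (x'(n := y)) m)" for r x x'
        by (auto simp: fun_eq_iff scaleR_left_distrib[symmetric])
      show "convex_path_functional (\<lambda>x. f (x(n := y)))"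
        using Suc.prems(1) unfolding convex_path_functional_def * by blast
      show "depends_below n (\<lambda>x. f (x(n := y)))"
        using Suc.prems(2) unfolding depends_below_def by (auto simp: less_Suc_eq)
    qed
  next
    fix x
    show "continuous_on UNIV (\<lambda>y. f (x(n := y)))"
      by (intro convex_on_continuous convex_path_functional_slice Suc.prems) simp
  qed
  have "(\<lambda>x. (x, x n)) \<in> paths \<rightarrow>\<^sub>M paths \<Otimes>\<^sub>M borel"
    by (intro measurable_Pair measurable_ident measurable_component_singleton) auto
  from measurable_compose[OF this 1] show ?case by simp
qed

lemma path_class_measurable: "path_class n f \<Longrightarrow> f \<in> borel_measurable paths"
  unfolding path_class_def using convex_path_functional_measurable by blast

lemma path_class_bound:
  assumes "path_class n f"
  obtains C where "0 \<le> C" "\<And>x. \<bar>f x\<bar> \<le> C * (1 + (\<Sum>i<n. (norm (x i))\<^sup>2))"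
proof -
  obtain C where C: "\<And>x. \<bar>f x\<bar> \<le> C * (1 + (\<Sum>i<n. (norm (x i))\<^sup>2))"
    using assms unfolding path_class_def by auto
  have "0 \<le> C" using C[of "\<lambda>_. 0"] by simp
  then show thesis using that C by blast
qed

section \<open>One Euler step as an operator on test functions\<close>

lemma euler_increment_bound:
  fixes a :: "real^'d" and M :: "real^'q^'d"
  assumes "norm a \<le> c * (1 + r)" "onorm ((*v) M) \<le> c * (1 + r)" "0 \<le> r"
  shows "(norm (a + M *v z))\<^sup>2 \<le> 4 * c\<^sup>2 * (1 + r\<^sup>2) * (1 + (norm z)\<^sup>2)"
proof -
  have "norm (M *v z) \<le> onorm ((*v) M) * norm z"
    by (rule onorm) (rule matrix_vector_mul_bounded_linear)
  also have "\<dots> \<le> c * (1 + r) * norm z" using assms(2) by (rule mult_right_mono) simp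
  finally have "norm (a + M *v z) \<le> c * (1 + r) + c * (1 + r) * norm z"
    using norm_triangle_ineq[of a "M *v z"] assms(1) by linarith
  then have "(norm (a + M *v z))\<^sup>2 \<le> (c * (1 + r) + c * (1 + r) * norm z)\<^sup>2" by (rule power_mono) simp
  also have "\<dots> = c\<^sup>2 * (1 + r)\<^sup>2 * (1 + norm z)\<^sup>2" by (simp add: power2_eq_square algebra_simps)
  \<comment> \<open>Each of the two squared sums is at most twice the sum of the squares, whence the
    constant 4. The product form lets \<open>r\<close> and \<open>z\<close> be integrated
    separately.\<close>
  also have "\<dots> \<le> c\<^sup>2 * (2 * (1 + r\<^sup>2)) * (2 * (1 + (norm z)\<^sup>2))"
    using sum_squares_bound[of 1 r] sum_squares_bound[of 1 "norm z"] assms(3)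
    by (intro mult_mono) (auto simp: power2_sum)
  finally show ?thesis by (simp add: algebra_simps)
qed

text \<open>The bound is a product of a factor in the past and a factor in the noise: the second is
  integrable for the Gaussian law, and the first is again of quadratic growth.\<close>

lemma path_class_step_bound:
  fixes f :: "(nat \<Rightarrow> real^'d) \<Rightarrow> real" and S :: "real^'d \<Rightarrow> real^'q^'d"
  assumes f: "path_class (Suc (Suc n)) f"
    and a: "\<And>x. norm (a x) \<le> c * (1 + norm x)" and S: "\<And>x. onorm ((*v) (S x)) \<le> c * (1 + norm x)"
  shows "\<exists>D. 0 \<le> D \<and> (\<forall>x z. \<bar>f (x(Suc n := a (x n) + S (x n) *v z))\<bar>
      \<le> D * (1 + (\<Sum>i<Suc n. (norm (x i))\<^sup>2)) * (1 + (norm z)\<^sup>2))"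
proof -
  obtain C where C: "0 \<le> C" "\<And>x. \<bar>f x\<bar> \<le> C * (1 + (\<Sum>i<Suc (Suc n). (norm (x i))\<^sup>2))"
    using path_class_bound[OF f] by blast
  show ?thesis
  proof (intro exI[of _ "C * (1 + 4 * c\<^sup>2)"] conjI allI)
    show "0 \<le> C * (1 + 4 * c\<^sup>2)" using C(1) by simp
    fix x :: "nat \<Rightarrow> real^'d" and z :: "real^'q"
    define s where "s = (\<Sum>i<Suc n. (norm (x i))\<^sup>2)"
    have s: "0 \<le> s" "(norm (x n))\<^sup>2 \<le> s" by (auto simp: s_def sum_nonneg)
    have "(\<Sum>i<Suc (Suc n). (norm ((x(Suc n := a (x n) + S (x n) *v z)) i))\<^sup>2) = s + (norm (a (x n) + S (x n) *v z))\<^sup>2"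
      unfolding s_def by (simp add: sum.lessThan_Suc)
    also have "\<dots> \<le> s + 4 * c\<^sup>2 * (1 + (norm (x n))\<^sup>2) * (1 + (norm z)\<^sup>2)"
      by (intro add_left_mono euler_increment_bound a S) simp
    also have "\<dots> \<le> s + 4 * c\<^sup>2 * (1 + s) * (1 + (norm z)\<^sup>2)"
      using s by (intro add_left_mono mult_right_mono mult_left_mono) auto
    finally have "1 + (\<Sum>i<Suc (Suc n). (norm ((x(Suc n := a (x n) + S (x n) *v z)) i))\<^sup>2)
        \<le> 1 + (s + 4 * c\<^sup>2 * (1 + s) * (1 + (norm z)\<^sup>2))" by simp
    also have "\<dots> \<le> (1 + 4 * c\<^sup>2) * (1 + s) * (1 + (norm z)\<^sup>2)"
      using s by (simp add: algebra_simps)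
    finally have "C * (1 + (\<Sum>i<Suc (Suc n). (norm ((x(Suc n := a (x n) + S (x n) *v z)) i))\<^sup>2))
        \<le> C * ((1 + 4 * c\<^sup>2) * (1 + s) * (1 + (norm z)\<^sup>2))" using C(1) by (rule mult_left_mono)
    with C(2)[of "x(Suc n := a (x n) + S (x n) *v z)"]
    show "\<bar>f (x(Suc n := a (x n) + S (x n) *v z))\<bar>
      \<le> C * (1 + 4 * c\<^sup>2) * (1 + (\<Sum>i<Suc n. (norm (x i))\<^sup>2)) * (1 + (norm z)\<^sup>2)"
      unfolding s_def[symmetric] by (simp only: mult.assoc)
  qed
qed

text \<open>The backward transition operator, that is, the conditional expectation of
  \<open>f\<close> given the positions \<open>0, ..., n\<close>. The new position gets index
  \<open>Suc n\<close>, so \<open>f\<close> may depend on \<open>Suc (Suc n)\<close> coordinates and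
  the result depends on \<open>Suc n\<close>.\<close>

definition euler_step ::
    "nat \<Rightarrow> (real^'d \<Rightarrow> real^'d) \<Rightarrow> (real^'d \<Rightarrow> real^'q^'d) \<Rightarrow> real \<Rightarrow>
      ((nat \<Rightarrow> real^'d) \<Rightarrow> real) \<Rightarrow> (nat \<Rightarrow> real^'d) \<Rightarrow> real" where
  "euler_step n a S s f x = (\<integral>z. f (x(Suc n := a (x n) + S (x n) *v z)) \<partial>gauss s)"

context
  fixes n :: nat and a :: "real^'d \<Rightarrow> real^'d" and S :: "real^'d \<Rightarrow> real^'q^'d"
    and s c :: real and f :: "(nat \<Rightarrow> real^'d) \<Rightarrow> real"
  assumes s: "0 < s" and f: "path_class (Suc (Suc n)) f"
    and a: "\<And>x. norm (a x) \<le> c * (1 + norm x)" and S: "\<And>x. onorm ((*v) (S x)) \<le> c * (1 + norm x)"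
begin

lemma slice_quadratic: "\<exists>C. \<forall>y. \<bar>f (x(Suc n := y))\<bar> \<le> C * (1 + (norm y)\<^sup>2)"
proof -
  obtain C where C: "0 \<le> C" "\<And>x. \<bar>f x\<bar> \<le> C * (1 + (\<Sum>i<Suc (Suc n). (norm (x i))\<^sup>2))"
    using path_class_bound[OF f] by blast
  define r where "r = (\<Sum>i<Suc n. (norm (x i))\<^sup>2)"
  have r: "0 \<le> r" by (simp add: r_def sum_nonneg)
  have "\<bar>f (x(Suc n := y))\<bar> \<le> (C * (1 + r)) * (1 + (norm y)\<^sup>2)" for y
  proof -
    have "(\<Sum>i<Suc (Suc n). (norm ((x(Suc n := y)) i))\<^sup>2) = r + (norm y)\<^sup>2"
      unfolding r_def by (simp add: sum.lessThan_Suc)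
    then have "\<bar>f (x(Suc n := y))\<bar> \<le> C * (1 + (r + (norm y)\<^sup>2))" using C(2)[of "x(Suc n := y)"] by simp
    also have "\<dots> \<le> C * ((1 + r) * (1 + (norm y)\<^sup>2))"
      using C(1) r by (intro mult_left_mono) (auto simp: algebra_simps)
    finally show ?thesis by simp
  qed
  then show ?thesis by blast
qed

lemma slice_measurable: "(\<lambda>y. f (x(Suc n := y))) \<in> borel_measurable borel"
  using f unfolding path_class_def
  by (intro borel_measurable_continuous_onI convex_on_continuous convex_path_functional_slice) auto

lemma euler_step_integrable:
  "integrable (gauss s) (\<lambda>z. f (x(Suc n := a (x n) + S (x n) *v z)))"
proof -
  from path_class_step_bound[OF f a S] obtain D where
    D0: "0 \<le> D \<and> (\<forall>x z. \<bar>f (x(Suc n := a (x n) + S (x n) *v z))\<bar>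
      \<le> D * (1 + (\<Sum>i<Suc n. (norm (x i))\<^sup>2)) * (1 + (norm z)\<^sup>2))" ..
  note D = D0[THEN conjunct2, rule_format]
  show ?thesis
  proof (rule integrable_gauss_quadratic[OF s _ D])
    have "(\<lambda>z. a (x n) + S (x n) *v z) \<in> borel_measurable borel"
      by (intro borel_measurable_add borel_measurable_matrix_vector_mult) simp_all
    from measurable_compose[OF this slice_measurable]
    show "(\<lambda>z. f (x(Suc n := a (x n) + S (x n) *v z))) \<in> borel_measurable borel" .
  qed
qed

lemma euler_step_mono:
  fixes S' :: "real^'d \<Rightarrow> real^'q^'d"
  assumes "\<And>x. S x \<preceq>\<^sub>m S' x"
  shows "euler_step n a S s f x \<le> euler_step n a S' s f x"
proof -
  obtain C where C: "\<And>y. \<bar>f (x(Suc n := y))\<bar> \<le> C * (1 + (norm y)\<^sup>2)" using slice_quadratic by blast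
  have "convex_on UNIV (\<lambda>y. f (x(Suc n := y)))"
    using f unfolding path_class_def by (intro convex_path_functional_slice) auto
  from integral_gauss_mat_le_mono[OF s this C assms] show ?thesis unfolding euler_step_def .
qed

text \<open>For convexity, the matrix at the mixed point is first replaced by the mixture
  \<open>?M\<close> of the two matrices, which can only increase the Gaussian integral. With
  \<open>?M\<close> and an affine \<open>a\<close>, the new position is the same mixture of the two
  new positions, and convexity of \<open>f\<close> applies for each \<open>z\<close>.\<close>

lemma path_class_euler_step:
  assumes affine: "\<exists>l b. linear l \<and> (\<forall>x. a x = l x + b)"
    and conv: "\<And>x y r. r \<in> {0..1} \<Longrightarrow> S (r *\<^sub>R x + (1 - r) *\<^sub>R y) \<preceq>\<^sub>m r *\<^sub>R S x + (1 - r) *\<^sub>R S y"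
  shows "path_class (Suc n) (euler_step n a S s f)"
proof -
  interpret prob_space "gauss s :: (real^'q) measure" using s by (rule prob_space_gauss)
  let ?p = "\<lambda>x z. x(Suc n := a (x n) + S (x n) *v z)"
  have fc: "convex_path_functional f" and fd: "depends_below (Suc (Suc n)) f"
    using f by (auto simp: path_class_def)
  from path_class_step_bound[OF f a S] obtain D where D0: "0 \<le> D \<and> (\<forall>x z. \<bar>f (?p x z)\<bar>
      \<le> D * (1 + (\<Sum>i<Suc n. (norm (x i))\<^sup>2)) * (1 + (norm z)\<^sup>2))" ..
  note D = D0[THEN conjunct1] D0[THEN conjunct2, rule_format]
  have int_sq: "integrable (gauss s :: (real^'q) measure) (\<lambda>z. (1 + (norm z)\<^sup>2))"
    by (rule integrable_gauss_quadratic[OF s, where C=1]) auto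
  have "convex_path_functional (euler_step n a S s f)"
    unfolding convex_path_functional_def
  proof (intro allI ballI)
    fix x y :: "nat \<Rightarrow> real^'d" and r :: real assume r: "r \<in> {0..1}"
    let ?w = "\<lambda>m. r *\<^sub>R x m + (1 - r) *\<^sub>R y m"
    obtain C where C: "\<And>v. \<bar>f (?w(Suc n := v))\<bar> \<le> C * (1 + (norm v)\<^sup>2)" using slice_quadratic by blast
    let ?M = "r *\<^sub>R S (x n) + (1 - r) *\<^sub>R S (y n)"
    obtain l b where l: "linear l" "\<And>x. a x = l x + b" using affine by blast
    have aw: "a (?w n) = r *\<^sub>R a (x n) + (1 - r) *\<^sub>R a (y n)"
      unfolding l(2) linear_add[OF l(1)] linear_scale[OF l(1)] by (simp add: algebra_simps)
    have pw: "?w(Suc n := a (?w n) + ?M *v z) = (\<lambda>m. r *\<^sub>R ?p x z m + (1 - r) *\<^sub>R ?p y z m)" for z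
      unfolding aw by (auto simp: fun_eq_iff matrix_vector_mult_add_rdistrib scaleR_matrix_vector_assoc[symmetric] scaleR_add_right)
    have "euler_step n a S s f ?w \<le> (\<integral>z. f (?w(Suc n := a (?w n) + ?M *v z)) \<partial>gauss s)"
      unfolding euler_step_def
      by (rule integral_gauss_mat_le_mono[OF s convex_path_functional_slice[OF fc] C conv[OF r]])
    also have "\<dots> \<le> (\<integral>z. r * f (?p x z) + (1 - r) * f (?p y z) \<partial>gauss s)"
    proof (rule integral_mono)
      show "integrable (gauss s) (\<lambda>z. r * f (?p x z) + (1 - r) * f (?p y z))"
        by (intro Bochner_Integration.integrable_add integrable_mult_right euler_step_integrable)
      show le: "f (?w(Suc n := a (?w n) + ?M *v z)) \<le> r * f (?p x z) + (1 - r) * f (?p y z)" for z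
        unfolding pw using fc r unfolding convex_path_functional_def by blast
      obtain E where E: "\<And>y. \<bar>f (?w(Suc n := y))\<bar> \<le> E * (1 + (norm y)\<^sup>2)" using slice_quadratic by blast
      have E0: "0 \<le> E" using E[of 0] by simp
      show "integrable (gauss s) (\<lambda>z. f (?w(Suc n := a (?w n) + ?M *v z)))"
      proof (rule integrable_gauss_quadratic[OF s])
        have "(\<lambda>z. a (?w n) + ?M *v z) \<in> borel_measurable borel"
          by (intro borel_measurable_add borel_measurable_matrix_vector_mult) simp_all
        from measurable_compose[OF this slice_measurable]
        show "(\<lambda>z. f (?w(Suc n := a (?w n) + ?M *v z))) \<in> borel_measurable borel" .
        fix z
        \<comment> \<open>For a fixed vector and a fixed matrix the case \<open>r = 0\<close> of
          \<open>euler_increment_bound\<close> is enough.\<close>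
        define k where "k = max (norm (a (?w n))) (onorm ((*v) ?M))"
        define V where "V = (norm (a (?w n) + ?M *v z))\<^sup>2"
        have "V \<le> 4 * k\<^sup>2 * (1 + 0\<^sup>2) * (1 + (norm z)\<^sup>2)"
          unfolding V_def by (rule euler_increment_bound) (auto simp: k_def)
        then have "1 + V \<le> 1 + (norm z)\<^sup>2 + 4 * k\<^sup>2 * (1 + (norm z)\<^sup>2)"
          using zero_le_power2[of "norm z"] unfolding power_zero_numeral add_0_right mult_1_right by linarith
        also have "\<dots> = (1 + 4 * k\<^sup>2) * (1 + (norm z)\<^sup>2)" by (simp add: algebra_simps)
        finally have "1 + (norm (a (?w n) + ?M *v z))\<^sup>2 \<le> (1 + 4 * k\<^sup>2) * (1 + (norm z)\<^sup>2)"
          unfolding V_def .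
        from order_trans[OF E mult_left_mono[OF this E0]]
        show "\<bar>f (?w(Suc n := a (?w n) + ?M *v z))\<bar> \<le> (E * (1 + 4 * k\<^sup>2)) * (1 + (norm z)\<^sup>2)"
          by (simp only: mult.assoc)
      qed
    qed
    also have "\<dots> = r * euler_step n a S s f x + (1 - r) * euler_step n a S s f y"
      unfolding euler_step_def using euler_step_integrable[of x] euler_step_integrable[of y] by simp
    finally show "euler_step n a S s f ?w \<le> r * euler_step n a S s f x + (1 - r) * euler_step n a S s f y" .
  qed
  moreover have "depends_below (Suc n) (euler_step n a S s f)"
    unfolding depends_below_def
  proof (intro allI impI)
    fix x y :: "nat \<Rightarrow> real^'d" assume xy: "\<forall>i<Suc n. x i = y i"
    have "f (?p x z) = f (?p y z)" for z
    proof (rule fd[unfolded depends_below_def, rule_format])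
      fix i assume "i < Suc (Suc n)"
      then show "?p x z i = ?p y z i" using xy by (cases "i = Suc n") auto
    qed
    then show "euler_step n a S s f x = euler_step n a S s f y" by (simp add: euler_step_def)
  qed
  moreover have "\<bar>euler_step n a S s f x\<bar> \<le> (D * (\<integral>z. (1 + (norm z)\<^sup>2) \<partial>(gauss s :: (real^'q) measure)))
      * (1 + (\<Sum>i<Suc n. (norm (x i))\<^sup>2))" for x
  proof -
    have "\<bar>euler_step n a S s f x\<bar> \<le> (\<integral>z. \<bar>f (?p x z)\<bar> \<partial>gauss s)"
      unfolding euler_step_def by (rule integral_abs_bound)
    also have "\<dots> \<le> (\<integral>z. D * (1 + (\<Sum>i<Suc n. (norm (x i))\<^sup>2)) * (1 + (norm z)\<^sup>2) \<partial>(gauss s :: (real^'q) measure))"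
      by (rule integral_mono) (use euler_step_integrable int_sq D in auto)
    also have "\<dots> = D * (1 + (\<Sum>i<Suc n. (norm (x i))\<^sup>2)) * (\<integral>z. (1 + (norm z)\<^sup>2) \<partial>(gauss s :: (real^'q) measure))"
      by (rule integral_mult_right_zero)
    finally show ?thesis by (simp only: mult_ac)
  qed
  ultimately show ?thesis unfolding path_class_def by blast
qed

text \<open>Independence makes the joint law of past and increment a product, so Fubini can
  integrate the increment first. Square integrability of the old positions and of the new one
  dominates \<open>f\<close> on the product.\<close>

lemma integral_euler_step:
  assumes P: "prob_space P"
    and p: "p \<in> P \<rightarrow>\<^sub>M paths" and Z: "distr P borel Z = gauss s"
    and Zm: "Z \<in> borel_measurable P"
    and ind: "distr P (paths \<Otimes>\<^sub>M borel) (\<lambda>\<omega>. (p \<omega>, Z \<omega>)) = distr P paths p \<Otimes>\<^sub>M distr P borel Z"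
    and am: "a \<in> borel_measurable borel" and Sm: "S \<in> borel_measurable borel"
    and p2: "\<And>i. i \<le> n \<Longrightarrow> integrable P (\<lambda>\<omega>. (norm (p \<omega> i))\<^sup>2)"
    and q2: "integrable P (\<lambda>\<omega>. (norm (a (p \<omega> n) + S (p \<omega> n) *v Z \<omega>))\<^sup>2)"
  shows "(\<integral>\<omega>. f ((p \<omega>)(Suc n := a (p \<omega> n) + S (p \<omega> n) *v Z \<omega>)) \<partial>P) = (\<integral>\<omega>. euler_step n a S s f (p \<omega>) \<partial>P)"
    and "integrable P (\<lambda>\<omega>. euler_step n a S s f (p \<omega>))"
proof -
  interpret P: prob_space P by fact
  note p [measurable] Zm [measurable]
  interpret D1: prob_space "distr P paths p" by (rule P.prob_space_distr) simp
  interpret D2: prob_space "distr P borel Z" by (rule P.prob_space_distr) simp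
  interpret DD: pair_prob_space "distr P paths p" "distr P borel Z" ..
  let ?h = "\<lambda>w. f ((fst w)(Suc n := a (fst w n) + S (fst w n) *v snd w))"
  have upd: "(\<lambda>w. (fst w)(Suc n := a (fst w n) + S (fst w n) *v snd w)) \<in> paths \<Otimes>\<^sub>M borel \<rightarrow>\<^sub>M paths"
  proof (rule measurable_PiM_single')
    fix i
    have m1: "(\<lambda>w. fst w j) \<in> paths \<Otimes>\<^sub>M borel \<rightarrow>\<^sub>M borel" for j
      by (rule measurable_compose[OF measurable_fst]) (rule measurable_component_singleton, simp)
    have "(\<lambda>w. a (fst w n) + S (fst w n) *v snd w) \<in> paths \<Otimes>\<^sub>M borel \<rightarrow>\<^sub>M borel"
      by (intro borel_measurable_add borel_measurable_matrix_vector_mult measurable_compose[OF m1 am]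
          measurable_compose[OF m1 Sm] measurable_snd)
    then show "(\<lambda>w. ((fst w)(Suc n := a (fst w n) + S (fst w n) *v snd w)) i) \<in> paths \<Otimes>\<^sub>M borel \<rightarrow>\<^sub>M borel"
      using m1[of i] by (cases "i = Suc n") auto
  qed (auto simp: PiE_def)
  have hm: "?h \<in> borel_measurable (paths \<Otimes>\<^sub>M borel)"
    by (rule measurable_compose[OF upd path_class_measurable[OF f]])
  have pair: "(\<lambda>\<omega>. (p \<omega>, Z \<omega>)) \<in> P \<rightarrow>\<^sub>M paths \<Otimes>\<^sub>M borel" by simp
  have eqd: "distr P paths p \<Otimes>\<^sub>M distr P borel Z = distr P (paths \<Otimes>\<^sub>M borel) (\<lambda>\<omega>. (p \<omega>, Z \<omega>))"
    by (rule ind[symmetric])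
  obtain C where C: "0 \<le> C" "\<And>x. \<bar>f x\<bar> \<le> C * (1 + (\<Sum>i<Suc (Suc n). (norm (x i))\<^sup>2))"
    using path_class_bound[OF f] by blast
  have "integrable P (\<lambda>\<omega>. ?h (p \<omega>, Z \<omega>))"
  proof (rule Bochner_Integration.integrable_bound)
    let ?q = "\<lambda>\<omega>. (p \<omega>)(Suc n := a (p \<omega> n) + S (p \<omega> n) *v Z \<omega>)"
    show "integrable P (\<lambda>\<omega>. C * (1 + (\<Sum>i<Suc (Suc n). (norm (?q \<omega> i))\<^sup>2)))"
    proof (intro integrable_mult_right Bochner_Integration.integrable_add Bochner_Integration.integrable_sum)
      fix i assume "i \<in> {..<Suc (Suc n)}"
      then show "integrable P (\<lambda>\<omega>. (norm (?q \<omega> i))\<^sup>2)"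
        using p2[of i] q2 by (cases "i = Suc n") auto
    qed simp
    show "(\<lambda>\<omega>. ?h (p \<omega>, Z \<omega>)) \<in> borel_measurable P" by (rule measurable_compose[OF pair hm])
    show "AE \<omega> in P. norm (?h (p \<omega>, Z \<omega>)) \<le> norm (C * (1 + (\<Sum>i<Suc (Suc n). (norm (?q \<omega> i))\<^sup>2)))"
      by (intro AE_I2) (simp only: real_norm_def fst_conv snd_conv, rule order_trans[OF C(2) abs_ge_self])
  qed
  then have int: "integrable (distr P paths p \<Otimes>\<^sub>M distr P borel Z) ?h"
    unfolding eqd by (subst integrable_distr_eq[OF pair hm])
  have sm: "euler_step n a S s f \<in> borel_measurable paths"
  proof -
    have "(\<lambda>x. \<integral>z. ?h (x, z) \<partial>gauss s) \<in> borel_measurable paths"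
      using hm Z prob_space_gauss[OF s] by (intro sigma_finite_measure.borel_measurable_lebesgue_integral)
        (auto simp: split_beta' measurable_cong_sets[OF sets_pair_measure_cong[OF refl sets_gauss] refl] intro: prob_space_imp_sigma_finite)
    then show ?thesis by (simp add: euler_step_def[abs_def])
  qed
  have "integrable (distr P paths p) (\<lambda>x. \<integral>z. ?h (x, z) \<partial>distr P borel Z)"
    by (rule DD.integrable_fst'[OF int])
  then have "integrable (distr P paths p) (euler_step n a S s f)"
    unfolding Z by (simp add: euler_step_def[abs_def])
  then show "integrable P (\<lambda>\<omega>. euler_step n a S s f (p \<omega>))"
    by (subst (asm) integrable_distr_eq[OF p sm])
  have "(\<integral>\<omega>. ?h (p \<omega>, Z \<omega>) \<partial>P) = (\<integral>w. ?h w \<partial>(distr P paths p \<Otimes>\<^sub>M distr P borel Z))"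
    unfolding eqd by (rule integral_distr[OF pair hm, symmetric])
  also have "\<dots> = (\<integral>x. (\<integral>z. ?h (x, z) \<partial>distr P borel Z) \<partial>distr P paths p)"
    by (rule DD.integral_fst'[OF int, symmetric])
  also have "\<dots> = (\<integral>x. euler_step n a S s f x \<partial>distr P paths p)"
    unfolding Z euler_step_def by simp
  also have "\<dots> = (\<integral>\<omega>. euler_step n a S s f (p \<omega>) \<partial>P)"
    by (rule integral_distr[OF p sm])
  finally show "(\<integral>\<omega>. f ((p \<omega>)(Suc n := a (p \<omega> n) + S (p \<omega> n) *v Z \<omega>)) \<partial>P) = (\<integral>\<omega>. euler_step n a S s f (p \<omega>) \<partial>P)" by simp
qed

end

section \<open>The convex order tested on functions of quadratic growth\<close>

lemma prob2_integrable_quadratic: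
  fixes \<phi> :: "'a::euclidean_space \<Rightarrow> real"
  assumes \<mu>: "\<mu> \<in> prob2" and [measurable]: "\<phi> \<in> borel_measurable borel"
    and bd: "\<And>x. \<bar>\<phi> x\<bar> \<le> C * (1 + (norm x)\<^sup>2)"
  shows "integrable \<mu> \<phi>"
proof -
  have sets [measurable_cong]: "sets \<mu> = sets borel" and "prob_space \<mu>"
    and m2: "moment2 \<mu> < \<infinity>"
    using \<mu> by (auto simp: prob2_def measures2_def)
  then interpret prob_space \<mu> by simp
  have "integrable \<mu> (\<lambda>z. (norm z)\<^sup>2)" using m2 by (intro integrableI_bounded) auto
  then have "integrable \<mu> (\<lambda>z. C * (1 + (norm z)\<^sup>2))" by simp
  then show ?thesis
    by (rule Bochner_Integration.integrable_bound)
       (auto intro!: AE_I2 order_trans[OF bd abs_ge_self] simp del: abs_mult)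
qed

lemma ext_integral_integrable:
  assumes "integrable M f"
  shows "ext_integral M f = ereal (\<integral>x. f x \<partial>M)"
proof -
  have "(\<integral>\<^sup>+x. ennreal (f x) \<partial>M) < \<infinity>" "(\<integral>\<^sup>+x. ennreal (- f x) \<partial>M) < \<infinity>"
    using assms by (auto simp: real_integrable_def less_top)
  then show ?thesis
    unfolding ext_integral_def real_lebesgue_integral_def[OF assms]
    by (cases rule: ennreal2_cases[of "\<integral>\<^sup>+x. ennreal (f x) \<partial>M" "\<integral>\<^sup>+x. ennreal (- f x) \<partial>M"])
       (auto simp: enn2ereal_ennreal)
qed

lemma prob2_imp_prob1:
  assumes \<mu>: "\<mu> \<in> prob2" shows "\<mu> \<in> prob1"
proof -
  have sets [measurable_cong]: "sets \<mu> = sets borel" and p: "prob_space \<mu>"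
    and m2: "moment2 \<mu> < \<infinity>"
    using \<mu> by (auto simp: prob2_def measures2_def)
  have "integrable \<mu> norm"
  proof (rule prob2_integrable_quadratic[OF \<mu>])
    fix x :: 'a
    have "2 * norm x \<le> 1 + (norm x)\<^sup>2" using sum_squares_bound[of 1 "norm x"] by simp
    then have "norm x \<le> 1 + (norm x)\<^sup>2" using norm_ge_zero[of x] by linarith
    then show "\<bar>norm x\<bar> \<le> 1 * (1 + (norm x)\<^sup>2)" by simp
  qed simp
  then have "(\<integral>\<^sup>+x. ennreal (norm x) \<partial>\<mu>) < \<infinity>" by (simp add: integrable_iff_bounded)
  then show ?thesis using sets p by (simp add: prob1_def)
qed

lemma cv_le_integral_mono:
  assumes "\<mu> \<preceq>\<^sub>c\<^sub>v \<nu>" "\<mu> \<in> prob2" "\<nu> \<in> prob2" "convex_on UNIV \<phi>"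
    and bd: "\<And>x. \<bar>\<phi> x\<bar> \<le> C * (1 + (norm x)\<^sup>2)"
  shows "(\<integral>x. \<phi> x \<partial>\<mu>) \<le> (\<integral>x. \<phi> x \<partial>\<nu>)"
proof -
  have [measurable]: "\<phi> \<in> borel_measurable borel"
    by (rule convex_on_borel_measurable[OF assms(4)])
  have "integrable \<mu> \<phi>" "integrable \<nu> \<phi>"
    by (rule prob2_integrable_quadratic[OF _ _ bd]; fact | simp)+
  moreover have "ext_integral \<mu> \<phi> \<le> ext_integral \<nu> \<phi>" using assms(1,4) by (auto simp: cv_le_def)
  ultimately show ?thesis by (simp add: ext_integral_integrable)
qed

text \<open>Convexity along the line through \<open>x\<close> and \<open>y\<close>, compared with its value at the point of the unit
  sphere around \<open>x\<close> opposite to \<open>y\<close>.\<close>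

lemma convex_lower_cone:
  fixes \<phi> :: "'a::euclidean_space \<Rightarrow> real"
  assumes "convex_on UNIV \<phi>"
  obtains K where "0 \<le> K" "\<And>y. \<phi> x - K * norm (x - y) \<le> \<phi> y"
proof -
  have "continuous_on (cball x 1) \<phi>"
    using convex_on_continuous[OF open_UNIV assms] by (rule continuous_on_subset) simp
  then have "bounded (\<phi> ` cball x 1)" by (intro compact_imp_bounded compact_continuous_image compact_cball)
  then have "\<exists>M. \<forall>z\<in>cball x 1. \<bar>\<phi> z\<bar> \<le> M" by (simp add: bounded_iff)
  then obtain M where M: "\<And>z. z \<in> cball x 1 \<Longrightarrow> \<bar>\<phi> z\<bar> \<le> M" by blast
  have M0: "0 \<le> M" using M[of x] by simp
  show thesis
  \<comment> \<open>One \<open>M\<close> bounds \<open>\<phi> z\<close> at the opposite point, the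
    other bounds \<open>- \<phi> x\<close>.\<close>
  proof (rule that[of "2 * M"])
    fix y
    show "\<phi> x - 2 * M * norm (x - y) \<le> \<phi> y"
    proof (cases "x = y")
      case False
      define r where "r = norm (x - y)"
      have r: "0 < r" using False by (simp add: r_def)
      define z where "z = x + (1 / r) *\<^sub>R (x - y)"
      have z: "z \<in> cball x 1" using r by (simp add: z_def dist_norm r_def)
      \<comment> \<open>The point \<open>x\<close> lies at distance \<open>r\<close> from
        \<open>y\<close> and at distance 1 from \<open>z\<close>, so it divides the segment in the
        ratio \<open>r : 1\<close>.\<close>
      have eq: "(1 - r / (1 + r)) *\<^sub>R y + (r / (1 + r)) *\<^sub>R z = x"
      proof -
        have "(r / (1 + r)) *\<^sub>R z = (r / (1 + r)) *\<^sub>R x + (1 / (1 + r)) *\<^sub>R (x - y)"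
          using r by (simp add: z_def scaleR_add_right)
        moreover have "1 - r / (1 + r) = 1 / (1 + r)" using r by (simp add: field_simps)
        moreover have "p *\<^sub>R y + (q *\<^sub>R x + p *\<^sub>R (x - y)) = (q + p) *\<^sub>R x" for p q :: real
          by (simp add: algebra_simps)
        ultimately have "(1 - r / (1 + r)) *\<^sub>R y + (r / (1 + r)) *\<^sub>R z = (r / (1 + r) + 1 / (1 + r)) *\<^sub>R x"
          by (simp only:)
        moreover have "r / (1 + r) + 1 / (1 + r) = 1" using r by (simp add: field_simps)
        ultimately show ?thesis by (simp only: scaleR_one)
      qed
      have "r / (1 + r) \<le> 1" using r by simp
      then have "\<phi> x \<le> (1 - r / (1 + r)) * \<phi> y + (r / (1 + r)) * \<phi> z"
        using convex_onD[OF assms, of "r / (1 + r)" y z] r unfolding eq by simp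
      then have "(1 + r) * \<phi> x \<le> (1 + r) * ((1 - r / (1 + r)) * \<phi> y + (r / (1 + r)) * \<phi> z)"
        using r by (intro mult_left_mono) auto
      also have "\<dots> = ((1 + r) * (1 - r / (1 + r))) * \<phi> y + ((1 + r) * (r / (1 + r))) * \<phi> z"
        by (simp only: distrib_left mult.assoc)
      also have "(1 + r) * (1 - r / (1 + r)) = 1" using r by (simp add: field_simps)
      also have "(1 + r) * (r / (1 + r)) = r" using r by simp
      finally have "\<phi> x * (1 + r) \<le> \<phi> y + r * \<phi> z" by (simp add: mult.commute)
      moreover have "r * \<phi> z \<le> r * M" "r * (- \<phi> x) \<le> r * M"
        using M[OF z] M[of x] r by (intro mult_left_mono; simp)+
      ultimately show ?thesis unfolding r_def[symmetric] by (simp add: algebra_simps)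
    qed simp
  qed (use M0 in simp)
qed

text \<open>The Pasch-Hausdorff envelope, the largest minorant of \<open>\<phi>\<close> that is
  Lipschitz with constant \<open>m\<close>. The infimum is taken over a set bounded below only when
  \<open>m\<close> is large enough, hence the conditions \<open>K \<le> m\<close> in the facts about
  it.\<close>

definition inf_conv :: "('a::euclidean_space \<Rightarrow> real) \<Rightarrow> real \<Rightarrow> 'a \<Rightarrow> real" where
  "inf_conv \<phi> m x = (INF y. \<phi> y + m * norm (x - y))"

text \<open>The Lipschitz regularisations of a convex function increase to it and have linear growth, so by
  monotone convergence the convex order only needs to be tested on functions of quadratic growth.\<close>

lemma cv_leI_quadratic:
  fixes \<mu> \<nu> :: "'a::euclidean_space measure"
  assumes \<mu>: "\<mu> \<in> prob2" and \<nu>: "\<nu> \<in> prob2"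
    and le: "\<And>\<phi>. convex_on UNIV \<phi> \<Longrightarrow> \<exists>C. \<forall>x. \<bar>\<phi> x\<bar> \<le> C * (1 + (norm x)\<^sup>2) \<Longrightarrow>
      (\<integral>x. \<phi> x \<partial>\<mu>) \<le> (\<integral>x. \<phi> x \<partial>\<nu>)"
  shows "\<mu> \<preceq>\<^sub>c\<^sub>v \<nu>"
  unfolding cv_le_def
proof (intro conjI allI impI)
  show "\<mu> \<in> prob1" "\<nu> \<in> prob1" using \<mu> \<nu> by (auto intro: prob2_imp_prob1)
  fix \<phi> :: "'a \<Rightarrow> real" assume conv: "convex_on UNIV \<phi>"
  obtain K where K: "0 \<le> K" "\<And>y. \<phi> 0 - K * norm (0 - y) \<le> \<phi> y"
    using convex_lower_cone[OF conv] by blast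
  \<comment> \<open>The cone below \<open>\<phi>\<close> with apex at 0 bounds all competitors in
    the infimum at once. This gives boundedness below as well as the linear lower growth of the
    envelope.\<close>
  have lower: "\<phi> 0 - K * norm x \<le> \<phi> y + m * norm (x - y)" if m: "K \<le> m" for m x y
  proof -
    have "K * norm y \<le> K * (norm x + norm (x - y))"
      using K(1) norm_triangle_ineq4[of x "x - y"] by (intro mult_left_mono) auto
    moreover have "K * norm (x - y) \<le> m * norm (x - y)" using m by (rule mult_right_mono) simp
    ultimately show ?thesis using K(2)[of y] by (simp add: algebra_simps)
  qed
  have bdd: "bdd_below (range (\<lambda>y. \<phi> y + m * norm (x - y)))" if "K \<le> m" for m x
    using lower[OF that] by (intro bdd_belowI2) auto
  have inf_le: "inf_conv \<phi> m x \<le> \<phi> y + m * norm (x - y)" if "K \<le> m" for m x y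
    unfolding inf_conv_def by (rule cINF_lower[OF bdd[OF that]]) simp
  have inf_ge: "L \<le> inf_conv \<phi> m x" if "\<And>y. L \<le> \<phi> y + m * norm (x - y)" for L m x
    unfolding inf_conv_def by (rule cINF_greatest) (use that in auto)
  have inf_conv_le: "inf_conv \<phi> m x \<le> \<phi> x" if "K \<le> m" for m x
    using inf_le[OF that, of x x] by simp
  have inf_mono: "inf_conv \<phi> m x \<le> inf_conv \<phi> m' x" if "K \<le> m" "m \<le> m'" for m m' x
  proof (rule inf_ge)
    fix y
    have "m * norm (x - y) \<le> m' * norm (x - y)" using that(2) by (rule mult_right_mono) simp
    then show "inf_conv \<phi> m x \<le> \<phi> y + m' * norm (x - y)" using inf_le[OF that(1), of x y] by simp
  qed
  have inf_convex: "convex_on UNIV (inf_conv \<phi> m)" if m: "K \<le> m" for m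
  proof (rule convex_onI)
    fix t :: real and x y :: 'a assume t: "0 < t" "t < 1"
    let ?I = "inf_conv \<phi> m" and ?w = "(1 - t) *\<^sub>R x + t *\<^sub>R y"
    have main: "?I ?w \<le> (1 - t) * (\<phi> a + m * norm (x - a)) + t * (\<phi> b + m * norm (y - b))" for a b
    proof -
      let ?c = "(1 - t) *\<^sub>R a + t *\<^sub>R b"
      have "?w - ?c = (1 - t) *\<^sub>R (x - a) + t *\<^sub>R (y - b)" by (simp add: algebra_simps)
      then have "norm (?w - ?c) \<le> (1 - t) * norm (x - a) + t * norm (y - b)"
        using norm_triangle_ineq[of "(1 - t) *\<^sub>R (x - a)" "t *\<^sub>R (y - b)"] t by simp
      then have "m * norm (?w - ?c) \<le> m * ((1 - t) * norm (x - a) + t * norm (y - b))"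
        using m K(1) by (intro mult_left_mono) auto
      moreover have "\<phi> ?c \<le> (1 - t) * \<phi> a + t * \<phi> b"
        using convex_onD[OF conv, of t a b] t by simp
      ultimately show ?thesis using inf_le[OF m, of ?w ?c] by (simp add: algebra_simps)
    qed
    \<comment> \<open>The infima over \<open>a\<close> and \<open>b\<close> are taken one after the
      other; isolating the term in question puts each into the form required by
      \<open>inf_ge\<close>.\<close>
    have "(?I ?w - t * (\<phi> b + m * norm (y - b))) / (1 - t) \<le> ?I x" for b
      using main[of _ b] t by (intro inf_ge) (simp add: pos_divide_le_eq mult.commute algebra_simps)
    then have "?I ?w - t * (\<phi> b + m * norm (y - b)) \<le> (1 - t) * ?I x" for b
      using t by (simp add: pos_divide_le_eq mult.commute)
    then have "(?I ?w - (1 - t) * ?I x) / t \<le> \<phi> b + m * norm (y - b)" for b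
      using t by (simp add: pos_divide_le_eq) (simp add: algebra_simps)
    then have "(?I ?w - (1 - t) * ?I x) / t \<le> ?I y" by (rule inf_ge)
    then show "?I ?w \<le> (1 - t) * ?I x + t * ?I y" using t by (simp add: pos_divide_le_eq algebra_simps)
  qed simp
  define \<psi> where "\<psi> n = inf_conv \<phi> (K + real n)" for n :: nat
  have \<psi>_conv: "convex_on UNIV (\<psi> n)" for n unfolding \<psi>_def by (rule inf_convex) simp
  have \<psi>_meas [measurable]: "\<psi> n \<in> borel_measurable borel" for n
    by (rule convex_on_borel_measurable[OF \<psi>_conv])
  have \<phi>_meas [measurable]: "\<phi> \<in> borel_measurable borel"
    by (rule convex_on_borel_measurable[OF conv])
  have \<psi>_quad: "\<exists>C. \<forall>x. \<bar>\<psi> n x\<bar> \<le> C * (1 + (norm x)\<^sup>2)" for n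
  proof (intro exI allI)
    fix x :: 'a
    have "\<psi> n x \<le> \<phi> 0 + (K + real n) * norm x" unfolding \<psi>_def using inf_le[of "K + real n" x 0] by simp
    moreover have "\<phi> 0 - K * norm x \<le> \<psi> n x" unfolding \<psi>_def by (rule inf_ge, rule lower) simp
    moreover have "K * norm x \<le> (K + real n) * norm x" by (rule mult_right_mono) auto
    ultimately have "\<bar>\<psi> n x\<bar> \<le> \<bar>\<phi> 0\<bar> + (K + real n) * norm x" by linarith
    also have "\<dots> \<le> \<bar>\<phi> 0\<bar> * (1 + (norm x)\<^sup>2) + (K + real n) * (1 + (norm x)\<^sup>2)"
    proof (intro add_mono mult_left_mono)
      have "2 * norm x \<le> 1 + (norm x)\<^sup>2" using sum_squares_bound[of 1 "norm x"] by simp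
      then show "norm x \<le> 1 + (norm x)\<^sup>2" using norm_ge_zero[of x] by linarith
    qed (use K(1) in \<open>auto simp: algebra_simps\<close>)
    finally show "\<bar>\<psi> n x\<bar> \<le> (\<bar>\<phi> 0\<bar> + (K + real n)) * (1 + (norm x)\<^sup>2)" by (simp add: distrib_right)
  qed
  \<comment> \<open>The sequence is eventually constant at each point: once the slope exceeds that
    of a cone below \<open>\<phi>\<close> with apex at \<open>x\<close>, the envelope touches
    \<open>\<phi>\<close> there.\<close>
  have \<psi>_lim: "(\<lambda>n. \<psi> n x) \<longlonglongrightarrow> \<phi> x" for x
  proof (rule tendsto_eventually)
    obtain L where L: "0 \<le> L" "\<And>y. \<phi> x - L * norm (x - y) \<le> \<phi> y" using convex_lower_cone[OF conv] by blast
    show "\<forall>\<^sub>F n in sequentially. \<psi> n x = \<phi> x"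
      using eventually_ge_at_top[of "nat \<lceil>L\<rceil>"]
    proof eventually_elim
      case (elim n)
      then have n: "L \<le> K + real n" using K(1) by linarith
      have "\<phi> x \<le> \<psi> n x" unfolding \<psi>_def
      proof (rule inf_ge)
        fix y
        have "L * norm (x - y) \<le> (K + real n) * norm (x - y)" using n by (rule mult_right_mono) simp
        then show "\<phi> x \<le> \<phi> y + (K + real n) * norm (x - y)" using L(2)[of y] by simp
      qed
      moreover have "\<psi> n x \<le> \<phi> x" unfolding \<psi>_def by (rule inf_conv_le) simp
      ultimately show ?case by simp
    qed
  qed
  have \<psi>_mono: "\<psi> m x \<le> \<psi> n x" if "m \<le> n" for m n x unfolding \<psi>_def using that by (intro inf_mono) auto
  have lim: "(\<lambda>n. ext_integral \<rho> (\<psi> n)) \<longlonglongrightarrow> ext_integral \<rho> \<phi>" if \<rho>: "\<rho> \<in> prob2" for \<rho>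
  proof -
    have sets [measurable_cong]: "sets \<rho> = sets borel" using \<rho> by (auto simp: prob2_def measures2_def)
    obtain C where "\<And>x. \<bar>\<psi> 0 x\<bar> \<le> C * (1 + (norm x)\<^sup>2)" using \<psi>_quad[of 0] by blast
    then have "integrable \<rho> (\<psi> 0)" by (intro prob2_integrable_quadratic[OF \<rho>]) auto
    then have fin0: "(\<integral>\<^sup>+x. ennreal (- \<psi> 0 x) \<partial>\<rho>) < \<infinity>" by (auto simp: real_integrable_def less_top)
    \<comment> \<open>Positive parts increase, so monotone convergence applies; negative parts are
      dominated by the integrable one of \<open>\<psi> 0\<close>.\<close>
    have 1: "(\<lambda>n. \<integral>\<^sup>+x. ennreal (\<psi> n x) \<partial>\<rho>) \<longlonglongrightarrow> (\<integral>\<^sup>+x. ennreal (\<phi> x) \<partial>\<rho>)"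
      by (intro nn_integral_LIMSEQ) (auto simp: incseq_def le_fun_def intro!: ennreal_leI \<psi>_mono tendsto_ennrealI \<psi>_lim)
    have 2: "(\<lambda>n. \<integral>\<^sup>+x. ennreal (- \<psi> n x) \<partial>\<rho>) \<longlonglongrightarrow> (\<integral>\<^sup>+x. ennreal (- \<phi> x) \<partial>\<rho>)"
      by (intro nn_integral_dominated_convergence[OF _ _ _ _ fin0])
         (auto intro!: AE_I2 ennreal_leI \<psi>_mono tendsto_ennrealI tendsto_minus \<psi>_lim)
    have "(\<integral>\<^sup>+x. ennreal (- \<phi> x) \<partial>\<rho>) \<le> (\<integral>\<^sup>+x. ennreal (- \<psi> 0 x) \<partial>\<rho>)"
      unfolding \<psi>_def by (intro nn_integral_mono ennreal_leI) (simp add: inf_conv_le)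
    then have fin: "(\<integral>\<^sup>+x. ennreal (- \<phi> x) \<partial>\<rho>) < \<infinity>" using fin0 by simp
    show ?thesis unfolding ext_integral_def
    proof (intro tendsto_diff_ereal_general tendsto_enn2erealI 1 2)
      have "enn2ereal (\<integral>\<^sup>+x. ennreal (- \<phi> x) \<partial>\<rho>) \<noteq> \<infinity>" using fin by (metis enn2ereal_eq_top_iff infinity_ennreal_def less_irrefl top_neq_ennreal)
      moreover have "enn2ereal (\<integral>\<^sup>+x. ennreal (- \<phi> x) \<partial>\<rho>) \<noteq> - \<infinity>" by (metis enn2ereal_nonneg ereal_infty_less_eq(2) ereal_less_eq(2) MInfty_neq_PInfty(1) not_MInfty_nonneg)
      ultimately show "\<not> (enn2ereal (\<integral>\<^sup>+x. ennreal (\<phi> x) \<partial>\<rho>) = \<infinity> \<and> enn2ereal (\<integral>\<^sup>+x. ennreal (- \<phi> x) \<partial>\<rho>) = \<infinity> \<or>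
         enn2ereal (\<integral>\<^sup>+x. ennreal (\<phi> x) \<partial>\<rho>) = - \<infinity> \<and> enn2ereal (\<integral>\<^sup>+x. ennreal (- \<phi> x) \<partial>\<rho>) = - \<infinity>)" by simp
    qed
  qed
  show "ext_integral \<mu> \<phi> \<le> ext_integral \<nu> \<phi>"
  proof (rule LIMSEQ_le[OF lim[OF \<mu>] lim[OF \<nu>]], intro exI allI impI)
    fix n :: nat
    obtain C where C: "\<And>x. \<bar>\<psi> n x\<bar> \<le> C * (1 + (norm x)\<^sup>2)" using \<psi>_quad[of n] by blast
    have "integrable \<mu> (\<psi> n)" "integrable \<nu> (\<psi> n)"
      by (auto intro!: prob2_integrable_quadratic[OF _ _ C] \<mu> \<nu>)
    then show "ext_integral \<mu> (\<psi> n) \<le> ext_integral \<nu> (\<psi> n)"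
      using le[OF \<psi>_conv \<psi>_quad, of n] by (simp add: ext_integral_integrable)
  qed
qed


subsection \<open>Separability of integrable functions on the unit interval\<close>

text \<open>Integrability of the approximant is demanded explicitly: the Bochner integral of a
  function that is not integrable is 0 and would count as closeness.\<close>

definition L1_approx :: "'a measure \<Rightarrow> ('a \<Rightarrow> real) set \<Rightarrow> ('a \<Rightarrow> real) \<Rightarrow> bool" where
  "L1_approx M D f \<longleftrightarrow> integrable M f \<and> (\<forall>e>0. \<exists>c\<in>D. integrable M c \<and> (\<integral>x. \<bar>f x - c x\<bar> \<partial>M) < e)"

lemma L1_approx_self: "integrable M f \<Longrightarrow> f \<in> D \<Longrightarrow> L1_approx M D f"
  unfolding L1_approx_def by (auto intro!: bexI[of _ f])

lemma L1_approx_close: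
  assumes f: "integrable M f" and close: "\<And>e. 0 < e \<Longrightarrow> \<exists>g. L1_approx M D g \<and> (\<integral>x. \<bar>f x - g x\<bar> \<partial>M) < e"
  shows "L1_approx M D f"
  unfolding L1_approx_def
proof (intro conjI allI impI f)
  fix e :: real assume e: "0 < e"
  obtain g where g: "L1_approx M D g" "(\<integral>x. \<bar>f x - g x\<bar> \<partial>M) < e / 2"
    using close[of "e / 2"] e by auto
  obtain c where c: "c \<in> D" "integrable M c" "(\<integral>x. \<bar>g x - c x\<bar> \<partial>M) < e / 2"
    using g(1) e unfolding L1_approx_def by (meson half_gt_zero)
  have gi: "integrable M g" using g(1) by (simp add: L1_approx_def)
  have "(\<integral>x. \<bar>f x - c x\<bar> \<partial>M) \<le> (\<integral>x. \<bar>f x - g x\<bar> + \<bar>g x - c x\<bar> \<partial>M)"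
    using f gi c by (intro integral_mono) auto
  also have "\<dots> = (\<integral>x. \<bar>f x - g x\<bar> \<partial>M) + (\<integral>x. \<bar>g x - c x\<bar> \<partial>M)" using f gi c by simp
  also have "\<dots> < e" using g(2) c(3) by simp
  finally show "\<exists>c\<in>D. integrable M c \<and> (\<integral>x. \<bar>f x - c x\<bar> \<partial>M) < e" using c by blast
qed

lemma L1_approx_lim:
  assumes s: "\<And>i::nat. L1_approx M D (s i)" and lim: "\<And>x. x \<in> space M \<Longrightarrow> (\<lambda>i. s i x) \<longlonglongrightarrow> f x"
    and w: "integrable M w" "\<And>i x. x \<in> space M \<Longrightarrow> \<bar>s i x\<bar> \<le> w x" and f: "integrable M f"
  shows "L1_approx M D f"
proof (rule L1_approx_close[OF f])
  have si: "integrable M (s i)" for i using s[of i] by (simp add: L1_approx_def)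
  have "(\<lambda>i. \<integral>x. \<bar>f x - s i x\<bar> \<partial>M) \<longlonglongrightarrow> (\<integral>x. 0 \<partial>M)"
  proof (rule integral_dominated_convergence[where w="\<lambda>x. \<bar>f x\<bar> + w x"])
    show "AE x in M. (\<lambda>i. \<bar>f x - s i x\<bar>) \<longlonglongrightarrow> 0"
    proof (rule AE_I2)
      fix x assume "x \<in> space M"
      then have "(\<lambda>i. \<bar>f x - s i x\<bar>) \<longlonglongrightarrow> \<bar>f x - f x\<bar>" by (intro tendsto_intros lim)
      then show "(\<lambda>i. \<bar>f x - s i x\<bar>) \<longlonglongrightarrow> 0" by simp
    qed
    show "AE x in M. norm \<bar>f x - s i x\<bar> \<le> \<bar>f x\<bar> + w x" for i
      using w(2)[of _ i] by (intro AE_I2) (smt (verit) real_norm_def)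
  qed (use f si w(1) in auto)
  then have L: "(\<lambda>i. \<integral>x. \<bar>f x - s i x\<bar> \<partial>M) \<longlonglongrightarrow> 0" by simp
  fix e :: real assume "0 < e"
  from order_tendstoD(2)[OF L this] obtain i where "(\<integral>x. \<bar>f x - s i x\<bar> \<partial>M) < e"
    by (auto simp: eventually_sequentially)
  then show "\<exists>g. L1_approx M D g \<and> (\<integral>x. \<bar>f x - g x\<bar> \<partial>M) < e" using s by blast
qed

lemma L1_approx_add:
  assumes D: "\<And>c d. c \<in> D \<Longrightarrow> d \<in> D \<Longrightarrow> (\<lambda>x. c x + d x) \<in> D"
    and f: "L1_approx M D f" and g: "L1_approx M D g"
  shows "L1_approx M D (\<lambda>x. f x + g x)"
  unfolding L1_approx_def
proof (intro conjI allI impI)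
  have fi: "integrable M f" "integrable M g" using f g by (auto simp: L1_approx_def)
  then show "integrable M (\<lambda>x. f x + g x)" by simp
  fix e :: real assume e: "0 < e"
  obtain c where c: "c \<in> D" "integrable M c" "(\<integral>x. \<bar>f x - c x\<bar> \<partial>M) < e / 2"
    using f e unfolding L1_approx_def by (meson half_gt_zero)
  obtain d where d: "d \<in> D" "integrable M d" "(\<integral>x. \<bar>g x - d x\<bar> \<partial>M) < e / 2"
    using g e unfolding L1_approx_def by (meson half_gt_zero)
  have "(\<integral>x. \<bar>(f x + g x) - (c x + d x)\<bar> \<partial>M) \<le> (\<integral>x. \<bar>f x - c x\<bar> + \<bar>g x - d x\<bar> \<partial>M)"
    using fi c d by (intro integral_mono) auto
  also have "\<dots> = (\<integral>x. \<bar>f x - c x\<bar> \<partial>M) + (\<integral>x. \<bar>g x - d x\<bar> \<partial>M)" using fi c d by simp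
  also have "\<dots> < e" using c d by simp
  finally show "\<exists>c\<in>D. integrable M c \<and> (\<integral>x. \<bar>f x + g x - c x\<bar> \<partial>M) < e"
    using D[OF c(1) d(1)] c(2) d(2) by (intro bexI[of _ "\<lambda>x. c x + d x"]) auto
qed

text \<open>Only rational multiples stay in \<open>D\<close>, so that it can be countable. The error
  is \<open>r * (f - c) + (q - r) * c\<close> up to the sign of the second part, and each part
  receives \<open>e / 2\<close>; the summand 1 in the denominators covers \<open>r = 0\<close> and
  \<open>c = 0\<close>.\<close>

lemma L1_approx_scale:
  assumes D: "\<And>c q. c \<in> D \<Longrightarrow> (\<lambda>x. real_of_rat q * c x) \<in> D" and f: "L1_approx M D f"
  shows "L1_approx M D (\<lambda>x. r * f x)"
  unfolding L1_approx_def
proof (intro conjI allI impI)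
  have fi: "integrable M f" using f by (auto simp: L1_approx_def)
  then show "integrable M (\<lambda>x. r * f x)" by simp
  fix e :: real assume e: "0 < e"
  have "0 < e / 2 / (1 + \<bar>r\<bar>)" using e by (simp add: divide_pos_pos)
  then obtain c where c: "c \<in> D" "integrable M c" "(\<integral>x. \<bar>f x - c x\<bar> \<partial>M) < e / 2 / (1 + \<bar>r\<bar>)"
    using f unfolding L1_approx_def by meson
  define I where "I = (\<integral>x. \<bar>c x\<bar> \<partial>M)"
  have I: "0 \<le> I" by (simp add: I_def)
  obtain q where q: "r < real_of_rat q" "real_of_rat q < r + e / 2 / (1 + I)"
    using of_rat_dense[of r "r + e / 2 / (1 + I)"] e I by (auto simp: divide_pos_pos)
  have "(\<integral>x. \<bar>r * f x - real_of_rat q * c x\<bar> \<partial>M) \<le> (\<integral>x. \<bar>r\<bar> * \<bar>f x - c x\<bar> + \<bar>r - real_of_rat q\<bar> * \<bar>c x\<bar> \<partial>M)"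
  proof (rule integral_mono)
    fix x
    have "r * f x - real_of_rat q * c x = r * (f x - c x) + (r - real_of_rat q) * c x" by (simp add: algebra_simps)
    then show "\<bar>r * f x - real_of_rat q * c x\<bar> \<le> \<bar>r\<bar> * \<bar>f x - c x\<bar> + \<bar>r - real_of_rat q\<bar> * \<bar>c x\<bar>"
      by (metis abs_mult abs_triangle_ineq)
  qed (use fi c in auto)
  also have "\<dots> = \<bar>r\<bar> * (\<integral>x. \<bar>f x - c x\<bar> \<partial>M) + \<bar>r - real_of_rat q\<bar> * I"
    unfolding I_def using fi c by simp
  also have "\<dots> < e"
  proof -
    have "\<bar>r\<bar> * (\<integral>x. \<bar>f x - c x\<bar> \<partial>M) \<le> \<bar>r\<bar> * (e / 2 / (1 + \<bar>r\<bar>))"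
      using c(3) by (intro mult_left_mono) auto
    also have "\<dots> < e / 2" using e by (simp add: field_simps)
    finally have 1: "\<bar>r\<bar> * (\<integral>x. \<bar>f x - c x\<bar> \<partial>M) < e / 2" .
    have "\<bar>r - real_of_rat q\<bar> * I \<le> (e / 2 / (1 + I)) * I"
      using q I by (intro mult_right_mono) auto
    also have "\<dots> \<le> e / 2" using e I by (simp add: field_simps)
    finally show ?thesis using 1 by simp
  qed
  finally show "\<exists>c\<in>D. integrable M c \<and> (\<integral>x. \<bar>r * f x - c x\<bar> \<partial>M) < e"
    using D[OF c(1), of q] c(2) by (intro bexI[of _ "\<lambda>x. real_of_rat q * c x"]) auto
qed

text \<open>The dense set consists of the rational combinations of indicators of generating sets. A
  Dynkin argument extends approximability from the generator to all measurable sets, and linearity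
  with dominated convergence extends it to all integrable functions.\<close>

lemma L1_separable:
  assumes fin: "finite_measure M" and gen: "sets M = sigma_sets (space M) E"
    and E: "countable E" "Int_stable E" "E \<subseteq> Pow (space M)"
  shows "\<exists>C :: nat \<Rightarrow> 'a \<Rightarrow> real. \<forall>f. integrable M f \<longrightarrow>
    (\<forall>e>0. \<exists>n. integrable M (C n) \<and> (\<integral>x. \<bar>f x - C n x\<bar> \<partial>M) < e)"
proof -
  interpret finite_measure M by fact
  define comb :: "(rat \<times> 'a set) list \<Rightarrow> 'a \<Rightarrow> real"
    where "comb l x = (\<Sum>(q, A)\<leftarrow>l. real_of_rat q * indicator A x)" for l x
  \<comment> \<open>The whole space is added to the generator because the indicator of a complement
    is formed by subtraction from that of the space.\<close>
  define D where "D = comb ` lists (UNIV \<times> insert (space M) E)"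
  have Dc: "countable D" unfolding D_def using E(1) by (intro countable_image countable_lists countable_SIGMA) auto
  have D0: "(\<lambda>x. 0) \<in> D" unfolding D_def by (intro image_eqI[of _ _ "[]"]) (auto simp: comb_def)
  have D1: "indicator A \<in> D" if "A \<in> insert (space M) E" for A
    unfolding D_def using that by (intro image_eqI[of _ _ "[(1, A)]"]) (auto simp: comb_def fun_eq_iff)
  have Dadd: "(\<lambda>x. c x + d x) \<in> D" if cd: "c \<in> D" "d \<in> D" for c d
  proof -
    obtain l k where "l \<in> lists (UNIV \<times> insert (space M) E)" "c = comb l"
      "k \<in> lists (UNIV \<times> insert (space M) E)" "d = comb k" using cd unfolding D_def by blast
    then show ?thesis unfolding D_def by (intro image_eqI[of _ _ "l @ k"]) (auto simp: comb_def fun_eq_iff)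
  qed
  have Dscale: "(\<lambda>x. real_of_rat q * c x) \<in> D" if c: "c \<in> D" for c q
  proof -
    obtain l where l: "l \<in> lists (UNIV \<times> insert (space M) E)" "c = comb l" using c unfolding D_def by blast
    let ?l = "map (\<lambda>(p, A). (q * p, A)) l"
    have "comb ?l = (\<lambda>x. real_of_rat q * c x)"
      unfolding l(2) comb_def by (auto simp: fun_eq_iff sum_list_const_mult[symmetric] o_def of_rat_mult mult.assoc split_beta')
    moreover have "?l \<in> lists (UNIV \<times> insert (space M) E)" using l(1) by (auto simp: in_lists_conv_set)
    ultimately show ?thesis unfolding D_def by (intro image_eqI[of _ _ ?l]) auto
  qed
  have add: "L1_approx M D (\<lambda>x. f x + g x)" if "L1_approx M D f" "L1_approx M D g" for f g
    by (rule L1_approx_add[OF Dadd that])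
  have scale: "L1_approx M D (\<lambda>x. r * f x)" if f: "L1_approx M D f" for f and r :: real
    by (rule L1_approx_scale[OF _ f]) (rule Dscale)
  have ind_int: "integrable M (indicator A :: 'a \<Rightarrow> real)" if "A \<in> sets M" for A
    using that by (intro integrable_const_bound[where B=1]) auto
  have space: "L1_approx M D (indicator (space M))" by (intro L1_approx_self ind_int D1) auto
  have ind: "L1_approx M D (indicator A)" if A: "A \<in> sets M" for A
    using E(2,3) A[unfolded gen]
  proof (induction rule: sigma_sets_induct_disjoint)
    case (basic A)
    then have "A \<in> sets M" using gen by auto
    then show ?case by (intro L1_approx_self ind_int D1) (use basic in auto)
  next
    case empty
    have "indicator {} = (\<lambda>x::'a. 0::real)" by auto
    then show ?case by (simp add: L1_approx_self D0)
  next
    case (compl A)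
    then have Am: "A \<in> sets M" by (simp add: gen)
    have "L1_approx M D (\<lambda>x. indicator (space M) x + (-1) * indicator A x)"
      by (intro add scale space compl)
    moreover have "(\<lambda>x. indicator (space M) x + (-1) * indicator A x) = (indicator (space M - A) :: 'a \<Rightarrow> real)"
      using sets.sets_into_space[OF Am] by (auto simp: fun_eq_iff indicator_def)
    ultimately show ?case by simp
  next
    case (union A)
    then have Am: "A i \<in> sets M" for i using gen by auto
    have part: "L1_approx M D (indicator (\<Union>i<n. A i))" for n
    proof (induction n)
      case 0
      have "indicator {} = (\<lambda>x::'a. 0::real)" by auto
      then show ?case by (simp add: L1_approx_self D0)
    next
      case (Suc n)
      have "L1_approx M D (\<lambda>x. indicator (\<Union>i<n. A i) x + indicator (A n) x)"
        using union Suc by (intro add) auto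
      moreover have "A i \<inter> A n = {}" if "i < n" for i
        using union(1) that by (simp add: disjoint_family_on_def)
      then have "(\<Union>i<n. A i) \<inter> A n = {}" by blast
      then have "(\<lambda>x. indicator (\<Union>i<n. A i) x + indicator (A n) x) = (indicator (\<Union>i<Suc n. A i) :: 'a \<Rightarrow> real)"
        by (auto simp: fun_eq_iff indicator_def less_Suc_eq)
      ultimately show ?case by simp
    qed
    show ?case
    proof (rule L1_approx_lim[OF part, where w="\<lambda>_. 1"])
      show "(\<lambda>n. indicator (\<Union>i<n. A i) x) \<longlonglongrightarrow> (indicator (\<Union> (range A)) x :: real)" for x
        by (rule LIMSEQ_indicator_UN)
      show "integrable M (indicator (\<Union> (range A)) :: 'a \<Rightarrow> real)" using Am by (intro ind_int) auto
    qed (auto simp: indicator_def)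
  qed
  have all: "L1_approx M D f" if "integrable M f" for f
    using that
  proof (induction rule: integrable_induct)
    case (base A c)
    then show ?case using scale[OF ind[OF base(1)], of c] by (simp add: mult.commute)
  next
    case (add f g)
    show ?case
      by (rule L1_approx_add[OF _ \<open>L1_approx M D f\<close> \<open>L1_approx M D g\<close>]) (rule Dadd)
  next
    case (lim f s)
    show ?case
      by (rule L1_approx_lim[where s=s and w="\<lambda>x. 2 * \<bar>f x\<bar>"]) (use lim in auto)
  qed
  show ?thesis
  proof (intro exI[of _ "from_nat_into D"] allI impI)
    fix f :: "'a \<Rightarrow> real" and e :: real assume "integrable M f" "0 < e"
    then obtain c where c: "c \<in> D" "integrable M c" "(\<integral>x. \<bar>f x - c x\<bar> \<partial>M) < e"
      using all unfolding L1_approx_def by meson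
    then show "\<exists>n. integrable M (from_nat_into D n) \<and> (\<integral>x. \<bar>f x - from_nat_into D n x\<bar> \<partial>M) < e"
      using from_nat_into_surj[OF Dc c(1)] by metis
  qed
qed

section \<open>Lebesgue measure on the unit interval\<close>

abbreviation unit_leb :: "real measure" where
  "unit_leb \<equiv> restrict_space lborel {0..1}"

abbreviation unit_borel :: "real measure" where
  "unit_borel \<equiv> restrict_space borel {0..1}"

lemma sets_unit_leb: "sets unit_leb = sets unit_borel"
  by (simp add: sets_restrict_space)

lemma prob_space_unit_leb: "prob_space unit_leb"
  by (rule prob_spaceI) (simp add: emeasure_restrict_space space_restrict_space)

lemma unit_leb_L1_separable:
  "\<exists>C :: nat \<Rightarrow> real \<Rightarrow> real. \<forall>f. integrable unit_leb f \<longrightarrow>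
    (\<forall>e>0. \<exists>n. integrable unit_leb (C n) \<and> (\<integral>x. \<bar>f x - C n x\<bar> \<partial>unit_leb) < e)"
proof -
  obtain B :: "real set set" where B: "countable B" "topological_basis B"
    using ex_countable_basis by blast
  \<comment> \<open>A basis of the topology need not be closed under intersections, but its finite
    intersections are, and they remain countably many.\<close>
  define E where "E = (\<lambda>F. \<Inter>F) ` {F. finite F \<and> F \<subseteq> B}"
  have E: "countable E" unfolding E_def by (intro countable_image countable_Collect_finite_subset B)
  have stE: "Int_stable E"
  proof (rule Int_stableI)
    fix a b assume "a \<in> E" "b \<in> E"
    then obtain F F' where "finite F" "F \<subseteq> B" "a = \<Inter>F" "finite F'" "F' \<subseteq> B" "b = \<Inter>F'" by (auto simp: E_def)
    then show "a \<inter> b \<in> E" unfolding E_def by (intro image_eqI[of _ _ "F \<union> F'"]) auto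
  qed
  have borelE: "sets (borel :: real measure) = sigma_sets UNIV E"
  proof
    have "sets (borel :: real measure) = sigma_sets UNIV B"
      by (subst borel_eq_countable_basis[OF B]) simp
    also have "\<dots> \<subseteq> sigma_sets UNIV E"
    proof (rule sigma_sets_mono)
      show "B \<subseteq> sigma_sets UNIV E"
      proof
        fix b assume "b \<in> B"
        then have "b \<in> E" unfolding E_def by (intro image_eqI[of _ _ "{b}"]) auto
        then show "b \<in> sigma_sets UNIV E" by auto
      qed
    qed
    finally show "sets (borel :: real measure) \<subseteq> sigma_sets UNIV E" .
    have "open a" if "a \<in> E" for a
      using that topological_basis_open[OF B(2)] by (auto simp: E_def intro!: open_Inter)
    then have "E \<subseteq> sets borel" by auto
    then show "sigma_sets UNIV E \<subseteq> sets (borel :: real measure)"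
      using sets.sigma_sets_subset[of E borel] by simp
  qed
  show ?thesis
  proof (rule L1_separable)
    interpret prob_space unit_leb by (rule prob_space_unit_leb)
    show "finite_measure unit_leb" by (rule finite_measure_axioms)
    show "sets unit_leb = sigma_sets (space unit_leb) ((\<inter>) {0..1} ` E)"
    proof -
      have "{0..1} \<in> sigma_sets UNIV E" unfolding borelE[symmetric] by simp
      then show ?thesis
        using sigma_sets_Int[of "{0..1}" UNIV E] by (simp add: sets_restrict_space space_restrict_space borelE)
    qed
    show "countable ((\<inter>) {0..1} ` E)" using E by simp
    show "Int_stable ((\<inter>) {0..1::real} ` E)"
    proof (rule Int_stableI)
      fix a b assume "a \<in> (\<inter>) {0..1::real} ` E" "b \<in> (\<inter>) {0..1::real} ` E"
      then obtain c d where cd: "c \<in> E" "d \<in> E" "a = {0..1} \<inter> c" "b = {0..1} \<inter> d" by blast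
      then have "a \<inter> b = {0..1} \<inter> (c \<inter> d)" by blast
      moreover have "c \<inter> d \<in> E" using stE cd by (auto simp: Int_stable_def)
      ultimately show "a \<inter> b \<in> (\<inter>) {0..1::real} ` E" by blast
    qed
    show "(\<inter>) {0..1} ` E \<subseteq> Pow (space unit_leb)" by (auto simp: space_restrict_space)
  qed
qed

text \<open>Separability of \<open>L\<^sup>1\<close> makes every function of \<open>u\<close> measurable which is continuous for the
  pseudometric \<open>\<integral>|G(u,v) - G(u',v)| dv\<close>.\<close>

lemma measurable_of_L1_continuous:
  fixes \<Phi> :: "'n \<Rightarrow> 'b::topological_space" and g :: "'n \<Rightarrow> real \<Rightarrow> real"
  assumes g: "(\<lambda>p. g (fst p) (snd p)) \<in> borel_measurable (N \<Otimes>\<^sub>M unit_leb)"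
    and gi: "\<And>u. u \<in> space N \<Longrightarrow> integrable unit_leb (g u)"
    and cont: "\<And>u V. u \<in> space N \<Longrightarrow> open V \<Longrightarrow> \<Phi> u \<in> V \<Longrightarrow>
      \<exists>\<delta>>0. \<forall>u'\<in>space N. (\<integral>v. \<bar>g u v - g u' v\<bar> \<partial>unit_leb) < \<delta> \<longrightarrow> \<Phi> u' \<in> V"
  shows "\<Phi> \<in> borel_measurable N"
proof (rule borel_measurableI)
  fix V :: "'b set" assume V: "open V"
  interpret prob_space unit_leb by (rule prob_space_unit_leb)
  obtain C :: "nat \<Rightarrow> real \<Rightarrow> real" where C: "\<And>f e. integrable unit_leb f \<Longrightarrow> 0 < e \<Longrightarrow>
      \<exists>n. integrable unit_leb (C n) \<and> (\<integral>x. \<bar>f x - C n x\<bar> \<partial>unit_leb) < e"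
    using unit_leb_L1_separable by blast
  \<comment> \<open>Balls with countably many centres and radii, each measurable by Fubini. By
    continuity the preimage of \<open>V\<close> is the union of the balls contained in it.\<close>
  define B where "B n k = {u \<in> space N. (\<integral>v. \<bar>g u v - C n v\<bar> \<partial>unit_leb) < 1 / real (Suc k)}" for n k
  define J where "J = {(n, k). integrable unit_leb (C n) \<and> B n k \<subseteq> \<Phi> -` V}"
  have Bm: "B n k \<in> sets N" if n: "integrable unit_leb (C n)" for n k
  proof -
    have "(\<lambda>p. \<bar>g (fst p) (snd p) - C n (snd p)\<bar>) \<in> borel_measurable (N \<Otimes>\<^sub>M unit_leb)"
      using g n by (intro borel_measurable_abs borel_measurable_diff measurable_compose[OF measurable_snd]) auto
    then have "(\<lambda>u. \<integral>v. \<bar>g u v - C n v\<bar> \<partial>unit_leb) \<in> borel_measurable N"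
      by (intro borel_measurable_lebesgue_integral) (simp add: split_beta')
    then show ?thesis unfolding B_def by measurable
  qed
  have "\<Phi> -` V \<inter> space N = (\<Union>(n, k)\<in>J. B n k)"
  proof (intro equalityI subsetI)
    fix u assume "u \<in> \<Phi> -` V \<inter> space N"
    then have u: "u \<in> space N" "\<Phi> u \<in> V" by auto
    obtain \<delta> where \<delta>: "0 < \<delta>" "\<And>u'. u' \<in> space N \<Longrightarrow> (\<integral>v. \<bar>g u v - g u' v\<bar> \<partial>unit_leb) < \<delta> \<Longrightarrow> \<Phi> u' \<in> V"
      using cont[OF u(1) V u(2)] by blast
    \<comment> \<open>Half of \<open>\<delta>\<close>, because two members of a ball are compared
      through its centre.\<close>
    obtain k where k: "1 / real (Suc k) < \<delta> / 2" using \<delta>(1) by (meson half_gt_zero nat_approx_posE)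
    obtain n where n: "integrable unit_leb (C n)" "(\<integral>v. \<bar>g u v - C n v\<bar> \<partial>unit_leb) < 1 / real (Suc k)"
      using C[OF gi[OF u(1)], of "1 / real (Suc k)"] by auto
    have "B n k \<subseteq> \<Phi> -` V"
    proof
      fix u' assume "u' \<in> B n k"
      then have u': "u' \<in> space N" "(\<integral>v. \<bar>g u' v - C n v\<bar> \<partial>unit_leb) < 1 / real (Suc k)" by (auto simp: B_def)
      have "(\<integral>v. \<bar>g u v - g u' v\<bar> \<partial>unit_leb) \<le> (\<integral>v. \<bar>g u v - C n v\<bar> + \<bar>g u' v - C n v\<bar> \<partial>unit_leb)"
        using gi[OF u(1)] gi[OF u'(1)] n(1) by (intro integral_mono) auto
      also have "\<dots> = (\<integral>v. \<bar>g u v - C n v\<bar> \<partial>unit_leb) + (\<integral>v. \<bar>g u' v - C n v\<bar> \<partial>unit_leb)"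
        using gi[OF u(1)] gi[OF u'(1)] n(1) by simp
      also have "\<dots> < \<delta>" using n(2) u'(2) k by linarith
      finally show "u' \<in> \<Phi> -` V" using \<delta>(2)[OF u'(1)] by simp
    qed
    then have "(n, k) \<in> J" "u \<in> B n k" using n u by (auto simp: J_def B_def)
    then show "u \<in> (\<Union>(n, k)\<in>J. B n k)" by blast
  qed (auto simp: J_def B_def)
  moreover have "(\<Union>(n, k)\<in>J. B n k) \<in> sets N"
    by (intro sets.countable_UN'') (auto simp: J_def intro!: Bm countableI_type)
  ultimately show "\<Phi> -` V \<inter> space N \<in> sets N" by simp
qed


subsection \<open>Upper bounds for the transport distance\<close>

lemma W2_power2_le:
  assumes \<pi>: "\<pi> \<in> couplings \<mu> \<nu>" and le: "(\<integral>\<^sup>+(x, y). ennreal ((norm (x - y))\<^sup>2) \<partial>\<pi>) \<le> ennreal c" and c: "0 \<le> c"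
  shows "(W2 \<mu> \<nu>)\<^sup>2 \<le> c"
proof -
  have "(INF \<pi>\<in>couplings \<mu> \<nu>. \<integral>\<^sup>+(x, y). ennreal ((norm (x - y))\<^sup>2) \<partial>\<pi>) \<le> ennreal c"
    by (rule INF_lower2[OF \<pi>]) (rule le)
  then have "enn2real (INF \<pi>\<in>couplings \<mu> \<nu>. \<integral>\<^sup>+(x, y). ennreal ((norm (x - y))\<^sup>2) \<partial>\<pi>) \<le> c"
    using c by (rule enn2real_leI[rotated])
  then show ?thesis by (simp add: W2_def)
qed

lemma W2_self:
  fixes \<mu> :: "'a::euclidean_space measure"
  assumes [measurable_cong]: "sets \<mu> = sets borel"
  shows "W2 \<mu> \<mu> = 0"
proof -
  have sp: "space \<mu> = UNIV" using sets_eq_imp_space_eq[OF assms] by simp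
  have m [measurable]: "(\<lambda>x. (x, x)) \<in> \<mu> \<rightarrow>\<^sub>M borel \<Otimes>\<^sub>M borel" by measurable
  let ?\<pi> = "distr \<mu> (borel \<Otimes>\<^sub>M borel) (\<lambda>x. (x, x))"
  have "?\<pi> \<in> couplings \<mu> \<mu>"
    using assms by (auto simp: couplings_def distr_distr o_def distr_id2)
  moreover have "(\<integral>\<^sup>+(x, y). ennreal ((norm (x - y))\<^sup>2) \<partial>?\<pi>) \<le> ennreal 0"
    by (subst nn_integral_distr[OF m]) auto
  ultimately have "(W2 \<mu> \<mu>)\<^sup>2 \<le> 0" by (rule W2_power2_le) simp
  then show ?thesis by simp
qed

lemma WOP2_self: "WOP2 x\<^sub>0 \<mu> \<mu> = 0"
  by (simp add: WOP2_def W2_self)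

lemma norm_diff_power2_le: "(norm (x - y))\<^sup>2 \<le> 2 * (norm x)\<^sup>2 + 2 * (norm (y::'a::real_normed_vector))\<^sup>2"
proof -
  have "(norm (x - y))\<^sup>2 \<le> (norm x + norm y)\<^sup>2" by (intro power_mono norm_triangle_ineq4) simp
  also have "\<dots> \<le> 2 * (norm x)\<^sup>2 + 2 * (norm y)\<^sup>2"
    using sum_squares_bound[of "norm x" "norm y"] by (simp add: power2_sum)
  finally show ?thesis .
qed

lemma norm_add_power2_le: "(norm (x + y))\<^sup>2 \<le> 2 * (norm x)\<^sup>2 + 2 * (norm (y::'a::real_normed_vector))\<^sup>2"
  using norm_diff_power2_le[of x "- y"] by simp

text \<open>The common part \<open>min p\<^sub>1 p\<^sub>2\<close> is transported along the diagonal and the remainders are coupled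
  independently. The coupling is the image of a density on \<open>bool \<times> S \<times> S\<close>, where the
  Boolean records which of the two cases applies.\<close>

lemma W2_density_le:
  fixes \<Gamma> :: "'b measure" and f1 f2 :: "'b \<Rightarrow> 'a::euclidean_space" and p1 p2 :: "'b \<Rightarrow> ennreal"
  assumes sf: "sigma_finite_measure \<Gamma>"
    and [measurable]: "p1 \<in> borel_measurable \<Gamma>" "p2 \<in> borel_measurable \<Gamma>"
      "f1 \<in> borel_measurable \<Gamma>" "f2 \<in> borel_measurable \<Gamma>"
    and fin: "\<And>s. p1 s < \<infinity>" "\<And>s. p2 s < \<infinity>"
    and one: "(\<integral>\<^sup>+s. p1 s \<partial>\<Gamma>) = 1" "(\<integral>\<^sup>+s. p2 s \<partial>\<Gamma>) = 1"
    and bound: "(\<integral>\<^sup>+s. min (p1 s) (p2 s) * ennreal ((norm (f1 s - f2 s))\<^sup>2) \<partial>\<Gamma>)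
      + (2 * (\<integral>\<^sup>+s. (p1 s - p2 s) * ennreal ((norm (f1 s))\<^sup>2) \<partial>\<Gamma>)
      + 2 * (\<integral>\<^sup>+s. (p2 s - p1 s) * ennreal ((norm (f2 s))\<^sup>2) \<partial>\<Gamma>)) \<le> ennreal c" and c: "0 \<le> c"
  shows "(W2 (distr (density \<Gamma> p1) borel f1) (distr (density \<Gamma> p2) borel f2))\<^sup>2 \<le> c"
proof -
  interpret sigma_finite_measure \<Gamma> by fact
  interpret GG: pair_sigma_finite \<Gamma> \<Gamma> ..
  define q where "q s = min (p1 s) (p2 s)" for s
  define d1 where "d1 s = p1 s - p2 s" for s
  define d2 where "d2 s = p2 s - p1 s" for s
  have [measurable]: "q \<in> borel_measurable \<Gamma>" "d1 \<in> borel_measurable \<Gamma>" "d2 \<in> borel_measurable \<Gamma>"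
    unfolding q_def[abs_def] d1_def[abs_def] d2_def[abs_def] by measurable
  have min_diff: "min a b + (a - b) = a" if "a < \<infinity>" for a b :: ennreal
    using that by (cases "a \<le> b") (auto simp: min_def diff_eq_0_ennreal diff_add_cancel_ennreal add.commute)
  have qd: "q s + d1 s = p1 s" "q s + d2 s = p2 s" for s
    using min_diff[OF fin(1)[of s], of "p2 s"] min_diff[OF fin(2)[of s], of "p1 s"]
    by (simp_all add: q_def d1_def d2_def min.commute)
  \<comment> \<open>The mass left after the diagonal transport. It is the same on both sides because
    the total masses agree.\<close>
  define r where "r = (\<integral>\<^sup>+s. d1 s \<partial>\<Gamma>)"
  have sum1: "(\<integral>\<^sup>+s. q s \<partial>\<Gamma>) + r = 1" and sum2: "(\<integral>\<^sup>+s. q s \<partial>\<Gamma>) + (\<integral>\<^sup>+s. d2 s \<partial>\<Gamma>) = 1"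
    using nn_integral_add[of q \<Gamma> d1] nn_integral_add[of q \<Gamma> d2] by (simp_all add: qd one r_def)
  have "(\<integral>\<^sup>+s. q s \<partial>\<Gamma>) \<noteq> \<infinity>" using sum1 by auto
  then have r2: "(\<integral>\<^sup>+s. d2 s \<partial>\<Gamma>) = r"
    using ennreal_add_left_cancel[of "\<integral>\<^sup>+s. q s \<partial>\<Gamma>" "\<integral>\<^sup>+s. d2 s \<partial>\<Gamma>" r] sum1 sum2 by simp
  have rfin: "r < \<infinity>"
  proof (rule ccontr)
    assume "\<not> r < \<infinity>"
    then have "r = \<infinity>" by (simp add: less_top[symmetric])
    then show False using sum1 by simp
  qed
  \<comment> \<open>The second remainder, normalised. If nothing remains, any probability density
    will do, and \<open>p2\<close> is one.\<close>
  define \<rho> where "\<rho> s = (if r = 0 then p2 s else d2 s / r)" for s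
  have [measurable]: "\<rho> \<in> borel_measurable \<Gamma>" unfolding \<rho>_def[abs_def] by measurable
  have \<rho>1: "(\<integral>\<^sup>+s. \<rho> s \<partial>\<Gamma>) = 1"
    using rfin by (cases "r = 0") (auto simp: \<rho>_def one nn_integral_divide r2 ennreal_divide_self)
  have \<rho>r: "r * (\<integral>\<^sup>+s. \<rho> s * g s \<partial>\<Gamma>) = (\<integral>\<^sup>+s. d2 s * g s \<partial>\<Gamma>)"
    if [measurable]: "g \<in> borel_measurable \<Gamma>" for g
  proof (cases "r = 0")
    case True
    then have "(\<integral>\<^sup>+s. d2 s \<partial>\<Gamma>) = 0" using r2 by simp
    then have "AE s in \<Gamma>. d2 s = 0" by (simp add: nn_integral_0_iff_AE)
    then have "AE s in \<Gamma>. d2 s * g s = 0" by eventually_elim simp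
    then have "(\<integral>\<^sup>+s. d2 s * g s \<partial>\<Gamma>) = 0" by (subst nn_integral_0_iff_AE) auto
    then show ?thesis using True by simp
  next
    case False
    have "r * (\<integral>\<^sup>+s. \<rho> s * g s \<partial>\<Gamma>) = (\<integral>\<^sup>+s. r * (\<rho> s * g s) \<partial>\<Gamma>)" by (simp add: nn_integral_cmult)
    also have "\<dots> = (\<integral>\<^sup>+s. d2 s * g s \<partial>\<Gamma>)"
    proof (rule nn_integral_cong)
      fix s
      have "r * (d2 s / r) = d2 s * r / r" by (simp add: ennreal_times_divide mult.commute[of r])
      also have "\<dots> = d2 s" using False rfin by (intro ennreal_mult_divide_eq) auto
      finally have "r * (d2 s / r) = d2 s" .
      then show "r * (\<rho> s * g s) = d2 s * g s" using False by (simp add: \<rho>_def mult.assoc[symmetric])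
    qed
    finally show ?thesis .
  qed
  let ?N = "count_space (UNIV::bool set) \<Otimes>\<^sub>M (\<Gamma> \<Otimes>\<^sub>M \<Gamma>)"
  \<comment> \<open>In the case \<open>True\<close> the third component is a dummy, integrated out
    against the probability density \<open>\<rho>\<close>; in the case \<open>False\<close> the two
    remainders are independent and \<open>\<rho>\<close> carries the normalisation.\<close>
  define W where "W w = (if fst w then q (fst (snd w)) else d1 (fst (snd w))) * \<rho> (snd (snd w))" for w :: "bool \<times> 'b \<times> 'b"
  define T where "T w = (f1 (fst (snd w)), if fst w then f2 (fst (snd w)) else f2 (snd (snd w)))" for w :: "bool \<times> 'b \<times> 'b"
  have fst_pred [measurable]: "Measurable.pred ?N fst" by simp
  have Wm [measurable]: "W \<in> borel_measurable ?N" unfolding W_def[abs_def] by measurable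
  have Tm [measurable]: "T \<in> ?N \<rightarrow>\<^sub>M borel \<Otimes>\<^sub>M borel" unfolding T_def[abs_def] by measurable
  define \<pi> where "\<pi> = distr (density ?N W) (borel \<Otimes>\<^sub>M borel) T"
  have sets\<pi> [measurable_cong]: "sets \<pi> = sets (borel \<Otimes>\<^sub>M borel)" by (simp add: \<pi>_def)
  have key: "(\<integral>\<^sup>+w. \<phi> w \<partial>\<pi>) = (\<integral>\<^sup>+s. q s * \<phi> (f1 s, f2 s) \<partial>\<Gamma>)
      + (\<integral>\<^sup>+s. d1 s * (\<integral>\<^sup>+s'. \<rho> s' * \<phi> (f1 s, f2 s') \<partial>\<Gamma>) \<partial>\<Gamma>)"
    if [measurable]: "\<phi> \<in> borel_measurable (borel \<Otimes>\<^sub>M borel)" for \<phi> :: "'a \<times> 'a \<Rightarrow> ennreal"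
  proof -
    have "(\<integral>\<^sup>+w. \<phi> w \<partial>\<pi>) = (\<integral>\<^sup>+w. W w * \<phi> (T w) \<partial>?N)"
      unfolding \<pi>_def by (simp add: nn_integral_distr nn_integral_density)
    also have "\<dots> = (\<integral>\<^sup>+b. (\<integral>\<^sup>+y. W (b, y) * \<phi> (T (b, y)) \<partial>(\<Gamma> \<Otimes>\<^sub>M \<Gamma>)) \<partial>count_space UNIV)"
      by (rule sigma_finite_measure.nn_integral_fst[symmetric]) (simp_all add: GG.sigma_finite_measure_axioms)
    also have "\<dots> = (\<integral>\<^sup>+y. W (True, y) * \<phi> (T (True, y)) \<partial>(\<Gamma> \<Otimes>\<^sub>M \<Gamma>)) + (\<integral>\<^sup>+y. W (False, y) * \<phi> (T (False, y)) \<partial>(\<Gamma> \<Otimes>\<^sub>M \<Gamma>))"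
      by (subst nn_integral_count_space_finite) (auto simp: UNIV_bool add.commute)
    also have "(\<integral>\<^sup>+y. W (True, y) * \<phi> (T (True, y)) \<partial>(\<Gamma> \<Otimes>\<^sub>M \<Gamma>))
        = (\<integral>\<^sup>+s. (\<integral>\<^sup>+s'. q s * \<rho> s' * \<phi> (f1 s, f2 s) \<partial>\<Gamma>) \<partial>\<Gamma>)"
      by (subst nn_integral_fst[symmetric]) (simp_all add: W_def T_def)
    also have "\<dots> = (\<integral>\<^sup>+s. q s * \<phi> (f1 s, f2 s) \<partial>\<Gamma>)"
    proof (rule nn_integral_cong)
      fix s
      have "(\<integral>\<^sup>+s'. q s * \<rho> s' * \<phi> (f1 s, f2 s) \<partial>\<Gamma>) = (\<integral>\<^sup>+s'. (q s * \<phi> (f1 s, f2 s)) * \<rho> s' \<partial>\<Gamma>)"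
        by (simp add: mult_ac)
      also have "\<dots> = q s * \<phi> (f1 s, f2 s)" by (subst nn_integral_cmult) (simp_all add: \<rho>1)
      finally show "(\<integral>\<^sup>+s'. q s * \<rho> s' * \<phi> (f1 s, f2 s) \<partial>\<Gamma>) = q s * \<phi> (f1 s, f2 s)" .
    qed
    also have "(\<integral>\<^sup>+y. W (False, y) * \<phi> (T (False, y)) \<partial>(\<Gamma> \<Otimes>\<^sub>M \<Gamma>))
        = (\<integral>\<^sup>+s. (\<integral>\<^sup>+s'. d1 s * \<rho> s' * \<phi> (f1 s, f2 s') \<partial>\<Gamma>) \<partial>\<Gamma>)"
      by (subst nn_integral_fst[symmetric]) (simp_all add: W_def T_def)
    also have "\<dots> = (\<integral>\<^sup>+s. d1 s * (\<integral>\<^sup>+s'. \<rho> s' * \<phi> (f1 s, f2 s') \<partial>\<Gamma>) \<partial>\<Gamma>)"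
    proof (rule nn_integral_cong)
      fix s assume [simp]: "s \<in> space \<Gamma>"
      have [measurable]: "(\<lambda>s'. \<phi> (f1 s, f2 s')) \<in> borel_measurable \<Gamma>" by measurable
      show "(\<integral>\<^sup>+s'. d1 s * \<rho> s' * \<phi> (f1 s, f2 s') \<partial>\<Gamma>) = d1 s * (\<integral>\<^sup>+s'. \<rho> s' * \<phi> (f1 s, f2 s') \<partial>\<Gamma>)"
        by (subst nn_integral_cmult[symmetric]) (simp_all add: mult.assoc)
    qed
    finally show ?thesis .
  qed
  have marg1: "distr \<pi> borel fst = distr (density \<Gamma> p1) borel f1"
  proof (rule measure_eqI)
    fix A assume "A \<in> sets (distr \<pi> borel fst)"
    then have [measurable]: "A \<in> sets borel" by simp
    have "emeasure (distr \<pi> borel fst) A = (\<integral>\<^sup>+w. indicator A (fst w) \<partial>\<pi>)"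
      by (subst nn_integral_indicator[symmetric]) (simp_all add: nn_integral_distr del: nn_integral_indicator)
    also have "\<dots> = (\<integral>\<^sup>+s. q s * indicator A (f1 s) \<partial>\<Gamma>) + (\<integral>\<^sup>+s. d1 s * indicator A (f1 s) \<partial>\<Gamma>)"
      by (subst key) (simp_all add: nn_integral_multc \<rho>1)
    also have "\<dots> = (\<integral>\<^sup>+s. p1 s * indicator A (f1 s) \<partial>\<Gamma>)"
      by (subst nn_integral_add[symmetric]) (simp_all add: distrib_right[symmetric] qd)
    also have "\<dots> = (\<integral>\<^sup>+x. indicator A x \<partial>distr (density \<Gamma> p1) borel f1)"
      by (simp add: nn_integral_distr nn_integral_density del: nn_integral_indicator)
    finally show "emeasure (distr \<pi> borel fst) A = emeasure (distr (density \<Gamma> p1) borel f1) A" by simp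
  qed simp
  have marg2: "distr \<pi> borel snd = distr (density \<Gamma> p2) borel f2"
  proof (rule measure_eqI)
    fix A assume "A \<in> sets (distr \<pi> borel snd)"
    then have [measurable]: "A \<in> sets borel" by simp
    have "emeasure (distr \<pi> borel snd) A = (\<integral>\<^sup>+w. indicator A (snd w) \<partial>\<pi>)"
      by (subst nn_integral_indicator[symmetric]) (simp_all add: nn_integral_distr del: nn_integral_indicator)
    also have "\<dots> = (\<integral>\<^sup>+s. q s * indicator A (f2 s) \<partial>\<Gamma>) + r * (\<integral>\<^sup>+s'. \<rho> s' * indicator A (f2 s') \<partial>\<Gamma>)"
      by (subst key) (simp_all add: nn_integral_multc r_def)
    also have "\<dots> = (\<integral>\<^sup>+s. q s * indicator A (f2 s) \<partial>\<Gamma>) + (\<integral>\<^sup>+s. d2 s * indicator A (f2 s) \<partial>\<Gamma>)"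
      by (subst \<rho>r) simp_all
    also have "\<dots> = (\<integral>\<^sup>+s. p2 s * indicator A (f2 s) \<partial>\<Gamma>)"
      by (subst nn_integral_add[symmetric]) (simp_all add: distrib_right[symmetric] qd)
    also have "\<dots> = (\<integral>\<^sup>+x. indicator A x \<partial>distr (density \<Gamma> p2) borel f2)"
      by (simp add: nn_integral_distr nn_integral_density del: nn_integral_indicator)
    finally show "emeasure (distr \<pi> borel snd) A = emeasure (distr (density \<Gamma> p2) borel f2) A" by simp
  qed simp
  have "\<pi> \<in> couplings (distr (density \<Gamma> p1) borel f1) (distr (density \<Gamma> p2) borel f2)"
    by (simp add: couplings_def sets\<pi> marg1 marg2)
  moreover have "(\<integral>\<^sup>+(x, y). ennreal ((norm (x - y))\<^sup>2) \<partial>\<pi>) \<le> ennreal c"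
  proof -
    define n1 where "n1 s = ennreal ((norm (f1 s))\<^sup>2)" for s
    define n2 where "n2 s = ennreal ((norm (f2 s))\<^sup>2)" for s
    have [measurable]: "n1 \<in> borel_measurable \<Gamma>" "n2 \<in> borel_measurable \<Gamma>"
      unfolding n1_def[abs_def] n2_def[abs_def] by measurable
    have nle: "ennreal ((norm (f1 s - f2 s'))\<^sup>2) \<le> 2 * n1 s + 2 * n2 s'" for s s'
    proof -
      have "ennreal ((norm (f1 s - f2 s'))\<^sup>2) \<le> ennreal (2 * (norm (f1 s))\<^sup>2 + 2 * (norm (f2 s'))\<^sup>2)"
        by (rule ennreal_leI[OF norm_diff_power2_le])
      then show ?thesis by (simp add: n1_def n2_def ennreal_mult)
    qed
    have inner: "(\<integral>\<^sup>+s'. \<rho> s' * ennreal ((norm (f1 s - f2 s'))\<^sup>2) \<partial>\<Gamma>) \<le> 2 * n1 s + 2 * (\<integral>\<^sup>+s'. \<rho> s' * n2 s' \<partial>\<Gamma>)" for s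
    proof -
      have "(\<integral>\<^sup>+s'. \<rho> s' * ennreal ((norm (f1 s - f2 s'))\<^sup>2) \<partial>\<Gamma>) \<le> (\<integral>\<^sup>+s'. (2 * n1 s) * \<rho> s' + 2 * (\<rho> s' * n2 s') \<partial>\<Gamma>)"
        using mult_left_mono[OF nle] by (intro nn_integral_mono) (simp add: distrib_left mult_ac)
      also have "\<dots> = 2 * n1 s + 2 * (\<integral>\<^sup>+s'. \<rho> s' * n2 s' \<partial>\<Gamma>)"
        by (subst nn_integral_add) (simp_all add: nn_integral_cmult \<rho>1)
      finally show ?thesis .
    qed
    have "(\<integral>\<^sup>+s. d1 s * (\<integral>\<^sup>+s'. \<rho> s' * ennreal ((norm (f1 s - f2 s'))\<^sup>2) \<partial>\<Gamma>) \<partial>\<Gamma>)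
        \<le> (\<integral>\<^sup>+s. 2 * (d1 s * n1 s) + d1 s * (2 * (\<integral>\<^sup>+s'. \<rho> s' * n2 s' \<partial>\<Gamma>)) \<partial>\<Gamma>)"
      using mult_left_mono[OF inner] by (intro nn_integral_mono) (simp add: distrib_left mult_ac)
    also have "\<dots> = 2 * (\<integral>\<^sup>+s. d1 s * n1 s \<partial>\<Gamma>) + r * (2 * (\<integral>\<^sup>+s'. \<rho> s' * n2 s' \<partial>\<Gamma>))"
      by (subst nn_integral_add) (simp_all add: nn_integral_cmult nn_integral_multc r_def)
    also have "\<dots> = 2 * (\<integral>\<^sup>+s. d1 s * n1 s \<partial>\<Gamma>) + 2 * (\<integral>\<^sup>+s'. d2 s' * n2 s' \<partial>\<Gamma>)"
      by (simp add: mult.left_commute[of r] \<rho>r)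
    finally have part: "(\<integral>\<^sup>+s. d1 s * (\<integral>\<^sup>+s'. \<rho> s' * ennreal ((norm (f1 s - f2 s'))\<^sup>2) \<partial>\<Gamma>) \<partial>\<Gamma>)
      \<le> 2 * (\<integral>\<^sup>+s. d1 s * n1 s \<partial>\<Gamma>) + 2 * (\<integral>\<^sup>+s'. d2 s' * n2 s' \<partial>\<Gamma>)" .
    have "(\<integral>\<^sup>+(x, y). ennreal ((norm (x - y))\<^sup>2) \<partial>\<pi>) = (\<integral>\<^sup>+s. q s * ennreal ((norm (f1 s - f2 s))\<^sup>2) \<partial>\<Gamma>)
      + (\<integral>\<^sup>+s. d1 s * (\<integral>\<^sup>+s'. \<rho> s' * ennreal ((norm (f1 s - f2 s'))\<^sup>2) \<partial>\<Gamma>) \<partial>\<Gamma>)"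
      by (subst key) (simp_all add: split_beta')
    also have "\<dots> \<le> (\<integral>\<^sup>+s. q s * ennreal ((norm (f1 s - f2 s))\<^sup>2) \<partial>\<Gamma>)
      + (2 * (\<integral>\<^sup>+s. d1 s * n1 s \<partial>\<Gamma>) + 2 * (\<integral>\<^sup>+s'. d2 s' * n2 s' \<partial>\<Gamma>))"
      by (intro add_left_mono part)
    also have "\<dots> \<le> ennreal c" using bound by (simp add: q_def d1_def d2_def n1_def n2_def)
    finally show ?thesis .
  qed
  ultimately show ?thesis using c by (rule W2_power2_le)
qed

text \<open>The cost of the independent coupling, with the squared distance bounded by twice the
  squared norms.\<close>

lemma W2_power2_le_moments:
  fixes \<alpha> \<beta> :: "'a::euclidean_space measure"
  assumes [measurable_cong]: "sets \<alpha> = sets borel" "sets \<beta> = sets borel" and "prob_space \<alpha>" "prob_space \<beta>"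
    and A: "moment2 \<alpha> \<le> ennreal a" "0 \<le> a"
    and B: "moment2 \<beta> \<le> ennreal b" "0 \<le> b"
  shows "(W2 \<alpha> \<beta>)\<^sup>2 \<le> 2 * a + 2 * b"
proof (rule W2_power2_le)
  interpret A: prob_space \<alpha> by fact
  interpret B: prob_space \<beta> by fact
  interpret AB: pair_prob_space \<alpha> \<beta> ..
  have s: "sets (\<alpha> \<Otimes>\<^sub>M \<beta>) = sets (borel \<Otimes>\<^sub>M borel)" by (intro sets_pair_measure_cong assms)
  have sp: "space \<alpha> = UNIV" "space \<beta> = UNIV" using assms(1,2)[THEN sets_eq_imp_space_eq] by auto
  have "distr (\<alpha> \<Otimes>\<^sub>M \<beta>) borel fst = \<alpha>"
  proof (rule measure_eqI)
    fix A assume "A \<in> sets (distr (\<alpha> \<Otimes>\<^sub>M \<beta>) borel fst)"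
    then have [measurable]: "A \<in> sets borel" by simp
    have "fst -` A \<inter> space (\<alpha> \<Otimes>\<^sub>M \<beta>) = A \<times> space \<beta>" by (auto simp: space_pair_measure sp)
    then show "emeasure (distr (\<alpha> \<Otimes>\<^sub>M \<beta>) borel fst) A = emeasure \<alpha> A"
      by (simp add: emeasure_distr B.emeasure_pair_measure_Times B.emeasure_space_1 assms(1))
  qed (simp add: assms)
  moreover have "distr (\<alpha> \<Otimes>\<^sub>M \<beta>) borel snd = \<beta>"
  proof (rule measure_eqI)
    fix A assume "A \<in> sets (distr (\<alpha> \<Otimes>\<^sub>M \<beta>) borel snd)"
    then have [measurable]: "A \<in> sets borel" by simp
    have "snd -` A \<inter> space (\<alpha> \<Otimes>\<^sub>M \<beta>) = space \<alpha> \<times> A" by (auto simp: space_pair_measure sp)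
    then show "emeasure (distr (\<alpha> \<Otimes>\<^sub>M \<beta>) borel snd) A = emeasure \<beta> A"
      by (simp add: emeasure_distr B.emeasure_pair_measure_Times A.emeasure_space_1 assms(2))
  qed (simp add: assms)
  ultimately show "\<alpha> \<Otimes>\<^sub>M \<beta> \<in> couplings \<alpha> \<beta>" by (simp add: couplings_def s)
  have "(\<integral>\<^sup>+(x, y). ennreal ((norm (x - y))\<^sup>2) \<partial>(\<alpha> \<Otimes>\<^sub>M \<beta>))
      \<le> (\<integral>\<^sup>+w. 2 * ennreal ((norm (fst w))\<^sup>2) + 2 * ennreal ((norm (snd w))\<^sup>2) \<partial>(\<alpha> \<Otimes>\<^sub>M \<beta>))"
  proof (rule nn_integral_mono)
    fix w :: "'a \<times> 'a"
    have "ennreal ((norm (fst w - snd w))\<^sup>2) \<le> ennreal (2 * (norm (fst w))\<^sup>2 + 2 * (norm (snd w))\<^sup>2)"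
      by (rule ennreal_leI[OF norm_diff_power2_le])
    then show "(case w of (x, y) \<Rightarrow> ennreal ((norm (x - y))\<^sup>2)) \<le> 2 * ennreal ((norm (fst w))\<^sup>2) + 2 * ennreal ((norm (snd w))\<^sup>2)"
      by (simp add: split_beta' ennreal_mult)
  qed
  also have "\<dots> = (\<integral>\<^sup>+x. (\<integral>\<^sup>+y. 2 * ennreal ((norm x)\<^sup>2) + 2 * ennreal ((norm y)\<^sup>2) \<partial>\<beta>) \<partial>\<alpha>)"
    by (subst B.nn_integral_fst[symmetric]) simp_all
  also have "\<dots> = 2 * moment2 \<alpha> + 2 * moment2 \<beta>"
    by (simp add: nn_integral_add nn_integral_cmult A.emeasure_space_1 B.emeasure_space_1)
  also have "\<dots> \<le> 2 * ennreal a + 2 * ennreal b"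
    by (intro add_mono mult_left_mono A B) auto
  also have "\<dots> = ennreal (2 * a + 2 * b)" using A(2) B(2) by (simp add: ennreal_mult)
  finally show "(\<integral>\<^sup>+(x, y). ennreal ((norm (x - y))\<^sup>2) \<partial>(\<alpha> \<Otimes>\<^sub>M \<beta>)) \<le> ennreal (2 * a + 2 * b)" .
qed (use A B in simp)


subsection \<open>Graphon mixtures\<close>

lemma families_measurable_kernel:
  assumes \<mu>: "\<mu> \<in> families"
  shows "\<mu> \<in> unit_leb \<rightarrow>\<^sub>M prob_algebra borel"
proof (rule measurable_prob_algebraI)
  have p: "\<mu> v \<in> prob2" if "v \<in> {0..1}" for v using \<mu> that by (auto simp: families_def)
  show "prob_space (\<mu> v)" if "v \<in> space unit_leb" for v
    using p that by (auto simp: space_restrict_space prob2_def)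
  show "\<mu> \<in> unit_leb \<rightarrow>\<^sub>M subprob_algebra borel"
  proof (rule measurable_subprob_algebra)
    fix v assume "v \<in> space unit_leb"
    then have v: "v \<in> {0..1}" by (simp add: space_restrict_space)
    show "subprob_space (\<mu> v)" "sets (\<mu> v) = sets borel"
      using p[OF v] by (auto simp: prob2_def measures2_def intro: prob_space_imp_subprob_space)
  next
    fix A :: "'a set" assume "A \<in> sets borel"
    then show "(\<lambda>v. emeasure (\<mu> v) A) \<in> borel_measurable unit_leb"
      using \<mu> by (simp add: families_def measurable_cong_sets[OF sets_unit_leb refl])
  qed
qed

lemma familiesI:
  assumes k: "\<mu> \<in> unit_leb \<rightarrow>\<^sub>M prob_algebra borel"
    and B: "\<And>v. v \<in> {0..1} \<Longrightarrow> moment2 (\<mu> v) \<le> ennreal B"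
  shows "\<mu> \<in> families"
  unfolding families_def
proof (intro CollectI conjI ballI)
  fix v :: real assume v: "v \<in> {0..1}"
  then have "\<mu> v \<in> space (prob_algebra borel)"
    using measurable_space[OF k] by (simp add: space_restrict_space)
  then have 1: "prob_space (\<mu> v)" "sets (\<mu> v) = sets borel" by (auto simp: space_prob_algebra)
  then show "\<mu> v \<in> prob2"
    using le_less_trans[OF B[OF v], of \<infinity>]
    by (auto simp: prob2_def measures2_def less_top[symmetric] intro: prob_space.finite_measure)
next
  fix A :: "'a set" assume "A \<in> sets borel"
  then have "(\<lambda>v. emeasure (\<mu> v) A) \<in> borel_measurable unit_leb"
    using measurable_compose[OF measurable_prob_algebraD[OF k] measurable_emeasure_subprob_algebra] by simp
  then show "(\<lambda>v. emeasure (\<mu> v) A) \<in> borel_measurable unit_borel"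
    by (simp add: measurable_cong_sets[OF sets_unit_leb refl])
next
  have "(SUP v\<in>{0..1}. \<integral>\<^sup>+x. ennreal ((norm x)\<^sup>2) \<partial>\<mu> v) \<le> ennreal B" by (rule SUP_least) (rule B)
  also have "\<dots> < \<infinity>" by simp
  finally show "(SUP v\<in>{0..1}. \<integral>\<^sup>+x. ennreal ((norm x)\<^sup>2) \<partial>\<mu> v) < \<infinity>" .
qed

lemma families_bound:
  assumes "\<mu> \<in> families"
  obtains B where "0 \<le> B" "\<And>v. v \<in> {0..1} \<Longrightarrow> moment2 (\<mu> v) \<le> ennreal B"
proof -
  let ?S = "SUP v\<in>{0..1}. \<integral>\<^sup>+x. ennreal ((norm x)\<^sup>2) \<partial>\<mu> v"
  have "?S < \<infinity>" using assms by (simp add: families_def)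
  then have "?S = ennreal (enn2real ?S)" by simp
  moreover have "moment2 (\<mu> v) \<le> ?S" if "v \<in> {0..1}" for v using that by (rule SUP_upper)
  ultimately show thesis using that[of "enn2real ?S"] by (metis enn2real_nonneg)
qed

lemma families_return: "(\<lambda>_. return borel x) \<in> families"
proof (rule familiesI[where B="(norm x)\<^sup>2"])
  show "(\<lambda>_. return borel x) \<in> unit_leb \<rightarrow>\<^sub>M prob_algebra borel"
    by (rule measurable_const) (simp add: space_prob_algebra prob_space_return)
qed (simp add: nn_integral_return)

text \<open>The law of a pair of a uniform label \<open>v\<close> and a point drawn from
  \<open>\<mu> v\<close>. Every mixture is the image of a reweighting of this one measure, so
  mixtures at different labels can be coupled through their weights.\<close>

definition label_measure :: "(real \<Rightarrow> 'a::euclidean_space measure) \<Rightarrow> (real \<times> 'a) measure" where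
  "label_measure \<mu> = unit_leb \<bind> (\<lambda>v. distr (\<mu> v) (unit_leb \<Otimes>\<^sub>M borel) (Pair v))"

definition deg :: "(real \<Rightarrow> real \<Rightarrow> real) \<Rightarrow> real \<Rightarrow> real" where
  "deg G u = (\<integral>v. G u v \<partial>unit_leb)"

locale graphon_family =
  fixes G :: "real \<Rightarrow> real \<Rightarrow> real" and \<mu> :: "real \<Rightarrow> 'a::euclidean_space measure"
  assumes G: "graphon G" and \<mu>: "\<mu> \<in> families"
begin

sublocale U: prob_space unit_leb by (rule prob_space_unit_leb)

lemma G_bounds: "u \<in> {0..1} \<Longrightarrow> v \<in> {0..1} \<Longrightarrow> 0 \<le> G u v \<and> G u v \<le> 1"
  using G by (auto simp: graphon_def)

lemma G_section [measurable]: "u \<in> {0..1} \<Longrightarrow> G u \<in> borel_measurable unit_leb"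
  using borel_measurable_graphon_section[OF G] by (simp add: measurable_cong_sets[OF sets_unit_leb refl])

lemma G_integrable: "u \<in> {0..1} \<Longrightarrow> integrable unit_leb (G u)"
  using G_bounds by (intro U.integrable_const_bound[where B=1] AE_I2) (auto simp: space_restrict_space)

lemma nn_integral_G: "u \<in> {0..1} \<Longrightarrow> (\<integral>\<^sup>+v. ennreal (G u v) \<partial>unit_leb) = ennreal (deg G u)"
  unfolding deg_def using G_bounds
  by (intro nn_integral_eq_integral G_integrable AE_I2) (auto simp: space_restrict_space)

lemma deg_nonneg: "u \<in> {0..1} \<Longrightarrow> 0 \<le> deg G u"
  unfolding deg_def using G_bounds by (intro Bochner_Integration.integral_nonneg_AE AE_I2) (auto simp: space_restrict_space)

lemma deg_le_1: "u \<in> {0..1} \<Longrightarrow> deg G u \<le> 1"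
proof -
  assume u: "u \<in> {0..1}"
  have "deg G u \<le> (\<integral>v. 1 \<partial>unit_leb)"
    unfolding deg_def using G_bounds u by (intro integral_mono_AE G_integrable AE_I2) (auto simp: space_restrict_space)
  then show ?thesis using U.prob_space by (simp add: space_restrict_space)
qed

lemma kernel [measurable]: "\<mu> \<in> unit_leb \<rightarrow>\<^sub>M prob_algebra borel"
  using \<mu> by (rule families_measurable_kernel)

lemma sub_kernel [measurable]: "\<mu> \<in> unit_leb \<rightarrow>\<^sub>M subprob_algebra borel"
  by (rule measurable_prob_algebraD) (rule kernel)

lemma \<mu>_prob: "v \<in> {0..1} \<Longrightarrow> prob_space (\<mu> v)" and sets_\<mu>: "v \<in> {0..1} \<Longrightarrow> sets (\<mu> v) = sets borel"
  using \<mu> by (auto simp: families_def prob2_def measures2_def)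

lemma lift_kernel: "(\<lambda>v. distr (\<mu> v) (unit_leb \<Otimes>\<^sub>M borel) (Pair v)) \<in> unit_leb \<rightarrow>\<^sub>M prob_algebra (unit_leb \<Otimes>\<^sub>M borel)"
  by (rule measurable_distr_prob_space2[OF kernel]) simp

lemma sets_label_measure [measurable_cong]: "sets (label_measure \<mu>) = sets (unit_leb \<Otimes>\<^sub>M borel)"
  unfolding label_measure_def
  by (rule sets_bind_measurable[OF measurable_prob_algebraD[OF lift_kernel] U.not_empty])

lemma space_label_measure: "space (label_measure \<mu>) = {0..1} \<times> UNIV"
  using sets_eq_imp_space_eq[OF sets_label_measure] by (simp add: space_pair_measure space_restrict_space)

lemma nn_integral_label_measure:
  assumes f[measurable]: "f \<in> borel_measurable (unit_leb \<Otimes>\<^sub>M borel)"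
  shows "(\<integral>\<^sup>+p. f p \<partial>label_measure \<mu>) = (\<integral>\<^sup>+v. (\<integral>\<^sup>+x. f (v, x) \<partial>\<mu> v) \<partial>unit_leb)"
proof -
  have "(\<integral>\<^sup>+p. f p \<partial>label_measure \<mu>) = (\<integral>\<^sup>+v. (\<integral>\<^sup>+p. f p \<partial>distr (\<mu> v) (unit_leb \<Otimes>\<^sub>M borel) (Pair v)) \<partial>unit_leb)"
    unfolding label_measure_def by (rule nn_integral_bind[OF f measurable_prob_algebraD[OF lift_kernel]])
  also have "\<dots> = (\<integral>\<^sup>+v. (\<integral>\<^sup>+x. f (v, x) \<partial>\<mu> v) \<partial>unit_leb)"
  proof (rule nn_integral_cong)
    fix v assume v: "v \<in> space unit_leb"
    then have s: "sets (\<mu> v) = sets borel" by (intro sets_\<mu>) (simp add: space_restrict_space)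
    have "Pair v \<in> \<mu> v \<rightarrow>\<^sub>M unit_leb \<Otimes>\<^sub>M borel"
      unfolding measurable_cong_sets[OF s refl] by (rule measurable_Pair1'[OF v])
    then show "(\<integral>\<^sup>+p. f p \<partial>distr (\<mu> v) (unit_leb \<Otimes>\<^sub>M borel) (Pair v)) = (\<integral>\<^sup>+x. f (v, x) \<partial>\<mu> v)"
      by (rule nn_integral_distr) simp
  qed
  finally show ?thesis .
qed

lemma prob_space_label_measure: "prob_space (label_measure \<mu>)"
proof (rule prob_spaceI)
  have "emeasure (label_measure \<mu>) (space (label_measure \<mu>)) = (\<integral>\<^sup>+p. 1 \<partial>label_measure \<mu>)" by simp
  also have "\<dots> = (\<integral>\<^sup>+v. (\<integral>\<^sup>+x. 1 \<partial>\<mu> v) \<partial>unit_leb)" by (rule nn_integral_label_measure) simp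
  also have "\<dots> = (\<integral>\<^sup>+v. 1 \<partial>unit_leb)"
    by (rule nn_integral_cong) (simp add: prob_space.emeasure_space_1[OF \<mu>_prob] space_restrict_space)
  also have "\<dots> = 1" using U.emeasure_space_1 by (simp add: space_restrict_space)
  finally show "emeasure (label_measure \<mu>) (space (label_measure \<mu>)) = 1" .
qed

lemma weight_measurable [measurable]:
  "u \<in> {0..1} \<Longrightarrow> (\<lambda>p. ennreal (G u (fst p))) \<in> borel_measurable (unit_leb \<Otimes>\<^sub>M borel)"
  by (intro measurable_compose[OF measurable_fst] measurable_compose[OF G_section]) simp_all

text \<open>The label \<open>u\<close> enters through the density only; the base measure and the map
  are common to all labels, as \<open>W2_density_le\<close> requires.\<close>

lemma graphon_mix_eq:
  assumes u: "u \<in> {0..1}"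
  shows "graphon_mix G \<mu> u = distr (density (label_measure \<mu>) (\<lambda>p. ennreal (G u (fst p)))) borel snd"
proof (rule measure_eqI)
  have s: "sets (graphon_mix G \<mu> u) = sets borel"
    by (simp add: graphon_mix_def sets.sigma_sets_eq[of borel, simplified])
  then show "sets (graphon_mix G \<mu> u) = sets (distr (density (label_measure \<mu>) (\<lambda>p. ennreal (G u (fst p)))) borel snd)"
    by simp
  fix A assume "A \<in> sets (graphon_mix G \<mu> u)"
  then have A [measurable]: "A \<in> sets borel" using s by simp
  note w = weight_measurable[OF u, measurable]
  have "emeasure (distr (density (label_measure \<mu>) (\<lambda>p. ennreal (G u (fst p)))) borel snd) A
      = (\<integral>\<^sup>+x. indicator A x \<partial>distr (density (label_measure \<mu>) (\<lambda>p. ennreal (G u (fst p)))) borel snd)" by simp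
  also have "\<dots> = (\<integral>\<^sup>+p. ennreal (G u (fst p)) * indicator A (snd p) \<partial>label_measure \<mu>)"
    by (simp add: nn_integral_distr nn_integral_density del: nn_integral_indicator)
  also have "\<dots> = (\<integral>\<^sup>+v. (\<integral>\<^sup>+x. ennreal (G u v) * indicator A x \<partial>\<mu> v) \<partial>unit_leb)"
    by (subst nn_integral_label_measure) simp_all
  also have "\<dots> = (\<integral>\<^sup>+v. ennreal (G u v) * emeasure (\<mu> v) A \<partial>unit_leb)"
    by (intro nn_integral_cong nn_integral_cmult_indicator) (simp add: sets_\<mu> space_restrict_space)
  also have "\<dots> = emeasure (graphon_mix G \<mu> u) A"
    by (simp add: emeasure_graphon_mix[OF G u \<mu> A] nn_integral_restrict_space)
  finally show "emeasure (graphon_mix G \<mu> u) A = emeasure (distr (density (label_measure \<mu>) (\<lambda>p. ennreal (G u (fst p)))) borel snd) A" ..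
qed

lemma nn_integral_graphon_mix:
  assumes u: "u \<in> {0..1}" and f[measurable]: "f \<in> borel_measurable borel"
  shows "(\<integral>\<^sup>+x. f x \<partial>graphon_mix G \<mu> u) = (\<integral>\<^sup>+v. ennreal (G u v) * (\<integral>\<^sup>+x. f x \<partial>\<mu> v) \<partial>unit_leb)"
proof -
  note w = weight_measurable[OF u, measurable]
  have "(\<integral>\<^sup>+x. f x \<partial>graphon_mix G \<mu> u) = (\<integral>\<^sup>+v. (\<integral>\<^sup>+x. ennreal (G u v) * f x \<partial>\<mu> v) \<partial>unit_leb)"
    unfolding graphon_mix_eq[OF u]
    by (simp add: nn_integral_distr nn_integral_density nn_integral_label_measure)
  also have "\<dots> = (\<integral>\<^sup>+v. ennreal (G u v) * (\<integral>\<^sup>+x. f x \<partial>\<mu> v) \<partial>unit_leb)"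
    by (intro nn_integral_cong nn_integral_cmult) (simp add: sets_\<mu> space_restrict_space measurable_cong_sets[OF sets_\<mu> refl])
  finally show ?thesis .
qed

lemma sets_graphon_mix: "sets (graphon_mix G \<mu> u) = sets borel"
  by (simp add: graphon_mix_def sets.sigma_sets_eq[of borel, simplified])

lemma emeasure_graphon_mix_UNIV:
  assumes u: "u \<in> {0..1}" shows "emeasure (graphon_mix G \<mu> u) (space (graphon_mix G \<mu> u)) = ennreal (deg G u)"
proof -
  have "emeasure (graphon_mix G \<mu> u) (space (graphon_mix G \<mu> u)) = (\<integral>\<^sup>+x. 1 \<partial>graphon_mix G \<mu> u)" by simp
  also have "\<dots> = (\<integral>\<^sup>+v. ennreal (G u v) \<partial>unit_leb)"
    by (subst nn_integral_graphon_mix[OF u])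
       (auto intro!: nn_integral_cong simp: prob_space.emeasure_space_1[OF \<mu>_prob] space_restrict_space)
  finally show ?thesis by (simp add: nn_integral_G[OF u])
qed

lemma mass_graphon_mix: "u \<in> {0..1} \<Longrightarrow> mass (graphon_mix G \<mu> u) = deg G u"
  by (simp add: mass_def measure_def emeasure_graphon_mix_UNIV deg_nonneg)

lemma graphon_mix_measures2:
  assumes u: "u \<in> {0..1}" shows "graphon_mix G \<mu> u \<in> measures2"
proof -
  obtain B where B: "0 \<le> B" "\<And>v. v \<in> {0..1} \<Longrightarrow> moment2 (\<mu> v) \<le> ennreal B"
    using families_bound[OF \<mu>] by blast
  have "moment2 (graphon_mix G \<mu> u) \<le> (\<integral>\<^sup>+v. ennreal (G u v) * ennreal B \<partial>unit_leb)"
    by (subst nn_integral_graphon_mix[OF u])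
       (auto intro!: nn_integral_mono mult_left_mono B simp: space_restrict_space)
  also have "\<dots> = ennreal (deg G u) * ennreal B"
    using G_section[OF u] by (subst nn_integral_multc) (auto simp: nn_integral_G[OF u])
  also have "\<dots> < \<infinity>" by (simp add: ennreal_mult_less_top)
  finally have "moment2 (graphon_mix G \<mu> u) < \<infinity>" .
  then show ?thesis
    unfolding measures2_def by (auto simp: sets_graphon_mix emeasure_graphon_mix_UNIV[OF u] intro!: finite_measureI)
qed

section \<open>The normalised and dilated mixtures whose distance enters \<open>WOP2\<close>\<close>

definition dilated :: "'a \<Rightarrow> real \<Rightarrow> 'a measure" where
  "dilated x\<^sub>0 u = distr (normalized x\<^sub>0 (graphon_mix G \<mu> u)) borel (dilation x\<^sub>0 (deg G u))"

lemma dilation_measurable [measurable]: "dilation x\<^sub>0 c \<in> borel_measurable borel"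
  unfolding dilation_def[abs_def] by measurable

lemma dilated_zero: "u \<in> {0..1} \<Longrightarrow> deg G u = 0 \<Longrightarrow> dilated x\<^sub>0 u = return borel x\<^sub>0"
  by (simp add: dilated_def normalized_def mass_graphon_mix distr_return dilation_def)

abbreviation "wt u p \<equiv> ennreal (G u (fst p) / deg G u)"
abbreviation "pos x\<^sub>0 u p \<equiv> dilation x\<^sub>0 (deg G u) (snd p)"

lemma wt_measurable [measurable]: "u \<in> {0..1} \<Longrightarrow> wt u \<in> borel_measurable (label_measure \<mu>)"
  using measurable_compose[OF measurable_fst G_section[of u], of borel]
  by (simp add: measurable_cong_sets[OF sets_label_measure refl])

lemma pos_measurable [measurable]: "pos x\<^sub>0 u \<in> borel_measurable (label_measure \<mu>)"
  by (intro measurable_compose[OF _ dilation_measurable]) (simp add: measurable_cong_sets[OF sets_label_measure refl])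

lemma nn_integral_normalized_row:
  assumes u: "u \<in> {0..1}" and d: "0 < deg G u"
  shows "(\<integral>\<^sup>+v. ennreal (G u v / deg G u) \<partial>unit_leb) = 1"
proof -
  have "(\<integral>\<^sup>+v. ennreal (G u v / deg G u) \<partial>unit_leb) = (\<integral>\<^sup>+v. ennreal (G u v) / ennreal (deg G u) \<partial>unit_leb)"
    using d G_bounds[OF u] by (intro nn_integral_cong) (auto simp: divide_ennreal space_restrict_space)
  also have "\<dots> = 1"
    using d G_section[OF u] by (subst nn_integral_divide) (auto simp: nn_integral_G[OF u] ennreal_divide_self)
  finally show ?thesis .
qed

lemma wt_total:
  assumes u: "u \<in> {0..1}" and d: "0 < deg G u"
  shows "(\<integral>\<^sup>+p. wt u p \<partial>label_measure \<mu>) = 1"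
proof -
  have "(\<integral>\<^sup>+p. wt u p \<partial>label_measure \<mu>) = (\<integral>\<^sup>+v. ennreal (G u v / deg G u) \<partial>unit_leb)"
    using wt_measurable[OF u]
    by (subst nn_integral_label_measure)
       (auto intro!: nn_integral_cong simp: measurable_cong_sets[OF sets_label_measure refl]
         prob_space.emeasure_space_1[OF \<mu>_prob] space_restrict_space)
  then show ?thesis by (simp only: nn_integral_normalized_row[OF u d])
qed

text \<open>Normalisation goes into the density and dilation into the map, which is the form that
  \<open>W2_density_le\<close> accepts.\<close>

lemma dilated_eq:
  assumes u: "u \<in> {0..1}" and d: "0 < deg G u"
  shows "dilated x\<^sub>0 u = distr (density (label_measure \<mu>) (wt u)) borel (pos x\<^sub>0 u)"
proof (rule measure_eqI)
  fix A assume "A \<in> sets (dilated x\<^sub>0 u)"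
  then have A [measurable]: "A \<in> sets borel" by (simp add: dilated_def)
  note w = weight_measurable[OF u, measurable] wt_measurable[OF u, measurable]
  let ?f = "dilation x\<^sub>0 (deg G u)"
  have fA: "?f -` A \<in> sets borel" by (rule measurable_sets_borel[OF dilation_measurable A])
  have sp: "space (graphon_mix G \<mu> u) = UNIV" using sets_eq_imp_space_eq[OF sets_graphon_mix] by simp
  have "emeasure (dilated x\<^sub>0 u) A = emeasure (scale_measure (ennreal (1 / deg G u)) (graphon_mix G \<mu> u)) (?f -` A)"
    unfolding dilated_def normalized_def mass_graphon_mix[OF u]
    using d sp by (subst emeasure_distr)
      (auto simp: measurable_cong_sets[OF trans[OF sets_scale_measure sets_graphon_mix] refl] space_scale_measure)
  also have "\<dots> = ennreal (1 / deg G u) * (\<integral>\<^sup>+x. indicator (?f -` A) x \<partial>graphon_mix G \<mu> u)"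
    using fA by (simp add: sets_graphon_mix)
  also have "\<dots> = ennreal (1 / deg G u) * (\<integral>\<^sup>+p. ennreal (G u (fst p)) * indicator A (pos x\<^sub>0 u p) \<partial>label_measure \<mu>)"
    unfolding graphon_mix_eq[OF u] using fA
    by (subst nn_integral_distr) (auto simp: nn_integral_density indicator_def intro!: arg_cong2[where f="(*)"] nn_integral_cong)
  also have "\<dots> = (\<integral>\<^sup>+p. wt u p * indicator A (pos x\<^sub>0 u p) \<partial>label_measure \<mu>)"
    using d G_bounds[OF u]
    by (subst nn_integral_cmult[symmetric])
       (auto intro!: nn_integral_cong simp: space_label_measure mult.assoc[symmetric] ennreal_mult[symmetric])
  also have "\<dots> = (\<integral>\<^sup>+x. indicator A x \<partial>distr (density (label_measure \<mu>) (wt u)) borel (pos x\<^sub>0 u))"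
    by (simp add: nn_integral_distr nn_integral_density del: nn_integral_indicator)
  finally show "emeasure (dilated x\<^sub>0 u) A = emeasure (distr (density (label_measure \<mu>) (wt u)) borel (pos x\<^sub>0 u)) A"
    by simp
qed (simp add: dilated_def)

lemma WOP2_graphon_mix:
  "u \<in> {0..1} \<Longrightarrow> u' \<in> {0..1} \<Longrightarrow> (WOP2 x\<^sub>0 (graphon_mix G \<mu> u) (graphon_mix G \<mu> u'))\<^sup>2
    = (deg G u - deg G u')\<^sup>2 + (W2 (dilated x\<^sub>0 u) (dilated x\<^sub>0 u'))\<^sup>2"
  by (simp add: WOP2_def dilated_def mass_graphon_mix)

lemma prob_space_dilated: "u \<in> {0..1} \<Longrightarrow> prob_space (dilated x\<^sub>0 u)"
proof (cases "deg G u = 0")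
  case False
  assume u: "u \<in> {0..1}"
  then have d: "0 < deg G u" using deg_nonneg[OF u] False by simp
  note w = wt_measurable[OF u, measurable]
  show ?thesis unfolding dilated_eq[OF u d]
    by (intro prob_space.prob_space_distr prob_spaceI) (auto simp: emeasure_density wt_total[OF u d] cong: nn_integral_cong)
qed (simp add: dilated_zero prob_space_return)

lemma centred_moment_bound:
  obtains C where "0 \<le> C" "\<And>v. v \<in> {0..1} \<Longrightarrow> (\<integral>\<^sup>+x. ennreal ((norm (x - x\<^sub>0))\<^sup>2) \<partial>\<mu> v) \<le> ennreal C"
proof -
  obtain B where B: "0 \<le> B" "\<And>v. v \<in> {0..1} \<Longrightarrow> moment2 (\<mu> v) \<le> ennreal B"
    using families_bound[OF \<mu>] by blast
  have "(\<integral>\<^sup>+x. ennreal ((norm (x - x\<^sub>0))\<^sup>2) \<partial>\<mu> v) \<le> ennreal (2 * B + 2 * (norm x\<^sub>0)\<^sup>2)" if v: "v \<in> {0..1}" for v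
  proof -
    have m: "(\<lambda>x. ennreal ((norm x)\<^sup>2)) \<in> borel_measurable (\<mu> v)"
      by (simp add: measurable_cong_sets[OF sets_\<mu>[OF v] refl])
    have "(\<integral>\<^sup>+x. ennreal ((norm (x - x\<^sub>0))\<^sup>2) \<partial>\<mu> v) \<le> (\<integral>\<^sup>+x. 2 * ennreal ((norm x)\<^sup>2) + ennreal (2 * (norm x\<^sub>0)\<^sup>2) \<partial>\<mu> v)"
    proof (rule nn_integral_mono)
      fix x
      have "ennreal ((norm (x - x\<^sub>0))\<^sup>2) \<le> ennreal (2 * (norm x)\<^sup>2 + 2 * (norm x\<^sub>0)\<^sup>2)"
        by (rule ennreal_leI[OF norm_diff_power2_le])
      then show "ennreal ((norm (x - x\<^sub>0))\<^sup>2) \<le> 2 * ennreal ((norm x)\<^sup>2) + ennreal (2 * (norm x\<^sub>0)\<^sup>2)"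
        by (simp add: ennreal_mult)
    qed
    also have "\<dots> = 2 * moment2 (\<mu> v) + ennreal (2 * (norm x\<^sub>0)\<^sup>2)"
      using m by (simp add: nn_integral_add nn_integral_cmult prob_space.emeasure_space_1[OF \<mu>_prob[OF v]])
    also have "\<dots> \<le> 2 * ennreal B + ennreal (2 * (norm x\<^sub>0)\<^sup>2)"
      using B(2)[OF v] by (intro add_right_mono mult_left_mono) auto
    also have "\<dots> = ennreal (2 * B + 2 * (norm x\<^sub>0)\<^sup>2)" using B(1) by (simp add: ennreal_mult)
    finally show ?thesis .
  qed
  then show thesis using that[of "2 * B + 2 * (norm x\<^sub>0)\<^sup>2"] B(1) by auto
qed

lemma nn_integral_weight_le:
  assumes w[measurable]: "w \<in> borel_measurable unit_leb" and [measurable]: "\<phi> \<in> borel_measurable borel"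
    and c: "\<And>v. v \<in> {0..1} \<Longrightarrow> (\<integral>\<^sup>+x. \<phi> x \<partial>\<mu> v) \<le> c"
  shows "(\<integral>\<^sup>+p. w (fst p) * \<phi> (snd p) \<partial>label_measure \<mu>) \<le> (\<integral>\<^sup>+v. w v \<partial>unit_leb) * c"
proof -
  have "(\<integral>\<^sup>+p. w (fst p) * \<phi> (snd p) \<partial>label_measure \<mu>) = (\<integral>\<^sup>+v. (\<integral>\<^sup>+x. w v * \<phi> x \<partial>\<mu> v) \<partial>unit_leb)"
    by (subst nn_integral_label_measure) simp_all
  also have "\<dots> = (\<integral>\<^sup>+v. w v * (\<integral>\<^sup>+x. \<phi> x \<partial>\<mu> v) \<partial>unit_leb)"
    by (intro nn_integral_cong nn_integral_cmult) (simp add: space_restrict_space measurable_cong_sets[OF sets_\<mu> refl])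
  also have "\<dots> \<le> (\<integral>\<^sup>+v. w v * c \<partial>unit_leb)"
    by (intro nn_integral_mono mult_left_mono c) (auto simp: space_restrict_space)
  also have "\<dots> = (\<integral>\<^sup>+v. w v \<partial>unit_leb) * c" by (rule nn_integral_multc) simp
  finally show ?thesis .
qed

text \<open>The degree is at most 1, so the dilation does not increase the distance to
  \<open>x\<^sub>0\<close>, and the bound is uniform in \<open>u\<close>.\<close>

lemma pos_moment:
  assumes C: "0 \<le> C" "\<And>v. v \<in> {0..1} \<Longrightarrow> (\<integral>\<^sup>+x. ennreal ((norm (x - x\<^sub>0))\<^sup>2) \<partial>\<mu> v) \<le> ennreal C"
    and u: "u \<in> {0..1}" and v: "v \<in> {0..1}"
  shows "(\<integral>\<^sup>+x. ennreal ((norm (dilation x\<^sub>0 (deg G u) x))\<^sup>2) \<partial>\<mu> v) \<le> ennreal (2 * C + 2 * (norm x\<^sub>0)\<^sup>2)"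
proof -
  have m: "(\<lambda>x. ennreal ((norm (x - x\<^sub>0))\<^sup>2)) \<in> borel_measurable (\<mu> v)"
    by (simp add: measurable_cong_sets[OF sets_\<mu>[OF v] refl])
  have "(\<integral>\<^sup>+x. ennreal ((norm (dilation x\<^sub>0 (deg G u) x))\<^sup>2) \<partial>\<mu> v)
      \<le> (\<integral>\<^sup>+x. 2 * ennreal ((norm (x - x\<^sub>0))\<^sup>2) + ennreal (2 * (norm x\<^sub>0)\<^sup>2) \<partial>\<mu> v)"
  proof (rule nn_integral_mono)
    fix x
    have "(norm (dilation x\<^sub>0 (deg G u) x))\<^sup>2 \<le> 2 * (norm (deg G u *\<^sub>R (x - x\<^sub>0)))\<^sup>2 + 2 * (norm x\<^sub>0)\<^sup>2"
      unfolding dilation_def by (rule norm_add_power2_le)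
    moreover have "(norm (deg G u *\<^sub>R (x - x\<^sub>0)))\<^sup>2 \<le> (norm (x - x\<^sub>0))\<^sup>2"
      using deg_nonneg[OF u] deg_le_1[OF u] by (intro power_mono) (simp_all add: mult_left_le_one_le)
    ultimately have "(norm (dilation x\<^sub>0 (deg G u) x))\<^sup>2 \<le> 2 * (norm (x - x\<^sub>0))\<^sup>2 + 2 * (norm x\<^sub>0)\<^sup>2"
      by linarith
    from ennreal_leI[OF this]
    show "ennreal ((norm (dilation x\<^sub>0 (deg G u) x))\<^sup>2) \<le> 2 * ennreal ((norm (x - x\<^sub>0))\<^sup>2) + ennreal (2 * (norm x\<^sub>0)\<^sup>2)"
      by (simp add: ennreal_mult)
  qed
  also have "\<dots> = 2 * (\<integral>\<^sup>+x. ennreal ((norm (x - x\<^sub>0))\<^sup>2) \<partial>\<mu> v) + ennreal (2 * (norm x\<^sub>0)\<^sup>2)"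
    using m by (simp add: nn_integral_add nn_integral_cmult prob_space.emeasure_space_1[OF \<mu>_prob[OF v]])
  also have "\<dots> \<le> 2 * ennreal C + ennreal (2 * (norm x\<^sub>0)\<^sup>2)"
    using C(2)[OF v] by (intro add_right_mono mult_left_mono) auto
  also have "\<dots> = ennreal (2 * C + 2 * (norm x\<^sub>0)\<^sup>2)" using C(1) by (simp add: ennreal_mult)
  finally show ?thesis .
qed

lemma dilated_moment:
  assumes C: "0 \<le> C" "\<And>v. v \<in> {0..1} \<Longrightarrow> (\<integral>\<^sup>+x. ennreal ((norm (x - x\<^sub>0))\<^sup>2) \<partial>\<mu> v) \<le> ennreal C"
    and u: "u \<in> {0..1}"
  shows "moment2 (dilated x\<^sub>0 u) \<le> ennreal (2 * C + 2 * (norm x\<^sub>0)\<^sup>2)"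
proof (cases "deg G u = 0")
  case True
  have "(norm x\<^sub>0)\<^sup>2 \<le> 2 * C + 2 * (norm x\<^sub>0)\<^sup>2" using C(1) by simp
  from ennreal_leI[OF this] show ?thesis
    by (simp add: dilated_zero[OF u True] nn_integral_return del: ennreal_plus)
next
  case False
  then have d: "0 < deg G u" using deg_nonneg[OF u] by simp
  have m: "(\<lambda>v. ennreal (G u v / deg G u)) \<in> borel_measurable unit_leb" using G_section[OF u] by simp
  note [measurable] = wt_measurable[OF u]
  have "moment2 (dilated x\<^sub>0 u) = (\<integral>\<^sup>+p. wt u p * ennreal ((norm (pos x\<^sub>0 u p))\<^sup>2) \<partial>label_measure \<mu>)"
    unfolding dilated_eq[OF u d] by (simp add: nn_integral_distr nn_integral_density)
  also have "\<dots> \<le> (\<integral>\<^sup>+v. ennreal (G u v / deg G u) \<partial>unit_leb) * ennreal (2 * C + 2 * (norm x\<^sub>0)\<^sup>2)"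
    using pos_moment[OF C u] m
    by (intro nn_integral_weight_le[where \<phi>="\<lambda>x. ennreal ((norm (dilation x\<^sub>0 (deg G u) x))\<^sup>2)"]) auto
  also have "(\<integral>\<^sup>+v. ennreal (G u v / deg G u) \<partial>unit_leb) = 1"
    by (rule nn_integral_normalized_row[OF u d])
  finally show ?thesis by simp
qed

section \<open>Continuity of the mixture in its label\<close>

definition row_dist :: "real \<Rightarrow> real \<Rightarrow> real" where
  "row_dist u u' = (\<integral>v. \<bar>G u v - G u' v\<bar> \<partial>unit_leb)"

lemma deg_diff_le: "u \<in> {0..1} \<Longrightarrow> u' \<in> {0..1} \<Longrightarrow> \<bar>deg G u - deg G u'\<bar> \<le> row_dist u u'"
  unfolding deg_def row_dist_def using integral_abs_bound[of unit_leb "\<lambda>v. G u v - G u' v"]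
  by (simp add: G_integrable)

text \<open>The factor 2 collects the difference of the rows and the difference of the normalising
  masses, each at most the row distance. Dividing by the degree makes the bound useful only at a
  fixed \<open>u\<close> of positive degree.\<close>

lemma normalized_row_dist:
  assumes u: "u \<in> {0..1}" and u': "u' \<in> {0..1}" and d: "0 < deg G u" "0 < deg G u'"
  shows "(\<integral>\<^sup>+v. ennreal \<bar>G u v / deg G u - G u' v / deg G u'\<bar> \<partial>unit_leb) \<le> ennreal (2 * row_dist u u' / deg G u)"
proof -
  let ?m = "deg G u" and ?m' = "deg G u'"
  have "(\<integral>v. \<bar>G u v / ?m - G u' v / ?m'\<bar> \<partial>unit_leb)
      \<le> (\<integral>v. \<bar>G u v - G u' v\<bar> / ?m + G u' v * \<bar>1 / ?m - 1 / ?m'\<bar> \<partial>unit_leb)"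
  proof (rule integral_mono)
    fix v assume "v \<in> space unit_leb"
    then have g: "0 \<le> G u' v" using G_bounds[OF u'] by (simp add: space_restrict_space)
    have "G u v / ?m - G u' v / ?m' = (G u v - G u' v) / ?m + G u' v * (1 / ?m - 1 / ?m')"
      using d by (simp add: field_simps)
    then have "\<bar>G u v / ?m - G u' v / ?m'\<bar> \<le> \<bar>(G u v - G u' v) / ?m\<bar> + \<bar>G u' v * (1 / ?m - 1 / ?m')\<bar>"
      by (simp only: abs_triangle_ineq)
    then show "\<bar>G u v / ?m - G u' v / ?m'\<bar> \<le> \<bar>G u v - G u' v\<bar> / ?m + G u' v * \<bar>1 / ?m - 1 / ?m'\<bar>"
      using d g by (simp add: abs_mult abs_divide)
  qed (use G_integrable[OF u] G_integrable[OF u'] in auto)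
  also have "\<dots> = row_dist u u' / ?m + ?m' * \<bar>1 / ?m - 1 / ?m'\<bar>"
    using G_integrable[OF u] G_integrable[OF u'] by (simp add: row_dist_def deg_def)
  also have "?m' * \<bar>1 / ?m - 1 / ?m'\<bar> = \<bar>?m - ?m'\<bar> / ?m"
  proof -
    have "?m' * (1 / ?m - 1 / ?m') = (?m' - ?m) / ?m" using d by (simp add: field_simps)
    then have "\<bar>?m' * (1 / ?m - 1 / ?m')\<bar> = \<bar>(?m' - ?m) / ?m\<bar>" by simp
    then show ?thesis using d by (simp add: abs_mult abs_divide abs_minus_commute)
  qed
  also have "row_dist u u' / ?m + \<bar>?m - ?m'\<bar> / ?m \<le> 2 * row_dist u u' / ?m"
    using deg_diff_le[OF u u'] d by (simp add: add_divide_distrib[symmetric] divide_right_mono)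
  finally have le: "(\<integral>v. \<bar>G u v / ?m - G u' v / ?m'\<bar> \<partial>unit_leb) \<le> 2 * row_dist u u' / ?m" .
  have "(\<integral>\<^sup>+v. ennreal \<bar>G u v / ?m - G u' v / ?m'\<bar> \<partial>unit_leb) = ennreal (\<integral>v. \<bar>G u v / ?m - G u' v / ?m'\<bar> \<partial>unit_leb)"
    using G_integrable[OF u] G_integrable[OF u'] by (intro nn_integral_eq_integral) auto
  then show ?thesis using ennreal_leI[OF le] by simp
qed

text \<open>For \<open>deg G u = 0\<close> the last term is 0 by the convention \<open>x / 0 = 0\<close>.\<close>

lemma WOP2_row_dist:
  assumes C: "0 \<le> C" "\<And>v. v \<in> {0..1} \<Longrightarrow> (\<integral>\<^sup>+x. ennreal ((norm (x - x\<^sub>0))\<^sup>2) \<partial>\<mu> v) \<le> ennreal C"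
    and u: "u \<in> {0..1}" and u': "u' \<in> {0..1}" and d: "deg G u = 0 \<or> row_dist u u' < deg G u"
  shows "(WOP2 x\<^sub>0 (graphon_mix G \<mu> u) (graphon_mix G \<mu> u'))\<^sup>2
    \<le> (row_dist u u')\<^sup>2 * (1 + C) + 8 * (2 * C + 2 * (norm x\<^sub>0)\<^sup>2) * row_dist u u' / deg G u"
proof -
  let ?m = "deg G u" and ?m' = "deg G u'" and ?d = "row_dist u u'" and ?C = "2 * C + 2 * (norm x\<^sub>0)\<^sup>2"
  interpret Gm: prob_space "label_measure \<mu>" by (rule prob_space_label_measure)
  have md: "\<bar>?m - ?m'\<bar> \<le> ?d" by (rule deg_diff_le[OF u u'])
  have d0: "0 \<le> ?d" using md by linarith
  have md2: "(?m - ?m')\<^sup>2 \<le> ?d\<^sup>2" using md d0 by (simp add: abs_le_square_iff[symmetric])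
  have C1: "0 \<le> ?C" using C(1) by simp
  have diff: "norm (dilation x\<^sub>0 a x - dilation x\<^sub>0 b x) = \<bar>a - b\<bar> * norm (x - x\<^sub>0)" for a b x
    by (simp add: dilation_def scaleR_diff_left[symmetric])
  note [measurable] = wt_measurable[OF u] wt_measurable[OF u']
  have wtm: "(\<lambda>v. ennreal (G w v / deg G w)) \<in> borel_measurable unit_leb" if "w \<in> {0..1}" for w
    using G_section[OF that] by simp
  have shift: "(\<integral>\<^sup>+p. wt w p * ennreal ((a * norm (snd p - x\<^sub>0))\<^sup>2) \<partial>label_measure \<mu>) \<le> ennreal (a\<^sup>2 * C)"
    if w: "w \<in> {0..1}" "0 < deg G w" for w a
  proof -
    have "(\<integral>\<^sup>+p. wt w p * ennreal ((a * norm (snd p - x\<^sub>0))\<^sup>2) \<partial>label_measure \<mu>)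
        \<le> (\<integral>\<^sup>+v. ennreal (G w v / deg G w) \<partial>unit_leb) * ennreal (a\<^sup>2 * C)"
    proof (rule nn_integral_weight_le[where \<phi>="\<lambda>x. ennreal ((a * norm (x - x\<^sub>0))\<^sup>2)", OF wtm[OF w(1)]])
      fix v :: real assume v: "v \<in> {0..1}"
      have m: "(\<lambda>x. ennreal ((norm (x - x\<^sub>0))\<^sup>2)) \<in> borel_measurable (\<mu> v)"
        by (simp add: measurable_cong_sets[OF sets_\<mu>[OF v] refl])
      have "(\<integral>\<^sup>+x. ennreal ((a * norm (x - x\<^sub>0))\<^sup>2) \<partial>\<mu> v) = ennreal (a\<^sup>2) * (\<integral>\<^sup>+x. ennreal ((norm (x - x\<^sub>0))\<^sup>2) \<partial>\<mu> v)"
        by (subst nn_integral_cmult[OF m, symmetric]) (simp add: power_mult_distrib ennreal_mult)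
      also have "\<dots> \<le> ennreal (a\<^sup>2) * ennreal C" by (rule mult_left_mono[OF C(2)[OF v]]) simp
      finally show "(\<integral>\<^sup>+x. ennreal ((a * norm (x - x\<^sub>0))\<^sup>2) \<partial>\<mu> v) \<le> ennreal (a\<^sup>2 * C)"
        using C(1) by (simp add: ennreal_mult)
    qed simp
    then show ?thesis by (simp add: nn_integral_normalized_row[OF w])
  qed
  have "(W2 (dilated x\<^sub>0 u) (dilated x\<^sub>0 u'))\<^sup>2 \<le> ?d\<^sup>2 * C + 8 * ?C * ?d / ?m"
  proof (cases "?m = 0")
    case True
    show ?thesis
    proof (cases "?m' = 0")
      case True2: True
      show ?thesis using C(1) by (simp add: dilated_zero[OF u True] dilated_zero[OF u' True2] W2_self True)
    next
      case False
      then have m': "0 < ?m'" using deg_nonneg[OF u'] by simp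
      have "prob_space (density (label_measure \<mu>) (wt u'))"
        by (rule prob_spaceI) (auto simp: emeasure_density wt_total[OF u' m'] cong: nn_integral_cong)
      \<comment> \<open>The point mass is written as the image of the same density under a constant
        map. The two weights then coincide, the remainders vanish, and the cost is that of shrinking
        towards \<open>x\<^sub>0\<close>.\<close>
      then have ret: "dilated x\<^sub>0 u = distr (density (label_measure \<mu>) (wt u')) borel (\<lambda>_. x\<^sub>0)"
        unfolding dilated_zero[OF u True] by (rule prob_space.distr_const[symmetric]) simp
      have "(W2 (distr (density (label_measure \<mu>) (wt u')) borel (\<lambda>_. x\<^sub>0))
          (distr (density (label_measure \<mu>) (wt u')) borel (pos x\<^sub>0 u')))\<^sup>2 \<le> ?m'\<^sup>2 * C"
      proof (rule W2_density_le)
        have "norm (x\<^sub>0 - pos x\<^sub>0 u' p) = ?m' * norm (snd p - x\<^sub>0)" for p :: "real \<times> 'a"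
          using m' by (simp add: dilation_def)
        then show "(\<integral>\<^sup>+p. min (wt u' p) (wt u' p) * ennreal ((norm (x\<^sub>0 - pos x\<^sub>0 u' p))\<^sup>2) \<partial>label_measure \<mu>)
          + (2 * (\<integral>\<^sup>+p. (wt u' p - wt u' p) * ennreal ((norm x\<^sub>0)\<^sup>2) \<partial>label_measure \<mu>)
          + 2 * (\<integral>\<^sup>+p. (wt u' p - wt u' p) * ennreal ((norm (pos x\<^sub>0 u' p))\<^sup>2) \<partial>label_measure \<mu>)) \<le> ennreal (?m'\<^sup>2 * C)"
          using shift[OF u' m', of ?m'] by simp
      qed (use C(1) wt_total[OF u' m'] in \<open>auto intro: Gm.sigma_finite_measure_axioms\<close>)
      also have "\<dots> \<le> ?d\<^sup>2 * C" using md2 True C(1) by (intro mult_right_mono) auto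
      finally show ?thesis unfolding ret dilated_eq[OF u' m'] using True by simp
    qed
  next
    case False
    then have m: "0 < ?m" using deg_nonneg[OF u] by simp
    \<comment> \<open>The masses differ by at most the row distance, which the hypothesis places
      below \<open>?m\<close>.\<close>
    then have m': "0 < ?m'" using d md by linarith
    let ?w = "\<lambda>v. ennreal \<bar>G u v / ?m - G u' v / ?m'\<bar>"
    have wm: "?w \<in> borel_measurable unit_leb" using G_section[OF u] G_section[OF u'] by simp
    \<comment> \<open>Subtraction in \<open>ennreal\<close> is truncated at 0, hence at most the
      absolute difference of the weights. The fact covers both orders of the two labels.\<close>
    have rem: "(\<integral>\<^sup>+p. (wt a p - wt b p) * ennreal ((norm (pos x\<^sub>0 c p))\<^sup>2) \<partial>label_measure \<mu>) \<le> ennreal (2 * ?d / ?m * ?C)"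
      if ab: "(a = u \<and> b = u') \<or> (a = u' \<and> b = u)" and c: "c \<in> {0..1}" for a b c
    proof -
      have "(\<integral>\<^sup>+p. (wt a p - wt b p) * ennreal ((norm (pos x\<^sub>0 c p))\<^sup>2) \<partial>label_measure \<mu>)
          \<le> (\<integral>\<^sup>+p. ?w (fst p) * ennreal ((norm (pos x\<^sub>0 c p))\<^sup>2) \<partial>label_measure \<mu>)"
      proof (intro nn_integral_mono mult_right_mono)
        fix p assume "p \<in> space (label_measure \<mu>)"
        then have "fst p \<in> {0..1}" by (auto simp: space_label_measure)
        then have "0 \<le> G u (fst p) / ?m" "0 \<le> G u' (fst p) / ?m'"
          using G_bounds[OF u] G_bounds[OF u'] m m' by auto
        then show "wt a p - wt b p \<le> ?w (fst p)"
          using ab by (auto simp: ennreal_minus intro!: ennreal_leI)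
      qed simp
      also have "\<dots> \<le> (\<integral>\<^sup>+v. ?w v \<partial>unit_leb) * ennreal ?C"
        using pos_moment[OF C c]
        by (intro nn_integral_weight_le[where \<phi>="\<lambda>x. ennreal ((norm (dilation x\<^sub>0 (deg G c) x))\<^sup>2)", OF wm]) auto
      also have "\<dots> \<le> ennreal (2 * ?d / ?m) * ennreal ?C"
        by (intro mult_right_mono normalized_row_dist u u' m m') simp
      also have "\<dots> = ennreal (2 * ?d / ?m * ?C)" using d0 m C1 by (intro ennreal_mult[symmetric]) auto
      finally show ?thesis .
    qed
    show ?thesis unfolding dilated_eq[OF u m] dilated_eq[OF u' m']
    proof (rule W2_density_le)
      have "(\<integral>\<^sup>+p. min (wt u p) (wt u' p) * ennreal ((norm (pos x\<^sub>0 u p - pos x\<^sub>0 u' p))\<^sup>2) \<partial>label_measure \<mu>)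
          \<le> (\<integral>\<^sup>+p. wt u p * ennreal ((\<bar>?m - ?m'\<bar> * norm (snd p - x\<^sub>0))\<^sup>2) \<partial>label_measure \<mu>)"
        unfolding diff by (intro nn_integral_mono mult_right_mono) auto
      also have "\<dots> \<le> ennreal (\<bar>?m - ?m'\<bar>\<^sup>2 * C)" by (rule shift[OF u m])
      also have "\<dots> \<le> ennreal (?d\<^sup>2 * C)" using md2 C(1) by (intro ennreal_leI mult_right_mono) auto
      finally have "(\<integral>\<^sup>+p. min (wt u p) (wt u' p) * ennreal ((norm (pos x\<^sub>0 u p - pos x\<^sub>0 u' p))\<^sup>2) \<partial>label_measure \<mu>)
        + (2 * (\<integral>\<^sup>+p. (wt u p - wt u' p) * ennreal ((norm (pos x\<^sub>0 u p))\<^sup>2) \<partial>label_measure \<mu>)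
        + 2 * (\<integral>\<^sup>+p. (wt u' p - wt u p) * ennreal ((norm (pos x\<^sub>0 u' p))\<^sup>2) \<partial>label_measure \<mu>))
        \<le> ennreal (?d\<^sup>2 * C) + (2 * ennreal (2 * ?d / ?m * ?C) + 2 * ennreal (2 * ?d / ?m * ?C))"
        by (intro add_mono mult_left_mono rem u u') auto
      also have "\<dots> = ennreal (?d\<^sup>2 * C + (2 * (2 * ?d / ?m * ?C) + 2 * (2 * ?d / ?m * ?C)))"
      proof -
        have "ennreal a + (2 * ennreal b + 2 * ennreal b) = ennreal (a + (2 * b + 2 * b))" if "0 \<le> a" "0 \<le> b" for a b
        proof -
          have "2 * ennreal b = ennreal (2 * b)" using that by (simp add: ennreal_mult)
          then show ?thesis using that by (simp only: ennreal_plus[symmetric] add_nonneg_nonneg mult_nonneg_nonneg zero_le_numeral)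
        qed
        then show ?thesis using C(1) C1 d0 m by simp
      qed
      \<comment> \<open>Two remainders, each with a factor 2 from the coupling and a factor 2 from
        \<open>normalized_row_dist\<close>, make the 8.\<close>
      also have "?d\<^sup>2 * C + (2 * (2 * ?d / ?m * ?C) + 2 * (2 * ?d / ?m * ?C)) = ?d\<^sup>2 * C + 8 * ?C * ?d / ?m"
        using m by (simp add: field_simps)
      finally show "(\<integral>\<^sup>+p. min (wt u p) (wt u' p) * ennreal ((norm (pos x\<^sub>0 u p - pos x\<^sub>0 u' p))\<^sup>2) \<partial>label_measure \<mu>)
        + (2 * (\<integral>\<^sup>+p. (wt u p - wt u' p) * ennreal ((norm (pos x\<^sub>0 u p))\<^sup>2) \<partial>label_measure \<mu>)
        + 2 * (\<integral>\<^sup>+p. (wt u' p - wt u p) * ennreal ((norm (pos x\<^sub>0 u' p))\<^sup>2) \<partial>label_measure \<mu>))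
        \<le> ennreal (?d\<^sup>2 * C + 8 * ?C * ?d / ?m)" .
      show "0 \<le> ?d\<^sup>2 * C + 8 * ?C * ?d / ?m" using C(1) C1 d0 m by (intro add_nonneg_nonneg) auto
    qed (use wt_total[OF u m] wt_total[OF u' m'] in \<open>auto intro: Gm.sigma_finite_measure_axioms\<close>)
  qed
  then show ?thesis
    unfolding WOP2_graphon_mix[OF u u'] using md2 by (simp add: distrib_left)
qed

lemma G_measurable_pair: "(\<lambda>p. G (fst p) (snd p)) \<in> borel_measurable (unit_borel \<Otimes>\<^sub>M unit_leb)"
proof -
  have "(\<lambda>p. p) \<in> unit_borel \<Otimes>\<^sub>M unit_leb \<rightarrow>\<^sub>M restrict_space borel ({0..1::real} \<times> {0..1::real})"
  proof (rule measurable_restrict_space2)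
    have "(\<lambda>p. (fst p, snd p)) \<in> unit_borel \<Otimes>\<^sub>M unit_leb \<rightarrow>\<^sub>M borel \<Otimes>\<^sub>M borel"
      by (intro measurable_Pair measurable_compose[OF measurable_fst] measurable_compose[OF measurable_snd]
          measurable_restrict_space1) simp_all
    then show "(\<lambda>p. p) \<in> unit_borel \<Otimes>\<^sub>M unit_leb \<rightarrow>\<^sub>M (borel :: (real \<times> real) measure)"
      by (simp add: borel_prod)
  qed (auto simp: space_pair_measure space_restrict_space)
  moreover have "(\<lambda>p. G (fst p) (snd p)) \<in> borel_measurable (restrict_space borel ({0..1} \<times> {0..1}))"
    using G by (simp add: graphon_def split_beta')
  ultimately show ?thesis by (rule measurable_compose)
qed

text \<open>Measurability needs continuity at each \<open>u\<close> separately, without uniformity,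
  so a modulus of continuity that deteriorates as the degree tends to 0 does no harm.\<close>

lemma graphon_mix_lipschitz_measurable:
  fixes F :: "'a measure \<Rightarrow> 'b::metric_space"
  assumes L: "\<And>\<alpha> \<beta>. \<alpha> \<in> measures2 \<Longrightarrow> \<beta> \<in> measures2 \<Longrightarrow> dist (F \<alpha>) (F \<beta>) \<le> L * WOP2 x\<^sub>0 \<alpha> \<beta>"
  shows "(\<lambda>u. F (graphon_mix G \<mu> u)) \<in> borel_measurable unit_borel"
proof (rule measurable_of_L1_continuous[OF G_measurable_pair])
  show "integrable unit_leb (G u)" if "u \<in> space unit_borel" for u
    using that by (intro G_integrable) (simp add: space_restrict_space)
  fix u V assume u0: "u \<in> space unit_borel" and V: "open V" "F (graphon_mix G \<mu> u) \<in> V"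
  have u: "u \<in> {0..1}" using u0 by (simp add: space_restrict_space)
  obtain e where e: "0 < e" "ball (F (graphon_mix G \<mu> u)) e \<subseteq> V" using V openE by blast
  obtain C where C: "0 \<le> C" "\<And>v. v \<in> {0..1} \<Longrightarrow> (\<integral>\<^sup>+x. ennreal ((norm (x - x\<^sub>0))\<^sup>2) \<partial>\<mu> v) \<le> ennreal C"
    using centred_moment_bound by blast
  \<comment> \<open>For a row distance of at most 1 its square is at most itself, so
    \<open>K\<close> times the row distance bounds the squared \<open>WOP2\<close> distance. At
    degree 0 the last summand is 0.\<close>
  define K where "K = 1 + C + 8 * (2 * C + 2 * (norm x\<^sub>0)\<^sup>2) / deg G u"
  have K: "1 \<le> K" unfolding K_def using C(1) deg_nonneg[OF u] by simp
  define r where "r = e / (1 + \<bar>L\<bar>)"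
  have r: "0 < r" using e by (simp add: r_def add_pos_nonneg)
  \<comment> \<open>Keeps the row distance below 1, below the degree if that is positive, and below
    \<open>r^2 / K\<close>.\<close>
  define \<delta> where "\<delta> = min (if deg G u = 0 then 1 else min 1 (deg G u)) (r\<^sup>2 / K)"
  have \<delta>: "0 < \<delta>" "\<delta> \<le> 1" "\<delta> \<le> r\<^sup>2 / K" "deg G u = 0 \<or> \<delta> \<le> deg G u"
    using deg_nonneg[OF u] r K by (auto simp: \<delta>_def)
  show "\<exists>\<delta>>0. \<forall>u'\<in>space unit_borel. (\<integral>v. \<bar>G u v - G u' v\<bar> \<partial>unit_leb) < \<delta> \<longrightarrow> F (graphon_mix G \<mu> u') \<in> V"
  proof (intro exI[of _ \<delta>] conjI ballI impI \<delta>(1))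
    fix u' assume u'0: "u' \<in> space unit_borel" and du: "(\<integral>v. \<bar>G u v - G u' v\<bar> \<partial>unit_leb) < \<delta>"
    then have u': "u' \<in> {0..1}" and d: "row_dist u u' < \<delta>" by (simp_all add: space_restrict_space row_dist_def)
    have d0: "0 \<le> row_dist u u'" using deg_diff_le[OF u u'] by linarith
    let ?W = "WOP2 x\<^sub>0 (graphon_mix G \<mu> u) (graphon_mix G \<mu> u')"
    have W0: "0 \<le> ?W" by (simp add: WOP2_def)
    have "?W\<^sup>2 \<le> (row_dist u u')\<^sup>2 * (1 + C) + 8 * (2 * C + 2 * (norm x\<^sub>0)\<^sup>2) * row_dist u u' / deg G u"
      by (rule WOP2_row_dist[OF C u u']) (use \<delta> d in auto)
    also have "(row_dist u u')\<^sup>2 * (1 + C) \<le> row_dist u u' * (1 + C)"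
      using d0 d \<delta>(2) C(1) by (intro mult_right_mono) (auto simp: power2_eq_square mult_left_le_one_le)
    finally have "?W\<^sup>2 \<le> row_dist u u' * K" by (simp add: K_def distrib_left mult_ac)
    also have "\<dots> < r\<^sup>2"
    proof -
      have "row_dist u u' < r\<^sup>2 / K" using d \<delta>(3) by simp
      then show ?thesis using K by (simp add: pos_less_divide_eq)
    qed
    finally have "?W < r" using r by (simp add: power_less_imp_less_base)
    have "dist (F (graphon_mix G \<mu> u)) (F (graphon_mix G \<mu> u')) \<le> L * ?W"
      by (intro L graphon_mix_measures2 u u')
    also have "\<dots> \<le> (1 + \<bar>L\<bar>) * ?W" using W0 by (intro mult_right_mono) auto
    also have "\<dots> < (1 + \<bar>L\<bar>) * r" using \<open>?W < r\<close> by (intro mult_strict_left_mono) auto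
    also have "\<dots> = e" unfolding r_def using abs_ge_zero[of L] by (simp add: field_simps)
    finally show "F (graphon_mix G \<mu> u') \<in> V" using e(2) by (auto simp: dist_commute)
  qed
qed

end

text \<open>Both mixtures have mass \<open>deg G u\<close>, so the mass term vanishes, and second
  moments bound the remaining term uniformly in the label.\<close>

lemma WOP2_graphon_mix_bounded:
  fixes \<mu> \<nu> :: "real \<Rightarrow> 'a::euclidean_space measure"
  assumes G: "graphon G" and \<mu>: "\<mu> \<in> families" and \<nu>: "\<nu> \<in> families"
  shows "\<exists>K. \<forall>u\<in>{0..1}. WOP2 x\<^sub>0 (graphon_mix G \<mu> u) (graphon_mix G \<nu> u) \<le> K"
proof -
  interpret M: graphon_family G \<mu> using G \<mu> by unfold_locales
  interpret N: graphon_family G \<nu> using G \<nu> by unfold_locales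
  obtain C where C: "0 \<le> C" "\<And>v. v \<in> {0..1} \<Longrightarrow> (\<integral>\<^sup>+x. ennreal ((norm (x - x\<^sub>0))\<^sup>2) \<partial>\<mu> v) \<le> ennreal C"
    using M.centred_moment_bound by blast
  obtain D where D: "0 \<le> D" "\<And>v. v \<in> {0..1} \<Longrightarrow> (\<integral>\<^sup>+x. ennreal ((norm (x - x\<^sub>0))\<^sup>2) \<partial>\<nu> v) \<le> ennreal D"
    using N.centred_moment_bound by blast
  let ?K = "2 * (2 * C + 2 * (norm x\<^sub>0)\<^sup>2) + 2 * (2 * D + 2 * (norm x\<^sub>0)\<^sup>2)"
  have "WOP2 x\<^sub>0 (graphon_mix G \<mu> u) (graphon_mix G \<nu> u) \<le> sqrt ?K" if u: "u \<in> {0..1}" for u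
  proof -
    have "(W2 (M.dilated x\<^sub>0 u) (N.dilated x\<^sub>0 u))\<^sup>2 \<le> ?K"
      using M.dilated_moment[OF C u] N.dilated_moment[OF D u] C(1) D(1)
      by (intro W2_power2_le_moments M.prob_space_dilated N.prob_space_dilated u)
         (auto simp: M.dilated_def N.dilated_def)
    from real_sqrt_le_mono[OF this] show ?thesis
      by (simp only: WOP2_def M.mass_graphon_mix[OF u] N.mass_graphon_mix[OF u] M.dilated_def N.dilated_def
          diff_self power_zero_numeral add_0)
  qed
  then show ?thesis by blast
qed


subsection \<open>Euler schemes\<close>

text \<open>Continuity and measurability of matrix-valued functions refer to the Euclidean norm of
  the entries, whereas (RD) is stated in the operator norm; any constant between the two
  suffices.\<close>

lemma norm_matrix_le_onorm:
  fixes A :: "real^'q^'d"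
  shows "norm A \<le> real CARD('d) * real CARD('q) * onorm ((*v) A)"
proof -
  have bl: "bounded_linear ((*v) A)" by (rule matrix_vector_mul_bounded_linear)
  have "\<bar>A $ i $ j\<bar> \<le> onorm ((*v) A)" for i j
  proof -
    have "\<bar>(A *v axis j 1) $ i\<bar> \<le> norm (A *v axis j 1)" by (rule component_le_norm_cart)
    also have "\<dots> \<le> onorm ((*v) A) * norm (axis j 1 :: real^'q)" by (rule onorm[OF bl])
    finally show ?thesis by (simp add: matrix_vector_mult_basis column_def)
  qed
  then have row: "norm (A $ i) \<le> real CARD('q) * onorm ((*v) A)" for i
    using order_trans[OF norm_le_l1_cart[of "A $ i"] sum_mono[of UNIV "\<lambda>j. \<bar>A $ i $ j\<bar>" "\<lambda>_. onorm ((*v) A)"]] by simp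
  have "norm A \<le> (\<Sum>i\<in>UNIV. norm (A $ i))" unfolding norm_vec_def by (rule L2_set_le_sum) simp
  also have "\<dots> \<le> (\<Sum>i\<in>(UNIV::'d set). real CARD('q) * onorm ((*v) A))" by (rule sum_mono) (rule row)
  finally show ?thesis by simp
qed

text \<open>Cutting off at \<open>T\<close> handles the shorter last step and the constant
  continuation after it at once, so \<open>sampled_path\<close> becomes evaluation along the grid
  without case distinctions.\<close>

definition grid :: "real \<Rightarrow> real \<Rightarrow> nat \<Rightarrow> real" where
  "grid h T k = min (real k * h) T"

text \<open>The number of steps is \<open>T / h\<close> rounded up: the last step is a full one when
  \<open>T / h\<close> is an integer and is cut short otherwise.\<close>

lemma grid_num_steps:
  assumes h: "0 < h" and T: "0 < T"
  shows "k < num_steps T h \<Longrightarrow> real k * h < T" and "num_steps T h \<le> k \<Longrightarrow> T \<le> real k * h"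
proof -
  have pos: "0 < T / h" using assms by simp
  show "real k * h < T" if k: "k < num_steps T h"
  proof (cases "T / h \<in> \<nat>")
    case True
    then obtain n where n: "T / h = real n" by (auto simp: Nats_def)
    then have "k < n" using k True by (simp add: num_steps_def)
    then have "real k < T / h" using n by simp
    then show ?thesis using h by (simp add: pos_less_divide_eq)
  next
    case False
    then have "k \<le> nat \<lfloor>T / h\<rfloor>" using k by (simp add: num_steps_def)
    then have "real k \<le> T / h" using pos by linarith
    moreover have "real k \<noteq> T / h" using False by (metis of_nat_in_Nats)
    ultimately have "real k < T / h" by simp
    then show ?thesis using h by (simp add: pos_less_divide_eq)
  qed
  show "T \<le> real k * h" if k: "num_steps T h \<le> k"
  proof (cases "T / h \<in> \<nat>")
    case True
    then obtain n where n: "T / h = real n" by (auto simp: Nats_def)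
    then have "n \<le> k" using k True by (simp add: num_steps_def)
    then have "T / h \<le> real k" using n by simp
    then show ?thesis using h by (simp add: pos_divide_le_eq)
  next
    case False
    then have "nat \<lfloor>T / h\<rfloor> + 1 \<le> k" using k by (simp add: num_steps_def)
    then have "T / h \<le> real k" using pos by linarith
    then show ?thesis using h by (simp add: pos_divide_le_eq)
  qed
qed

lemma grid_before: "0 < h \<Longrightarrow> 0 < T \<Longrightarrow> k < num_steps T h \<Longrightarrow> grid h T k = real k * h"
  using grid_num_steps(1)[of h T k] by (simp add: grid_def)

lemma grid_after: "0 < h \<Longrightarrow> 0 < T \<Longrightarrow> num_steps T h \<le> k \<Longrightarrow> grid h T k = T"
  using grid_num_steps(2)[of h T k] by (simp add: grid_def)

lemma sampled_path_grid: "0 < h \<Longrightarrow> 0 < T \<Longrightarrow> sampled_path T h x m = x (grid h T m)"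
  by (simp add: sampled_path_def grid_before grid_after)

lemma grid_mono: "0 < h \<Longrightarrow> incseq (grid h T)"
  unfolding incseq_def grid_def by (intro allI impI min.mono mult_right_mono) auto

lemma grid_nonneg: "0 < h \<Longrightarrow> 0 < T \<Longrightarrow> 0 \<le> grid h T k"
  by (simp add: grid_def)

lemma grid_step:
  assumes "0 < h" "0 < T" "k < num_steps T h"
  shows "grid h T k < grid h T (Suc k)" "grid h T (Suc k) \<in> {real k * h..real (Suc k) * h}"
  using grid_num_steps(1)[OF assms] assms(1) grid_before[OF assms] by (auto simp: grid_def distrib_right)

lemma distr_pair_comp:
  assumes P: "prob_space P" and V: "V \<in> P \<rightarrow>\<^sub>M MA" "W \<in> P \<rightarrow>\<^sub>M MB"
    and ind: "distr P (MA \<Otimes>\<^sub>M MB) (\<lambda>\<omega>. (V \<omega>, W \<omega>)) = distr P MA V \<Otimes>\<^sub>M distr P MB W"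
    and gk: "g \<in> MA \<rightarrow>\<^sub>M NA" "k \<in> MB \<rightarrow>\<^sub>M NB"
  shows "distr P (NA \<Otimes>\<^sub>M NB) (\<lambda>\<omega>. (g (V \<omega>), k (W \<omega>))) = distr P NA (\<lambda>\<omega>. g (V \<omega>)) \<Otimes>\<^sub>M distr P NB (\<lambda>\<omega>. k (W \<omega>))"
proof (rule pair_measure_eqI[symmetric])
  interpret P: prob_space P by fact
  note [measurable] = V gk
  show "sigma_finite_measure (distr P NA (\<lambda>\<omega>. g (V \<omega>)))" "sigma_finite_measure (distr P NB (\<lambda>\<omega>. k (W \<omega>)))"
    by (intro prob_space_imp_sigma_finite P.prob_space_distr; simp)+
  interpret V: prob_space "distr P MA V" by (rule P.prob_space_distr) simp
  interpret W: prob_space "distr P MB W" by (rule P.prob_space_distr) simp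
  fix A B assume "A \<in> sets (distr P NA (\<lambda>\<omega>. g (V \<omega>)))" "B \<in> sets (distr P NB (\<lambda>\<omega>. k (W \<omega>)))"
  then have [measurable]: "A \<in> sets NA" "B \<in> sets NB" by auto
  let ?A = "g -` A \<inter> space MA" and ?B = "k -` B \<inter> space MB"
  have sAB: "?A \<in> sets MA" "?B \<in> sets MB" by measurable
  have "emeasure (distr P NA (\<lambda>\<omega>. g (V \<omega>))) A = emeasure (distr P MA V) ?A"
    using measurable_space[OF V(1)] sAB by (auto simp: emeasure_distr intro!: arg_cong[where f="emeasure P"])
  moreover have "emeasure (distr P NB (\<lambda>\<omega>. k (W \<omega>))) B = emeasure (distr P MB W) ?B"
    using measurable_space[OF V(2)] sAB by (auto simp: emeasure_distr intro!: arg_cong[where f="emeasure P"])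
  moreover have "emeasure (distr P MA V) ?A * emeasure (distr P MB W) ?B = emeasure (distr P (MA \<Otimes>\<^sub>M MB) (\<lambda>\<omega>. (V \<omega>, W \<omega>))) (?A \<times> ?B)"
    unfolding ind using sAB by (subst W.emeasure_pair_measure_Times) auto
  moreover have "\<dots> = emeasure (distr P (NA \<Otimes>\<^sub>M NB) (\<lambda>\<omega>. (g (V \<omega>), k (W \<omega>)))) (A \<times> B)"
    using measurable_space[OF V(1)] measurable_space[OF V(2)] sAB
    by (subst (1 2) emeasure_distr) (auto intro!: arg_cong[where f="emeasure P"])
  ultimately show "emeasure (distr P NA (\<lambda>\<omega>. g (V \<omega>))) A * emeasure (distr P NB (\<lambda>\<omega>. k (W \<omega>))) B
      = emeasure (distr P (NA \<Otimes>\<^sub>M NB) (\<lambda>\<omega>. (g (V \<omega>), k (W \<omega>)))) (A \<times> B)" by simp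
qed simp

text \<open>Interpreted once with \<open>G\<close> and \<open>\<sigma>\<close> and once with
  \<open>K\<close> and \<open>\<theta>\<close>. Independence is asked only within one label, between
  initial value and noise, because different labels interact through their laws and not through
  their paths.\<close>

locale euler =
  fixes x\<^sub>0 :: "real^'d" and P :: "'w measure" and G :: "real \<Rightarrow> real \<Rightarrow> real"
    and b :: "real \<Rightarrow> real^'d \<Rightarrow> real^'d" and S :: "real \<Rightarrow> real^'d \<Rightarrow> (real^'d) measure \<Rightarrow> real^'q^'d"
    and X\<^sub>0 :: "real \<Rightarrow> 'w \<Rightarrow> real^'d" and B :: "real \<Rightarrow> real \<Rightarrow> 'w \<Rightarrow> real^'q"
    and X :: "real \<Rightarrow> real \<Rightarrow> 'w \<Rightarrow> real^'d" and h T L \<kappa> :: real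
  assumes P: "prob_space P" and hT: "0 < h" "0 < T" and G: "graphon G"
    and B: "\<And>u. u \<in> {0..1} \<Longrightarrow> std_brownian P (B u)"
    and X\<^sub>0m: "\<And>u. u \<in> {0..1} \<Longrightarrow> X\<^sub>0 u \<in> borel_measurable P"
    and indep: "\<And>u A N. u \<in> {0..1} \<Longrightarrow> A \<in> sets (vimage_algebra (space P) (X\<^sub>0 u) borel) \<Longrightarrow>
        N \<in> sets (vimage_algebra (space P) (\<lambda>\<omega>. \<lambda>t\<in>{0..}. B u t \<omega>) (PiM {0..} (\<lambda>_. borel))) \<Longrightarrow>
        measure P (A \<inter> N) = measure P A * measure P N"
    and X\<^sub>0_law: "(\<lambda>u. distr P borel (X\<^sub>0 u)) \<in> families"
    and affine: "\<And>t. 0 \<le> t \<Longrightarrow> \<exists>l c. linear l \<and> (\<forall>x. b t x = l x + c)"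
    and lipschitz: "\<And>t x y \<mu> \<nu>. 0 \<le> t \<Longrightarrow> \<mu> \<in> measures2 \<Longrightarrow> \<nu> \<in> measures2 \<Longrightarrow>
        onorm ((*v) (S t x \<mu> - S t y \<nu>)) \<le> L * (norm (x - y) + WOP2 x\<^sub>0 \<mu> \<nu>)"
    and L: "0 \<le> L"
    and \<kappa>: "\<And>t u. 0 \<le> t \<Longrightarrow> u \<in> {0..1} \<Longrightarrow> onorm ((*v) (S t 0 (graphon_mix G (\<lambda>_. return borel 0) u))) \<le> \<kappa>"
    and scheme: "euler_scheme P h G b S B X\<^sub>0 X"
begin

sublocale prob_space P by (rule P)

abbreviation "\<tau> \<equiv> grid h T"
abbreviation "M \<equiv> num_steps T h"

definition law :: "nat \<Rightarrow> real \<Rightarrow> (real^'d) measure" where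
  "law k u = distr P borel (X u (\<tau> k))"

definition drift :: "nat \<Rightarrow> real^'d \<Rightarrow> real^'d" where
  "drift k x = x + (\<tau> (Suc k) - \<tau> k) *\<^sub>R b (\<tau> k) x"

definition diffusion :: "nat \<Rightarrow> real \<Rightarrow> real^'d \<Rightarrow> real^'q^'d" where
  "diffusion k u x = S (\<tau> k) x (graphon_mix G (law k) u)"

definition increment :: "real \<Rightarrow> nat \<Rightarrow> 'w \<Rightarrow> real^'q" where
  "increment u k \<omega> = B u (\<tau> (Suc k)) \<omega> - B u (\<tau> k) \<omega>"

text \<open>Taken from the grid rather than from \<open>h\<close>, since the last step may be
  shorter.\<close>

definition sd :: "nat \<Rightarrow> real" where
  "sd k = sqrt (\<tau> (Suc k) - \<tau> k)"

text \<open>Frozen after index \<open>n\<close>, so that the first \<open>n\<close> steps form a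
  point of the sequence space on which test functions act.\<close>

definition path :: "nat \<Rightarrow> real \<Rightarrow> 'w \<Rightarrow> nat \<Rightarrow> real^'d" where
  "path n u \<omega> = (\<lambda>i. X u (\<tau> (min i n)) \<omega>)"

lemma \<tau>0: "\<tau> 0 = 0" using hT by (simp add: grid_def)

lemma X_0: "u \<in> {0..1} \<Longrightarrow> \<omega> \<in> space P \<Longrightarrow> X u (\<tau> 0) \<omega> = X\<^sub>0 u \<omega>"
  using scheme by (simp add: euler_scheme_def \<tau>0)

text \<open>The last grid point may fall inside a step of the scheme; the continuous-time formula,
  with coefficients frozen at the start of the step, covers this case too.\<close>

lemma X_Suc:
  assumes u: "u \<in> {0..1}" and \<omega>: "\<omega> \<in> space P" and k: "k < M"
  shows "X u (\<tau> (Suc k)) \<omega> = drift k (X u (\<tau> k) \<omega>) + diffusion k u (X u (\<tau> k) \<omega>) *v increment u k \<omega>"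
proof -
  have g: "real k * h = \<tau> k" using grid_before[OF hT k] by simp
  have "X u t \<omega> = X u (real k * h) \<omega> + (t - real k * h) *\<^sub>R b (real k * h) (X u (real k * h) \<omega>)
          + S (real k * h) (X u (real k * h) \<omega>) (graphon_mix G (\<lambda>v. distr P borel (X v (real k * h))) u)
            *v (B u t \<omega> - B u (real k * h) \<omega>)" if "t \<in> {real k * h..real (Suc k) * h}" for t
    using scheme u \<omega> that unfolding euler_scheme_def by blast
  from this[OF grid_step(2)[OF hT k]] show ?thesis
    by (simp add: g drift_def diffusion_def law_def[abs_def] increment_def)
qed

lemma sd_pos: "k < M \<Longrightarrow> 0 < sd k"
  using grid_step(1)[OF hT] by (simp add: sd_def)

lemma increment_measurable: "u \<in> {0..1} \<Longrightarrow> increment u k \<in> borel_measurable P"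
  unfolding increment_def[abs_def] using B[of u] grid_nonneg[OF hT]
  by (intro borel_measurable_diff) (auto simp: std_brownian_def)

lemma increment_law:
  assumes u: "u \<in> {0..1}" and k: "k < M"
  shows "distr P borel (increment u k) = gauss (sd k)"
proof -
  have "distributed P lborel (\<lambda>\<omega>. B u (\<tau> (Suc k)) \<omega> - B u (\<tau> k) \<omega>)
      (\<lambda>x. ennreal (\<Prod>i\<in>UNIV. normal_density 0 (sqrt (\<tau> (Suc k) - \<tau> k)) (x $ i)))"
    using B[OF u] grid_step(1)[OF hT k] grid_nonneg[OF hT, of k] unfolding std_brownian_def by blast
  then have "distr P lborel (increment u k) = gauss (sd k)"
    by (simp add: distributed_def gauss_def sd_def increment_def[abs_def])
  then show ?thesis by (metis distr_cong sets_lborel)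
qed

text \<open>The initial value and the increments live in different spaces; they are embedded in the product
  space since independent families of random variables have a common codomain.\<close>

definition source_var :: "real \<Rightarrow> nat \<Rightarrow> 'w \<Rightarrow> (real^'d) \<times> (real^'q)" where
  "source_var u k \<omega> = (case k of 0 \<Rightarrow> (X\<^sub>0 u \<omega>, 0) | Suc j \<Rightarrow> (0, increment u j \<omega>))"

lemma source_var_measurable: "u \<in> {0..1} \<Longrightarrow> source_var u k \<in> borel_measurable P"
  unfolding source_var_def[abs_def] using X\<^sub>0m increment_measurable
  by (cases k) (auto intro!: borel_measurable_Pair)

text \<open>The events of the increments intersect in an event of the noise, which splits off from
  that of the initial value by \<open>indep\<close>. The increments then factor among themselves by
  the Brownian property.\<close>

lemma indep_source_vars:
  assumes u: "u \<in> {0..1}"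
  shows "indep_vars (\<lambda>_. borel) (source_var u) {..n}"
  unfolding indep_vars_def2
proof (intro conjI ballI source_var_measurable u indep_setsI)
  fix i show "{source_var u i -` A \<inter> space P |A. A \<in> sets borel} \<subseteq> events"
    using measurable_sets[OF source_var_measurable[OF u]] by blast
next
  fix A J assume J: "J \<noteq> {}" "J \<subseteq> {..n}" "finite J"
    and A: "\<forall>j\<in>J. A j \<in> {source_var u j -` A \<inter> space P |A. A \<in> sets borel}"
  let ?noise = "vimage_algebra (space P) (\<lambda>\<omega>. \<lambda>t\<in>{0..}. B u t \<omega>) (PiM {0..} (\<lambda>_. borel))"
  define K where "K = {k. Suc k \<in> J}"
  have K: "finite K" "K \<subseteq> {..<n}"
  proof -
    have "Suc ` K \<subseteq> J" by (auto simp: K_def)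
    then show "finite K" using J(3) by (meson finite_imageD finite_subset inj_Suc inj_on_subset subset_UNIV)
  qed (use J(2) in \<open>auto simp: K_def\<close>)
  have AK: "\<exists>E\<in>sets borel. A (Suc k) = increment u k -` E \<inter> space P" if k: "k \<in> K" for k
  proof -
    have "Suc k \<in> J" using k by (simp add: K_def)
    then obtain E where E: "E \<in> sets borel" "A (Suc k) = source_var u (Suc k) -` E \<inter> space P"
      using A by blast
    have "Pair (0 :: real^'d) -` E \<in> sets (borel :: (real^'q) measure)"
      by (rule measurable_sets_borel[OF _ E(1)]) (intro borel_measurable_Pair measurable_const measurable_ident; simp)
    moreover have "A (Suc k) = increment u k -` (Pair 0 -` E) \<inter> space P"
      using E(2) by (auto simp: source_var_def)
    ultimately show ?thesis by blast
  qed
  \<comment> \<open>The intersection with the whole space gives the right event of probability 1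
    when no increment is involved.\<close>
  define N where "N = space P \<inter> (\<Inter>k\<in>K. A (Suc k))"
  have "indep_vars (\<lambda>_. borel) (increment u) {..<n}"
    using B[OF u] grid_mono[OF hT(1), of T] grid_nonneg[OF hT, of 0]
    unfolding std_brownian_def increment_def[abs_def] by blast
  then have inc: "indep_sets (\<lambda>i. {increment u i -` A \<inter> space P |A. A \<in> sets borel}) {..<n}"
    by (simp add: indep_vars_def2)
  have probN: "prob N = (\<Prod>k\<in>K. prob (A (Suc k)))"
  proof (cases "K = {}")
    case True then show ?thesis by (simp add: N_def prob_space)
  next
    case False
    have "N = (\<Inter>k\<in>K. A (Suc k))" using False AK by (fastforce simp: N_def)
    moreover have "prob (\<Inter>k\<in>K. A (Suc k)) = (\<Prod>k\<in>K. prob (A (Suc k)))"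
      using AK by (intro indep_setsD[OF inc K(2) False K(1)]) blast
    ultimately show ?thesis by simp
  qed
  have N: "N \<in> sets ?noise"
  proof -
    have Bt: "B u t \<in> ?noise \<rightarrow>\<^sub>M borel" if t: "0 \<le> t" for t
    proof -
      have "(\<lambda>\<omega>. \<lambda>t\<in>{0..}. B u t \<omega>) \<in> ?noise \<rightarrow>\<^sub>M PiM {0..} (\<lambda>_. borel)"
        by (rule measurable_vimage_algebra1) (auto simp: space_PiM)
      from measurable_compose[OF this measurable_component_singleton[of t]] t
      show ?thesis by simp
    qed
    have "increment u k \<in> ?noise \<rightarrow>\<^sub>M borel" for k
      unfolding increment_def[abs_def] by (intro borel_measurable_diff Bt grid_nonneg hT)
    then have Am: "A (Suc k) \<in> sets ?noise" if "k \<in> K" for k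
      using AK[OF that] measurable_sets[of "increment u k" ?noise borel] by (auto simp: space_vimage_algebra)
    have "space ?noise \<inter> (\<Inter>k\<in>K. A (Suc k)) \<in> sets ?noise"
    proof (cases "K = {}")
      case False
      then have "(\<Inter>k\<in>K. A (Suc k)) \<in> sets ?noise" by (intro sets.finite_INT Am K(1))
      then show ?thesis by (intro sets.Int sets.top)
    next
      case True
      then show ?thesis using sets.top[of ?noise] by simp
    qed
    then show ?thesis by (simp add: N_def)
  qed
  show "prob (\<Inter>j\<in>J. A j) = (\<Prod>j\<in>J. prob (A j))"
  proof (cases "0 \<in> J")
    case False
    then have JK: "J = Suc ` K" by (auto simp: K_def image_iff) (metis not0_implies_Suc)
    then have "K \<noteq> {}" using J(1) by auto
    then have "N = (\<Inter>j\<in>J. A j)" using AK by (fastforce simp: N_def JK)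
    then show ?thesis using probN by (simp add: JK prod.reindex)
  next
    case True
    then have JK: "J = insert 0 (Suc ` K)" by (auto simp: K_def image_iff) (metis not0_implies_Suc)
    obtain E where E: "E \<in> sets borel" "A 0 = source_var u 0 -` E \<inter> space P" using A True by auto
    have "(\<lambda>x. (x, 0 :: real^'q)) -` E \<in> sets (borel :: (real^'d) measure)"
      by (rule measurable_sets_borel[OF _ E(1)]) (intro borel_measurable_Pair measurable_const measurable_ident; simp)
    then have m0: "X\<^sub>0 u -` ((\<lambda>x. (x, 0)) -` E) \<inter> space P \<in> sets (vimage_algebra (space P) (X\<^sub>0 u) borel)"
      by (rule in_vimage_algebra)
    have A0: "A 0 = X\<^sub>0 u -` ((\<lambda>x. (x, 0)) -` E) \<inter> space P"
      using E(2) by (auto simp: source_var_def)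
    from indep[OF u m0[folded A0] N] have "prob (A 0 \<inter> N) = prob (A 0) * prob N" .
    moreover have "A 0 \<inter> N = (\<Inter>j\<in>J. A j)" using A0 by (auto simp: N_def JK)
    ultimately show ?thesis using probN K(1) by (simp add: JK prod.reindex)
  qed
qed

text \<open>The scheme as a deterministic function of its sources. This shows that the path up to
  step \<open>n\<close> uses only the sources \<open>0, ..., n\<close> and is therefore independent
  of the next increment.\<close>

fun recursion :: "real \<Rightarrow> (nat \<Rightarrow> (real^'d) \<times> (real^'q)) \<Rightarrow> nat \<Rightarrow> real^'d" where
  "recursion u v 0 = fst (v 0)"
| "recursion u v (Suc k) = drift k (recursion u v k) + diffusion k u (recursion u v k) *v snd (v (Suc k))"

lemma recursion_eq:
  assumes u: "u \<in> {0..1}" and \<omega>: "\<omega> \<in> space P"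
  shows "k \<le> n \<Longrightarrow> k \<le> M \<Longrightarrow> recursion u (restrict (\<lambda>i. source_var u i \<omega>) {..n}) k = X u (\<tau> k) \<omega>"
proof (induction k)
  case 0 then show ?case using X_0[OF u \<omega>] by (simp add: source_var_def)
next
  case (Suc k) then show ?case using X_Suc[OF u \<omega>, of k] by (simp add: source_var_def)
qed

section \<open>Regularity and growth of the coefficients of one step\<close>

lemma drift_affine: "\<exists>l c. linear l \<and> (\<forall>x. drift k x = l x + c)"
proof -
  obtain l c where l: "linear l" "\<And>x. b (\<tau> k) x = l x + c" using affine[OF grid_nonneg[OF hT]] by blast
  let ?d = "\<tau> (Suc k) - \<tau> k"
  have "linear (\<lambda>x. x + ?d *\<^sub>R l x)"
    using l(1) by (intro linearI) (simp_all add: linear_add linear_scale algebra_simps)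
  moreover have "drift k x = (x + ?d *\<^sub>R l x) + ?d *\<^sub>R c" for x
    by (simp add: drift_def l(2) scaleR_add_right)
  ultimately show ?thesis by blast
qed

lemma drift_measurable [measurable]: "drift k \<in> borel_measurable borel"
proof -
  obtain l c where l: "linear l" "\<And>x. drift k x = l x + c" using drift_affine by blast
  have "continuous_on UNIV (\<lambda>x. l x + c)"
    using l(1) by (intro continuous_intros linear_continuous_on) (simp add: linear_conv_bounded_linear)
  then show ?thesis using l(2) by (simp add: borel_measurable_continuous_onI cong: measurable_cong)
qed

lemma drift_growth: "\<exists>c\<ge>0. \<forall>x. norm (drift k x) \<le> c * (1 + norm x)"
proof -
  obtain l c where l: "linear l" "\<And>x. drift k x = l x + c" using drift_affine by blast
  have bl: "bounded_linear l" using l(1) by (simp add: linear_conv_bounded_linear)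
  have "norm (drift k x) \<le> (onorm l + norm c) * (1 + norm x)" for x
  proof -
    have "norm (drift k x) \<le> norm (l x) + norm c" unfolding l(2) by (rule norm_triangle_ineq)
    also have "norm (l x) \<le> onorm l * norm x" by (rule onorm[OF bl])
    finally have "norm (drift k x) \<le> onorm l * norm x + norm c" by simp
    show ?thesis
    proof -
      have "(onorm l + norm c) * (1 + norm x) = onorm l + norm c + onorm l * norm x + norm c * norm x"
        by (simp add: algebra_simps)
      with \<open>norm (drift k x) \<le> onorm l * norm x + norm c\<close> show ?thesis
        using onorm_pos_le[OF bl] mult_nonneg_nonneg[OF norm_ge_zero[of c] norm_ge_zero[of x]] by linarith
    qed
  qed
  moreover have "0 \<le> onorm l + norm c" using onorm_pos_le[OF bl] by simp
  ultimately show ?thesis by blast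
qed

lemma diffusion_lipschitz:
  assumes "law k \<in> families" "u \<in> {0..1}"
  shows "onorm ((*v) (diffusion k u x - diffusion k u y)) \<le> L * norm (x - y)"
proof -
  interpret graphon_family G "law k" using G assms by unfold_locales
  show ?thesis unfolding diffusion_def
    using lipschitz[OF grid_nonneg[OF hT] graphon_mix_measures2 graphon_mix_measures2, OF assms(2,2), of k x y]
    by (simp add: WOP2_self)
qed

lemma diffusion_continuous:
  assumes "law k \<in> families" "u \<in> {0..1}"
  shows "continuous_on UNIV (diffusion k u)"
proof (rule lipschitz_on_continuous_on[where L="real CARD('d) * real CARD('q) * L"], rule lipschitz_onI)
  fix x y
  have "dist (diffusion k u x) (diffusion k u y) \<le> real CARD('d) * real CARD('q) * onorm ((*v) (diffusion k u x - diffusion k u y))"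
    unfolding dist_norm by (rule norm_matrix_le_onorm)
  also have "\<dots> \<le> real CARD('d) * real CARD('q) * (L * norm (x - y))"
    by (intro mult_left_mono diffusion_lipschitz assms) simp
  finally show "dist (diffusion k u x) (diffusion k u y) \<le> real CARD('d) * real CARD('q) * L * dist x y"
    by (simp add: dist_norm mult.assoc)
qed (use L in simp)

lemma diffusion_measurable:
  "law k \<in> families \<Longrightarrow> u \<in> {0..1} \<Longrightarrow> diffusion k u \<in> borel_measurable borel"
  by (intro borel_measurable_continuous_onI diffusion_continuous)

text \<open>The Lipschitz condition compares with the value at \<open>0\<close> and the family of
  point masses at \<open>0\<close>, which \<open>\<kappa>\<close> bounds. One constant for all
  labels is needed for the second moments after the step to stay uniformly bounded.\<close>

lemma diffusion_growth:
  assumes "law k \<in> families"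
  shows "\<exists>c\<ge>0. \<forall>u\<in>{0..1}. \<forall>x. onorm ((*v) (diffusion k u x)) \<le> c * (1 + norm x)"
proof -
  interpret graphon_family G "law k" using G assms by unfold_locales
  interpret R: graphon_family G "\<lambda>_. return borel 0" using G families_return by unfold_locales
  obtain K where K: "\<And>u. u \<in> {0..1} \<Longrightarrow> WOP2 x\<^sub>0 (graphon_mix G (law k) u) (graphon_mix G (\<lambda>_. return borel 0) u) \<le> K"
    using WOP2_graphon_mix_bounded[OF G assms families_return] by blast
  let ?c = "max 0 \<kappa> + L * max 0 K + L"
  have "onorm ((*v) (diffusion k u x)) \<le> ?c * (1 + norm x)" if u: "u \<in> {0..1}" for u x
  proof -
    let ?A = "S (\<tau> k) 0 (graphon_mix G (\<lambda>_. return borel 0) u)"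
    have "(*v) (diffusion k u x) = (\<lambda>z. (diffusion k u x - ?A) *v z + ?A *v z)"
      by (simp add: fun_eq_iff matrix_vector_mult_diff_rdistrib)
    then have "onorm ((*v) (diffusion k u x)) \<le> onorm ((*v) (diffusion k u x - ?A)) + onorm ((*v) ?A)"
      using onorm_triangle[OF matrix_vector_mul_bounded_linear matrix_vector_mul_bounded_linear, of "diffusion k u x - ?A" ?A] by simp
    also have "onorm ((*v) (diffusion k u x - ?A)) \<le> L * (norm (x - 0) + WOP2 x\<^sub>0 (graphon_mix G (law k) u) (graphon_mix G (\<lambda>_. return borel 0) u))"
      unfolding diffusion_def
      by (intro lipschitz grid_nonneg hT graphon_mix_measures2 R.graphon_mix_measures2 u)
    also have "\<dots> \<le> L * (norm x + max 0 K)" using K[OF u] L by (intro mult_left_mono) auto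
    also have "onorm ((*v) ?A) \<le> max 0 \<kappa>" using \<kappa>[OF grid_nonneg[OF hT] u, of k] by simp
    finally have "onorm ((*v) (diffusion k u x)) \<le> L * (norm x + max 0 K) + max 0 \<kappa>" by simp
    also have "\<dots> \<le> ?c * (1 + norm x)"
    proof -
      have "0 \<le> max 0 \<kappa> * norm x" "0 \<le> L * max 0 K * norm x" using L by auto
      then show ?thesis using L by (simp add: algebra_simps)
    qed
    finally show ?thesis .
  qed
  moreover have "0 \<le> ?c" using L by simp
  ultimately show ?thesis by blast
qed

lemma growth:
  assumes "law k \<in> families"
  obtains c where "0 \<le> c" "\<And>x. norm (drift k x) \<le> c * (1 + norm x)"
    "\<And>u x. u \<in> {0..1} \<Longrightarrow> onorm ((*v) (diffusion k u x)) \<le> c * (1 + norm x)"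
proof -
  obtain c1 where c1: "c1 \<ge> 0" "\<And>x. norm (drift k x) \<le> c1 * (1 + norm x)" using drift_growth by blast
  obtain c2 where c2: "c2 \<ge> 0" "\<And>u x. u \<in> {0..1} \<Longrightarrow> onorm ((*v) (diffusion k u x)) \<le> c2 * (1 + norm x)"
    using diffusion_growth[OF assms] by blast
  have le: "c1 * (1 + norm x) \<le> (c1 + c2) * (1 + norm x)" "c2 * (1 + norm x) \<le> (c1 + c2) * (1 + norm x)" for x :: "real^'d"
    using c1(1) c2(1) by (auto intro!: mult_right_mono)
  show thesis
    by (rule that[of "c1 + c2"]) (use c1 c2 order_trans[OF c1(2) le(1)] order_trans[OF c2(2) le(2)] in auto)
qed

text \<open>Path and increment are functions of disjoint blocks of independent sources. The laws of
  the earlier steps are assumed to be measurable families here because this lemma feeds the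
  induction that establishes it.\<close>

lemma path_increment_independent:
  assumes u: "u \<in> {0..1}" and n: "n < M" and fam: "\<And>k. k < n \<Longrightarrow> law k \<in> families"
  shows "path n u \<in> P \<rightarrow>\<^sub>M paths"
    and "distr P (paths \<Otimes>\<^sub>M borel) (\<lambda>\<omega>. (path n u \<omega>, increment u n \<omega>)) = distr P paths (path n u) \<Otimes>\<^sub>M distr P borel (increment u n)"
proof -
  let ?V = "\<lambda>\<omega>. restrict (\<lambda>i. source_var u i \<omega>) {..n}" and ?W = "\<lambda>\<omega>. restrict (\<lambda>i. source_var u i \<omega>) {Suc n}"
  let ?MA = "PiM {..n} (\<lambda>_. borel :: ((real^'d) \<times> (real^'q)) measure)"
  let ?MB = "PiM {Suc n} (\<lambda>_. borel :: ((real^'d) \<times> (real^'q)) measure)"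
  have Vm: "?V \<in> P \<rightarrow>\<^sub>M ?MA" and Wm: "?W \<in> P \<rightarrow>\<^sub>M ?MB"
    by (intro measurable_restrict source_var_measurable u)+
  have snd_m: "(snd :: (real^'d) \<times> (real^'q) \<Rightarrow> _) \<in> borel_measurable borel"
    and fst_m: "(fst :: (real^'d) \<times> (real^'q) \<Rightarrow> _) \<in> borel_measurable borel"
    by (auto intro!: borel_measurable_continuous_onI continuous_intros)
  have comp: "(\<lambda>v. v j) \<in> ?MA \<rightarrow>\<^sub>M borel" if "j \<le> n" for j
    by (rule measurable_component_singleton) (use that in simp)
  have rec: "(\<lambda>v. recursion u v k) \<in> ?MA \<rightarrow>\<^sub>M borel" if "k \<le> n" for k
    using that
  proof (induction k)
    case 0
    then show ?case unfolding recursion.simps by (rule measurable_compose[OF comp fst_m])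
  next
    case (Suc k)
    then have IH: "(\<lambda>v. recursion u v k) \<in> ?MA \<rightarrow>\<^sub>M borel" by simp
    have D: "diffusion k u \<in> borel_measurable borel" using Suc.prems by (intro diffusion_measurable fam u) simp
    show ?case unfolding recursion.simps
      using Suc.prems
      by (intro borel_measurable_add borel_measurable_matrix_vector_mult measurable_compose[OF IH drift_measurable]
          measurable_compose[OF IH D] measurable_compose[OF comp snd_m])
  qed
  have g: "(\<lambda>v i. recursion u v (min i n)) \<in> ?MA \<rightarrow>\<^sub>M paths"
    by (rule measurable_PiM_single') (auto intro!: rec simp: PiE_def)
  have k: "(\<lambda>w. snd (w (Suc n))) \<in> ?MB \<rightarrow>\<^sub>M borel"
    by (rule measurable_compose[OF _ snd_m]) (rule measurable_component_singleton, simp)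
  have gV: "(\<lambda>i. recursion u (?V \<omega>) (min i n)) = path n u \<omega>" if "\<omega> \<in> space P" for \<omega>
    using n by (simp add: path_def recursion_eq[OF u that])
  have kW: "snd (?W \<omega> (Suc n)) = increment u n \<omega>" for \<omega> by (simp add: source_var_def)
  show "path n u \<in> P \<rightarrow>\<^sub>M paths"
    using measurable_compose[OF Vm g] by (rule measurable_cong[THEN iffD1, rotated]) (rule gV)
  have "indep_var ?MA ?V ?MB ?W"
    by (rule indep_var_restrict[OF indep_source_vars[OF u, of "Suc n"]]) auto
  then have "distr P (?MA \<Otimes>\<^sub>M ?MB) (\<lambda>\<omega>. (?V \<omega>, ?W \<omega>)) = distr P ?MA ?V \<Otimes>\<^sub>M distr P ?MB ?W"
    by (simp only: indep_var_distribution_eq)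
  from distr_pair_comp[OF P Vm Wm this g k]
  have "distr P (paths \<Otimes>\<^sub>M borel) (\<lambda>\<omega>. ((\<lambda>i. recursion u (?V \<omega>) (min i n)), increment u n \<omega>))
      = distr P paths (\<lambda>\<omega>. (\<lambda>i. recursion u (?V \<omega>) (min i n))) \<Otimes>\<^sub>M distr P borel (increment u n)"
    unfolding kW .
  moreover have "distr P (paths \<Otimes>\<^sub>M borel) (\<lambda>\<omega>. ((\<lambda>i. recursion u (?V \<omega>) (min i n)), increment u n \<omega>))
      = distr P (paths \<Otimes>\<^sub>M borel) (\<lambda>\<omega>. (path n u \<omega>, increment u n \<omega>))"
    by (rule distr_cong) (simp_all only: gV)
  moreover have "distr P paths (\<lambda>\<omega>. (\<lambda>i. recursion u (?V \<omega>) (min i n))) = distr P paths (path n u)"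
    by (rule distr_cong) (simp_all only: gV)
  ultimately show "distr P (paths \<Otimes>\<^sub>M borel) (\<lambda>\<omega>. (path n u \<omega>, increment u n \<omega>)) = distr P paths (path n u) \<Otimes>\<^sub>M distr P borel (increment u n)"
    by simp
qed

lemma X_measurable:
  assumes u: "u \<in> {0..1}"
  shows "k \<le> M \<Longrightarrow> (\<And>j. j < k \<Longrightarrow> law j \<in> families) \<Longrightarrow> X u (\<tau> k) \<in> borel_measurable P"
proof (induction k)
  case 0
  show ?case by (rule measurable_cong[THEN iffD2, OF X_0[OF u] X\<^sub>0m[OF u]])
next
  case (Suc k)
  then have X: "X u (\<tau> k) \<in> borel_measurable P" and k: "k < M" and fam: "law k \<in> families" by auto
  have "(\<lambda>\<omega>. drift k (X u (\<tau> k) \<omega>) + diffusion k u (X u (\<tau> k) \<omega>) *v increment u k \<omega>) \<in> borel_measurable P"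
    by (intro borel_measurable_add borel_measurable_matrix_vector_mult measurable_compose[OF X drift_measurable]
        measurable_compose[OF X diffusion_measurable[OF fam u]] increment_measurable u)
  then show ?case by (rule measurable_cong[THEN iffD2, rotated]) (rule X_Suc[OF u _ k])
qed

lemma law_Suc:
  assumes u: "u \<in> {0..1}" and k: "k < M" and fam: "\<And>j. j \<le> k \<Longrightarrow> law j \<in> families"
  shows "law (Suc k) u = distr (law k u \<Otimes>\<^sub>M gauss (sd k)) borel (\<lambda>p. drift k (fst p) + diffusion k u (fst p) *v snd p)"
proof -
  have fam': "\<And>j. j < k \<Longrightarrow> law j \<in> families" using fam by simp
  note pm = path_increment_independent[OF u k fam']
  have Xm: "X u (\<tau> k) \<in> borel_measurable P" using k fam by (intro X_measurable[OF u]) auto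
  have Dm: "diffusion k u \<in> borel_measurable borel" by (intro diffusion_measurable fam u) simp
  have comp: "(\<lambda>x. x k) \<in> paths \<rightarrow>\<^sub>M (borel :: (real^'d) measure)" by (rule measurable_component_singleton) simp
  have id: "(\<lambda>x. x) \<in> borel \<rightarrow>\<^sub>M (borel :: (real^'q) measure)" by simp
  have pk: "path k u \<omega> k = X u (\<tau> k) \<omega>" for \<omega> by (simp add: path_def)
  have pair: "distr P (borel \<Otimes>\<^sub>M borel) (\<lambda>\<omega>. (X u (\<tau> k) \<omega>, increment u k \<omega>)) = law k u \<Otimes>\<^sub>M gauss (sd k)"
    using distr_pair_comp[OF P pm(1) increment_measurable[OF u] pm(2) comp id]
    by (simp add: pk law_def increment_law[OF u k])
  have \<Phi>: "(\<lambda>p. drift k (fst p) + diffusion k u (fst p) *v snd p) \<in> borel \<Otimes>\<^sub>M borel \<rightarrow>\<^sub>M borel"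
    by (intro borel_measurable_add borel_measurable_matrix_vector_mult measurable_compose[OF measurable_fst drift_measurable]
        measurable_compose[OF measurable_fst Dm] measurable_snd)
  have "law (Suc k) u = distr P borel (\<lambda>\<omega>. drift k (X u (\<tau> k) \<omega>) + diffusion k u (X u (\<tau> k) \<omega>) *v increment u k \<omega>)"
    unfolding law_def by (rule distr_cong) (simp_all add: X_Suc[OF u _ k])
  also have "\<dots> = distr (distr P (borel \<Otimes>\<^sub>M borel) (\<lambda>\<omega>. (X u (\<tau> k) \<omega>, increment u k \<omega>))) borel
      (\<lambda>p. drift k (fst p) + diffusion k u (fst p) *v snd p)"
    by (subst distr_distr[OF \<Phi> measurable_Pair[OF Xm increment_measurable[OF u]]]) (simp add: o_def)
  finally show ?thesis by (simp add: pair)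
qed

text \<open>A Caratheodory function: measurable in the label because \<open>S\<close> is Lipschitz
  for \<open>WOP2\<close>, and continuous in the position.\<close>

lemma diffusion_jointly_measurable:
  assumes fam: "law k \<in> families"
  shows "(\<lambda>p. diffusion k (fst p) (snd p)) \<in> borel_measurable (unit_leb \<Otimes>\<^sub>M borel)"
proof (rule caratheodory_measurable[where f="diffusion k"])
  interpret graphon_family G "law k" using G fam by unfold_locales
  fix x
  have "(\<lambda>u. S (\<tau> k) x (graphon_mix G (law k) u)) \<in> borel_measurable unit_borel"
  proof (rule graphon_mix_lipschitz_measurable)
    fix \<alpha> \<beta> :: "(real^'d) measure" assume ab: "\<alpha> \<in> measures2" "\<beta> \<in> measures2"
    have "dist (S (\<tau> k) x \<alpha>) (S (\<tau> k) x \<beta>) \<le> real CARD('d) * real CARD('q) * onorm ((*v) (S (\<tau> k) x \<alpha> - S (\<tau> k) x \<beta>))"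
      unfolding dist_norm by (rule norm_matrix_le_onorm)
    also have "\<dots> \<le> real CARD('d) * real CARD('q) * (L * WOP2 x\<^sub>0 \<alpha> \<beta>)"
      using lipschitz[OF grid_nonneg[OF hT] ab, of k x x] by (intro mult_left_mono) auto
    finally show "dist (S (\<tau> k) x \<alpha>) (S (\<tau> k) x \<beta>) \<le> (real CARD('d) * real CARD('q) * L) * WOP2 x\<^sub>0 \<alpha> \<beta>"
      by (simp add: mult.assoc)
  qed
  then show "(\<lambda>u. diffusion k u x) \<in> borel_measurable unit_leb"
    by (simp add: diffusion_def measurable_cong_sets[OF sets_unit_leb refl])
next
  fix u assume "u \<in> space unit_leb"
  then show "continuous_on UNIV (diffusion k u)"
    by (intro diffusion_continuous fam) (simp add: space_restrict_space)
qed

text \<open>Strong induction, since the formula for the next law needs all earlier laws to be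
  families. Measurability in the label follows by composing kernels, and the uniform moment bound
  from the linear growth of the coefficients.\<close>

lemma law_families: "k \<le> M \<Longrightarrow> law k \<in> families"
proof (induction k rule: less_induct)
  case (less k)
  show ?case
  proof (cases k)
    case 0
    have l0: "law 0 u = distr P borel (X\<^sub>0 u)" if "u \<in> {0..1}" for u
      unfolding law_def by (rule distr_cong) (simp_all add: X_0[OF that])
    obtain C where "\<And>v. v \<in> {0..1} \<Longrightarrow> moment2 (distr P borel (X\<^sub>0 v)) \<le> ennreal C"
      using families_bound[OF X\<^sub>0_law] by blast
    moreover have "law 0 \<in> unit_leb \<rightarrow>\<^sub>M prob_algebra borel"
      using families_measurable_kernel[OF X\<^sub>0_law]
      by (rule measurable_cong[THEN iffD2, rotated]) (simp add: l0 space_restrict_space)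
    ultimately show ?thesis unfolding 0 by (intro familiesI[where B=C]) (simp_all add: l0)
  next
    case (Suc n)
    then have n: "n < M" and fam: "\<And>j. j \<le> n \<Longrightarrow> law j \<in> families" using less by auto
    have famn: "law n \<in> families" by (rule fam) simp
    interpret \<gamma>: prob_space "gauss (sd n) :: (real^'q) measure" by (rule prob_space_gauss[OF sd_pos[OF n]])
    have kn: "law n \<in> unit_leb \<rightarrow>\<^sub>M prob_algebra borel" by (rule families_measurable_kernel[OF famn])
    let ?\<Phi> = "\<lambda>u p. drift n (fst p) + diffusion n u (fst p) *v (snd p :: real^'q)"
    have \<Phi>: "(\<lambda>(u, p). ?\<Phi> u p) \<in> unit_leb \<Otimes>\<^sub>M (borel \<Otimes>\<^sub>M borel) \<rightarrow>\<^sub>M borel"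
    proof -
      have m1: "(\<lambda>w. fst (snd w)) \<in> unit_leb \<Otimes>\<^sub>M (borel \<Otimes>\<^sub>M borel) \<rightarrow>\<^sub>M (borel :: (real^'d) measure)"
        and m2: "(\<lambda>w. snd (snd w)) \<in> unit_leb \<Otimes>\<^sub>M (borel \<Otimes>\<^sub>M borel) \<rightarrow>\<^sub>M (borel :: (real^'q) measure)"
        by measurable
      have m3: "(\<lambda>w. (fst w, fst (snd w))) \<in> unit_leb \<Otimes>\<^sub>M (borel \<Otimes>\<^sub>M borel :: ((real^'d) \<times> (real^'q)) measure) \<rightarrow>\<^sub>M unit_leb \<Otimes>\<^sub>M borel"
        by measurable
      have "(\<lambda>w. ?\<Phi> (fst w) (snd w)) \<in> unit_leb \<Otimes>\<^sub>M (borel \<Otimes>\<^sub>M borel) \<rightarrow>\<^sub>M borel"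
        using measurable_compose[OF m3 diffusion_jointly_measurable[OF famn]]
        by (intro borel_measurable_add borel_measurable_matrix_vector_mult measurable_compose[OF m1 drift_measurable] m2) simp
      then show ?thesis by (simp add: split_beta')
    qed
    have "(\<lambda>u. distr (law n u \<Otimes>\<^sub>M gauss (sd n)) borel (?\<Phi> u)) \<in> unit_leb \<rightarrow>\<^sub>M prob_algebra borel"
    proof (rule measurable_distr_prob_space2[OF _ \<Phi>])
      have "(\<lambda>u. gauss (sd n) :: (real^'q) measure) \<in> unit_leb \<rightarrow>\<^sub>M prob_algebra borel"
        by (rule measurable_const) (simp add: space_prob_algebra \<gamma>.prob_space_axioms)
      from measurable_pair_prob[OF kn this]
      show "(\<lambda>u. law n u \<Otimes>\<^sub>M gauss (sd n)) \<in> unit_leb \<rightarrow>\<^sub>M prob_algebra (borel \<Otimes>\<^sub>M (borel :: (real^'q) measure))" .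
    qed
    then have kS: "law (Suc n) \<in> unit_leb \<rightarrow>\<^sub>M prob_algebra borel"
      by (rule measurable_cong[THEN iffD2, rotated]) (simp add: law_Suc[OF _ n fam] space_restrict_space)
    obtain c where c: "0 \<le> c" "\<And>x. norm (drift n x) \<le> c * (1 + norm x)"
        "\<And>u x. u \<in> {0..1} \<Longrightarrow> onorm ((*v) (diffusion n u x)) \<le> c * (1 + norm x)"
      using growth[OF famn] by blast
    obtain C where C: "0 \<le> C" "\<And>v. v \<in> {0..1} \<Longrightarrow> moment2 (law n v) \<le> ennreal C"
      using families_bound[OF famn] by blast
    define g where "g = enn2real (moment2 (gauss (sd n) :: (real^'q) measure))"
    have g: "moment2 (gauss (sd n) :: (real^'q) measure) = ennreal g" "0 \<le> g"
      unfolding g_def using gauss_second_moment[OF sd_pos[OF n], where 'q='q] by simp_all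
    have "moment2 (law (Suc n) u) \<le> ennreal (4 * c\<^sup>2 * (1 + C) * (1 + g))" if u: "u \<in> {0..1}" for u
    proof -
      have "law n u \<in> space (prob_algebra borel)"
        using measurable_space[OF kn] u by (simp add: space_restrict_space)
      then have "prob_space (law n u)" and sl [measurable_cong]: "sets (law n u) = sets borel"
        by (auto simp: space_prob_algebra)
      then interpret l: prob_space "law n u" by simp
      have \<Phi>u: "?\<Phi> u \<in> law n u \<Otimes>\<^sub>M gauss (sd n) \<rightarrow>\<^sub>M borel"
      proof -
        have sp: "sets (law n u \<Otimes>\<^sub>M gauss (sd n)) = sets (borel \<Otimes>\<^sub>M (borel :: (real^'q) measure))"
          by (intro sets_pair_measure_cong sl) simp
        show ?thesis unfolding measurable_cong_sets[OF sp refl]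
          by (intro borel_measurable_add borel_measurable_matrix_vector_mult measurable_compose[OF measurable_fst drift_measurable]
              measurable_compose[OF measurable_fst diffusion_measurable[OF famn u]] measurable_snd)
      qed
      have "moment2 (law (Suc n) u) = (\<integral>\<^sup>+p. ennreal ((norm (?\<Phi> u p))\<^sup>2) \<partial>(law n u \<Otimes>\<^sub>M gauss (sd n)))"
        by (subst law_Suc[OF u n]) (use \<Phi>u fam in \<open>simp_all add: nn_integral_distr\<close>)
      also have "\<dots> \<le> (\<integral>\<^sup>+p. ennreal (4 * c\<^sup>2) * ((1 + ennreal ((norm (fst p))\<^sup>2)) * (1 + ennreal ((norm (snd p))\<^sup>2))) \<partial>(law n u \<Otimes>\<^sub>M (gauss (sd n) :: (real^'q) measure)))"
      proof (rule nn_integral_mono)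
        fix p :: "(real^'d) \<times> (real^'q)"
        have "(norm (?\<Phi> u p))\<^sup>2 \<le> 4 * c\<^sup>2 * (1 + (norm (fst p))\<^sup>2) * (1 + (norm (snd p))\<^sup>2)"
          by (rule euler_increment_bound[OF c(2) c(3)[OF u]]) simp
        from ennreal_leI[OF this]
        show "ennreal ((norm (?\<Phi> u p))\<^sup>2) \<le> ennreal (4 * c\<^sup>2) * ((1 + ennreal ((norm (fst p))\<^sup>2)) * (1 + ennreal ((norm (snd p))\<^sup>2)))"
          by (simp add: ennreal_mult' mult.assoc)
      qed
      also have "\<dots> = (\<integral>\<^sup>+x. (\<integral>\<^sup>+z. ennreal (4 * c\<^sup>2) * ((1 + ennreal ((norm x)\<^sup>2)) * (1 + ennreal ((norm z)\<^sup>2))) \<partial>(gauss (sd n) :: (real^'q) measure)) \<partial>law n u)"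
        by (subst \<gamma>.nn_integral_fst[symmetric]) simp_all
      also have "\<dots> = (\<integral>\<^sup>+x. ennreal (4 * c\<^sup>2) * ((1 + ennreal ((norm x)\<^sup>2)) * (1 + ennreal g)) \<partial>law n u)"
        using \<gamma>.emeasure_space_1 by (simp add: nn_integral_cmult nn_integral_add g(1))
      also have "\<dots> = ennreal (4 * c\<^sup>2) * ((1 + (\<integral>\<^sup>+x. ennreal ((norm x)\<^sup>2) \<partial>law n u)) * (1 + ennreal g))"
        by (simp add: nn_integral_cmult nn_integral_multc nn_integral_add l.emeasure_space_1)
      also have "\<dots> \<le> ennreal (4 * c\<^sup>2) * ((1 + ennreal C) * (1 + ennreal g))"
        by (intro mult_left_mono mult_right_mono add_left_mono C(2) u) auto
      also have "\<dots> = ennreal (4 * c\<^sup>2 * (1 + C) * (1 + g))"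
        using C(1) g(2) by (simp add: ennreal_mult mult.assoc)
      finally show ?thesis .
    qed
    then show ?thesis unfolding Suc by (rule familiesI[OF kS])
  qed
qed

lemma path_measurable:
  assumes "u \<in> {0..1}" "n \<le> M" shows "path n u \<in> P \<rightarrow>\<^sub>M paths"
  unfolding path_def[abs_def] using assms law_families
  by (intro measurable_PiM_single' X_measurable) (auto simp: PiE_def)

lemma X_square_integrable:
  assumes u: "u \<in> {0..1}" and k: "k \<le> M"
  shows "integrable P (\<lambda>\<omega>. (norm (X u (\<tau> k) \<omega>))\<^sup>2)"
proof -
  have Xm [measurable]: "X u (\<tau> k) \<in> borel_measurable P" using u k by (intro X_measurable law_families) auto
  have "law k u \<in> prob2" using law_families[OF k] u by (simp add: families_def)
  then have "moment2 (law k u) < \<infinity>" by (simp add: prob2_def measures2_def)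
  then have "(\<integral>\<^sup>+\<omega>. ennreal ((norm (X u (\<tau> k) \<omega>))\<^sup>2) \<partial>P) < \<infinity>"
    unfolding law_def by (subst (asm) nn_integral_distr) simp_all
  then show ?thesis by (intro integrableI_bounded) auto
qed

lemma path_class_integrable:
  assumes f: "path_class (Suc n) f" and u: "u \<in> {0..1}" and n: "n \<le> M"
  shows "integrable P (\<lambda>\<omega>. f (path n u \<omega>))"
proof -
  obtain C where C: "0 \<le> C" "\<And>x. \<bar>f x\<bar> \<le> C * (1 + (\<Sum>i<Suc n. (norm (x i))\<^sup>2))"
    using path_class_bound[OF f] by blast
  show ?thesis
  proof (rule Bochner_Integration.integrable_bound)
    show "integrable P (\<lambda>\<omega>. C * (1 + (\<Sum>i<Suc n. (norm (path n u \<omega> i))\<^sup>2)))"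
      unfolding path_def using n by (intro integrable_mult_right Bochner_Integration.integrable_add
        Bochner_Integration.integrable_sum X_square_integrable u) auto
    show "(\<lambda>\<omega>. f (path n u \<omega>)) \<in> borel_measurable P"
      by (rule measurable_compose[OF path_measurable[OF u n] path_class_measurable[OF f]])
    show "AE \<omega> in P. norm (f (path n u \<omega>)) \<le> norm (C * (1 + (\<Sum>i<Suc n. (norm (path n u \<omega> i))\<^sup>2)))"
      by (intro AE_I2) (simp only: real_norm_def, rule order_trans[OF C(2) abs_ge_self])
  qed
qed

lemma integral_path_Suc:
  assumes f: "path_class (Suc (Suc n)) f" and u: "u \<in> {0..1}" and n: "n < M"
  shows "(\<integral>\<omega>. f (path (Suc n) u \<omega>) \<partial>P) = (\<integral>\<omega>. euler_step n (drift n) (diffusion n u) (sd n) f (path n u \<omega>) \<partial>P)"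
    and "integrable P (\<lambda>\<omega>. euler_step n (drift n) (diffusion n u) (sd n) f (path n u \<omega>))"
proof -
  have fam: "law j \<in> families" if "j \<le> n" for j using that n by (intro law_families) simp
  obtain c where c: "0 \<le> c" "\<And>x. norm (drift n x) \<le> c * (1 + norm x)"
      "\<And>u x. u \<in> {0..1} \<Longrightarrow> onorm ((*v) (diffusion n u x)) \<le> c * (1 + norm x)"
    using growth[OF fam] by blast
  have pn: "path n u \<omega> n = X u (\<tau> n) \<omega>" for \<omega> by (simp add: path_def)
  have eq: "X u (\<tau> (Suc n)) \<omega> = drift n (path n u \<omega> n) + diffusion n u (path n u \<omega> n) *v increment u n \<omega>"
    if "\<omega> \<in> space P" for \<omega>
    unfolding pn by (rule X_Suc[OF u that n])
  have sq: "integrable P (\<lambda>\<omega>. (norm (drift n (path n u \<omega> n) + diffusion n u (path n u \<omega> n) *v increment u n \<omega>))\<^sup>2)"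
    using X_square_integrable[OF u, of "Suc n"] n
    by (subst Bochner_Integration.integrable_cong[OF refl, where g="\<lambda>\<omega>. (norm (X u (\<tau> (Suc n)) \<omega>))\<^sup>2"]) (auto simp: eq)
  note step = integral_euler_step[where a="drift n" and S="diffusion n u" and c=c, OF sd_pos[OF n] f c(2) c(3)[OF u] P
      path_measurable[OF u less_imp_le[OF n]] increment_law[OF u n] increment_measurable[OF u]
      path_increment_independent(2)[OF u n] drift_measurable diffusion_measurable[OF fam[OF order_refl] u] _ sq]
  have sqi: "integrable P (\<lambda>\<omega>. (norm (path n u \<omega> i))\<^sup>2)" for i
    unfolding path_def using n by (intro X_square_integrable u) auto
  \<comment> \<open>The two sequences differ beyond index \<open>Suc n\<close>, where they are
    frozen at different positions, but \<open>f\<close> does not see those coordinates.\<close>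
  have fp: "f (path (Suc n) u \<omega>) = f ((path n u \<omega>)(Suc n := drift n (path n u \<omega> n) + diffusion n u (path n u \<omega> n) *v increment u n \<omega>))"
    if "\<omega> \<in> space P" for \<omega>
  proof -
    have "depends_below (Suc (Suc n)) f" using f by (simp add: path_class_def)
    moreover have "path (Suc n) u \<omega> i = ((path n u \<omega>)(Suc n := drift n (path n u \<omega> n) + diffusion n u (path n u \<omega> n) *v increment u n \<omega>)) i"
      if "i < Suc (Suc n)" for i
      using that eq[OF \<open>\<omega> \<in> space P\<close>] by (cases "i = Suc n") (auto simp: path_def min_def)
    ultimately show ?thesis unfolding depends_below_def by blast
  qed
  have "(\<integral>\<omega>. f (path (Suc n) u \<omega>) \<partial>P)
      = (\<integral>\<omega>. f ((path n u \<omega>)(Suc n := drift n (path n u \<omega> n) + diffusion n u (path n u \<omega> n) *v increment u n \<omega>)) \<partial>P)"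
    by (rule Bochner_Integration.integral_cong[OF refl fp])
  then show "(\<integral>\<omega>. f (path (Suc n) u \<omega>) \<partial>P) = (\<integral>\<omega>. euler_step n (drift n) (diffusion n u) (sd n) f (path n u \<omega>) \<partial>P)"
    using step(1) fam sqi by simp
  show "integrable P (\<lambda>\<omega>. euler_step n (drift n) (diffusion n u) (sd n) f (path n u \<omega>))"
    using step(2) fam sqi by simp
qed

end


subsection \<open>Propagation of the convex order\<close>

lemma mat_le_trans:
  assumes "A \<preceq>\<^sub>m B" "B \<preceq>\<^sub>m C" shows "A \<preceq>\<^sub>m (C :: real^'q^'d)"
proof -
  let ?U = "B ** transpose B - A ** transpose A" and ?V = "C ** transpose C - B ** transpose B"
  have eq: "C ** transpose C - A ** transpose A = ?U + ?V" by simp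
  have t: "transpose (?U + ?V) = transpose ?U + transpose ?V"
    by (simp add: transpose_def vec_eq_iff)
  show ?thesis
    using assms unfolding mat_le_def pos_semidef_def eq t
    by (auto simp only: matrix_vector_mult_add_rdistrib inner_add_right intro!: add_nonneg_nonneg)
qed

text \<open>These test functions extract the order of the marginal laws at step \<open>n\<close>
  from the order of the paths.\<close>

lemma path_class_coordinate:
  assumes \<phi>: "convex_on UNIV \<phi>" and bd: "\<And>y. \<bar>\<phi> y\<bar> \<le> C * (1 + (norm y)\<^sup>2)"
  shows "path_class (Suc n) (\<lambda>x. \<phi> (x n))"
  unfolding path_class_def
proof (intro conjI exI[of _ C] allI)
  show "convex_path_functional (\<lambda>x. \<phi> (x n))"
    unfolding convex_path_functional_def
  proof (intro allI ballI)
    fix x y :: "nat \<Rightarrow> real^'a" and r :: real assume "r \<in> {0..1}"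
    then show "\<phi> (r *\<^sub>R x n + (1 - r) *\<^sub>R y n) \<le> r * \<phi> (x n) + (1 - r) * \<phi> (y n)"
      using \<phi> by (simp add: convex_on_def)
  qed
  show "depends_below (Suc n) (\<lambda>x. \<phi> (x n))" by (simp add: depends_below_def)
  fix x :: "nat \<Rightarrow> real^'a"
  have C: "0 \<le> C" using bd[of 0] by simp
  have "(norm (x n))\<^sup>2 \<le> (\<Sum>i<Suc n. (norm (x i))\<^sup>2)" by (rule member_le_sum) auto
  then show "\<bar>\<phi> (x n)\<bar> \<le> C * (1 + (\<Sum>i<Suc n. (norm (x i))\<^sup>2))"
    using order_trans[OF bd[of "x n"] mult_left_mono[OF _ C]] by simp
qed

text \<open>On a path frozen from \<open>M\<close> on, every term of the growth series is at most
  \<open>r ^ m * h\<close> times the finite sum of squares, with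
  \<open>r = exp (- l * h) < 1\<close>. The geometric series yields the constant
  \<open>D\<close>.\<close>

lemma path_class_stopped:
  assumes F: "convex_path_functional F" "quadratic_growth l h F" and l: "0 < l" and h: "0 < h"
  shows "path_class (Suc M) (\<lambda>x. F (\<lambda>i. x (min i M)))"
proof -
  obtain C where C: "0 < C" "\<And>x. ennreal \<bar>F x\<bar> \<le> ennreal C *
      (1 + (\<Sum>m. ennreal (exp (- l * (real m * h)) * (((norm (x m))\<^sup>2 + (norm (x (Suc m)))\<^sup>2) / 2) * h)))"
    using F(2) unfolding quadratic_growth_def by blast
  define r where "r = exp (- l * h)"
  have r: "0 < r" "r < 1" using l h by (simp_all add: r_def)
  define D where "D = h / (1 - r)"
  have D: "0 < D" using r h by (simp add: D_def)
  have bd: "\<bar>F (\<lambda>i. x (min i M))\<bar> \<le> (C * (1 + D)) * (1 + (\<Sum>i<Suc M. (norm (x i))\<^sup>2))" for x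
  proof -
    define s where "s = (\<Sum>i<Suc M. (norm (x i))\<^sup>2)"
    have s: "0 \<le> s" by (simp add: s_def sum_nonneg)
    have xs: "(norm (x (min i M)))\<^sup>2 \<le> s" for i unfolding s_def by (rule member_le_sum) auto
    have "(\<Sum>m. ennreal (exp (- l * (real m * h)) * (((norm (x (min m M)))\<^sup>2 + (norm (x (min (Suc m) M)))\<^sup>2) / 2) * h))
        \<le> (\<Sum>m. ennreal (r ^ m * (s * h)))"
    proof (intro suminf_le ennreal_leI summableI)
      fix m
      have e: "exp (- l * (real m * h)) = r ^ m"
        unfolding r_def exp_of_nat_mult[symmetric] by (simp add: mult_ac)
      have "((norm (x (min m M)))\<^sup>2 + (norm (x (min (Suc m) M)))\<^sup>2) / 2 \<le> s" using xs[of m] xs[of "Suc m"] by simp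
      then have "r ^ m * (((norm (x (min m M)))\<^sup>2 + (norm (x (min (Suc m) M)))\<^sup>2) / 2) * h \<le> r ^ m * s * h"
        using r h by (intro mult_right_mono mult_left_mono) auto
      then show "exp (- l * (real m * h)) * (((norm (x (min m M)))\<^sup>2 + (norm (x (min (Suc m) M)))\<^sup>2) / 2) * h \<le> r ^ m * (s * h)"
        unfolding e by (simp add: mult.assoc)
    qed
    also have "\<dots> = ennreal (\<Sum>m. r ^ m * (s * h))"
      using r s h by (intro suminf_ennreal2) (auto intro!: summable_mult2 summable_geometric)
    also have "(\<Sum>m. r ^ m * (s * h)) = D * s"
      using r by (subst suminf_mult2[symmetric]) (auto simp: suminf_geometric summable_geometric D_def)
    finally have "1 + (\<Sum>m. ennreal (exp (- l * (real m * h)) * (((norm (x (min m M)))\<^sup>2 + (norm (x (min (Suc m) M)))\<^sup>2) / 2) * h))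
        \<le> ennreal 1 + ennreal (D * s)" by (intro add_mono) auto
    also have "\<dots> = ennreal (1 + D * s)" using D s by (subst ennreal_plus[symmetric]) auto
    finally have "ennreal \<bar>F (\<lambda>i. x (min i M))\<bar> \<le> ennreal C * ennreal (1 + D * s)"
      using order_trans[OF C(2)[of "\<lambda>i. x (min i M)"] mult_left_mono] by simp
    also have "\<dots> = ennreal (C * (1 + D * s))" using C(1) D s by (intro ennreal_mult[symmetric]) auto
    finally have "\<bar>F (\<lambda>i. x (min i M))\<bar> \<le> C * (1 + D * s)"
      using C(1) D s by (subst (asm) ennreal_le_iff) auto
    also have "\<dots> \<le> C * ((1 + D) * (1 + s))"
      using C(1) D s by (intro mult_left_mono) (auto simp: algebra_simps)
    finally show ?thesis by (simp add: s_def mult.assoc)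
  qed
  have "convex_path_functional (\<lambda>x. F (\<lambda>i. x (min i M)))"
    unfolding convex_path_functional_def
  proof (intro allI ballI)
    fix x y :: "nat \<Rightarrow> real^'a" and r :: real assume "r \<in> {0..1}"
    then show "F (\<lambda>i. r *\<^sub>R x (min i M) + (1 - r) *\<^sub>R y (min i M))
        \<le> r * F (\<lambda>i. x (min i M)) + (1 - r) * F (\<lambda>i. y (min i M))"
      using F(1)[unfolded convex_path_functional_def, THEN spec[of _ "\<lambda>i. x (min i M)"],
          THEN spec[of _ "\<lambda>i. y (min i M)"]] by blast
  qed
  moreover have "depends_below (Suc M) (\<lambda>x. F (\<lambda>i. x (min i M)))"
    unfolding depends_below_def by (auto intro!: arg_cong[where f=F])
  ultimately show ?thesis using bd unfolding path_class_def by blast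
qed

lemma euler_law_prob2:
  assumes "euler x\<^sub>0 P G b S X\<^sub>0 B X h T L \<kappa>" "k \<le> num_steps T h" "u \<in> {0..1}"
  shows "euler.law P X h T k u \<in> prob2"
  using euler.law_families[OF assms(1,2)] assms(3) by (simp add: families_def)

text \<open>Induction on the number of steps. The convex order of the first \<open>n\<close> steps for all labels gives
  the convex order of the marginal laws at time \<open>n\<close>, which is what monotonicity of \<open>\<sigma>\<close> in
  the measure argument requires for the next step.\<close>

lemma euler_path_convex_order:
  fixes b :: "real \<Rightarrow> real^'d \<Rightarrow> real^'d" and \<sigma> \<theta> :: "real \<Rightarrow> real^'d \<Rightarrow> (real^'d) measure \<Rightarrow> real^'q^'d"
  assumes EX: "euler x\<^sub>0 P G b \<sigma> X\<^sub>0 B X h T L \<kappa>" and EY: "euler x\<^sub>0 P K b \<theta> Y\<^sub>0 B Y h T L' \<kappa>'"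
    and CO: "CO P G K b \<sigma> \<theta> X\<^sub>0 Y\<^sub>0"
    and n: "n \<le> num_steps T h" and u: "u \<in> {0..1}" and f: "path_class (Suc n) f"
  shows "(\<integral>\<omega>. f (euler.path X h T n u \<omega>) \<partial>P) \<le> (\<integral>\<omega>. f (euler.path Y h T n u \<omega>) \<partial>P)"
  using n u f
proof (induction n arbitrary: u f)
  case 0
  interpret X: euler x\<^sub>0 P G b \<sigma> X\<^sub>0 B X h T L \<kappa> by (rule EX)
  interpret Y: euler x\<^sub>0 P K b \<theta> Y\<^sub>0 B Y h T L' \<kappa>' by (rule EY)
  note u = \<open>u \<in> {0..1}\<close>
  \<comment> \<open>At step 0 a test function sees a single coordinate, so the order of the initial
    laws applies; the zeros in the other coordinates are arbitrary.\<close>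
  define \<phi> where "\<phi> y = f ((\<lambda>_. 0)(0 := y))" for y
  have fc: "convex_path_functional f" and fd: "depends_below (Suc 0) f" using 0 by (auto simp: path_class_def)
  have \<phi>: "convex_on UNIV \<phi>" unfolding \<phi>_def by (rule convex_path_functional_slice[OF fc])
  obtain C where C: "\<And>x. \<bar>f x\<bar> \<le> C * (1 + (\<Sum>i<Suc 0. (norm (x i))\<^sup>2))"
    using path_class_bound[OF \<open>path_class (Suc 0) f\<close>] by blast
  have bd: "\<bar>\<phi> y\<bar> \<le> C * (1 + (norm y)\<^sup>2)" for y using C[of "(\<lambda>_. 0)(0 := y)"] by (simp add: \<phi>_def)
  have [measurable]: "\<phi> \<in> borel_measurable borel"
    by (rule convex_on_borel_measurable[OF \<phi>])
  have f\<phi>: "f x = \<phi> (x 0)" for x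
    unfolding \<phi>_def by (rule fd[unfolded depends_below_def, rule_format]) simp
  have le: "distr P borel (X\<^sub>0 u) \<preceq>\<^sub>c\<^sub>v distr P borel (Y\<^sub>0 u)" using CO u unfolding CO_def by blast
  have "distr P borel (X\<^sub>0 u) \<in> prob2" "distr P borel (Y\<^sub>0 u) \<in> prob2"
    using X.X\<^sub>0_law Y.X\<^sub>0_law u by (auto simp: families_def)
  from cv_le_integral_mono[OF le this \<phi> bd]
  have "(\<integral>\<omega>. \<phi> (X\<^sub>0 u \<omega>) \<partial>P) \<le> (\<integral>\<omega>. \<phi> (Y\<^sub>0 u \<omega>) \<partial>P)"
    using X.X\<^sub>0m[OF u] Y.X\<^sub>0m[OF u] by (simp add: integral_distr)
  moreover have "(\<integral>\<omega>. f (X.path 0 u \<omega>) \<partial>P) = (\<integral>\<omega>. \<phi> (X\<^sub>0 u \<omega>) \<partial>P)"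
    by (rule Bochner_Integration.integral_cong) (simp_all add: f\<phi> X.path_def X.X_0[OF u])
  moreover have "(\<integral>\<omega>. f (Y.path 0 u \<omega>) \<partial>P) = (\<integral>\<omega>. \<phi> (Y\<^sub>0 u \<omega>) \<partial>P)"
    by (rule Bochner_Integration.integral_cong) (simp_all add: f\<phi> Y.path_def Y.X_0[OF u])
  ultimately show ?case by simp
next
  case (Suc n)
  interpret X: euler x\<^sub>0 P G b \<sigma> X\<^sub>0 B X h T L \<kappa> by (rule EX)
  interpret Y: euler x\<^sub>0 P K b \<theta> Y\<^sub>0 B Y h T L' \<kappa>' by (rule EY)
  note u = \<open>u \<in> {0..1}\<close> and f = \<open>path_class (Suc (Suc n)) f\<close>
  have n: "n < num_steps T h" and n': "n \<le> num_steps T h" using Suc.prems by auto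
  have t: "0 \<le> grid h T n" by (rule grid_nonneg[OF X.hT])
  have famX: "X.law n \<in> families" and famY: "Y.law n \<in> families"
    using X.law_families[OF n'] Y.law_families[OF n'] by auto
  interpret GX: graphon_family G "X.law n" using X.G famX by unfold_locales
  \<comment> \<open>The induction hypothesis at every label \<open>v\<close>, applied to functions
    of the last position, gives the premise under which \<open>\<sigma>\<close> is monotone in the
    family.\<close>
  have order: "X.law n v \<preceq>\<^sub>c\<^sub>v Y.law n v" if v: "v \<in> {0..1}" for v
  proof (rule cv_leI_quadratic)
    show "X.law n v \<in> prob2" "Y.law n v \<in> prob2"
      using euler_law_prob2[OF EX n' v] euler_law_prob2[OF EY n' v] by auto
    fix \<phi> :: "real^'d \<Rightarrow> real" assume \<phi>: "convex_on UNIV \<phi>" "\<exists>C. \<forall>x. \<bar>\<phi> x\<bar> \<le> C * (1 + (norm x)\<^sup>2)"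
    then obtain C where C: "\<And>x. \<bar>\<phi> x\<bar> \<le> C * (1 + (norm x)\<^sup>2)" by blast
    have [measurable]: "\<phi> \<in> borel_measurable borel"
      by (rule convex_on_borel_measurable[OF \<phi>(1)])
    have Xm: "X v (grid h T n) \<in> borel_measurable P" "Y v (grid h T n) \<in> borel_measurable P"
      using n' v by (auto intro!: X.X_measurable X.law_families Y.X_measurable Y.law_families)
    have "(\<integral>\<omega>. \<phi> (X.path n v \<omega> n) \<partial>P) \<le> (\<integral>\<omega>. \<phi> (Y.path n v \<omega> n) \<partial>P)"
      by (rule Suc.IH[OF n' v path_class_coordinate[OF \<phi>(1) C]])
    then show "(\<integral>x. \<phi> x \<partial>X.law n v) \<le> (\<integral>x. \<phi> x \<partial>Y.law n v)"
      using Xm by (simp add: X.law_def Y.law_def X.path_def Y.path_def integral_distr)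
  qed
  \<comment> \<open>The intermediate matrix is \<open>\<sigma>\<close> evaluated at the laws of
    \<open>Y\<close>: the family is changed first with \<open>\<sigma>\<close> and \<open>G\<close>
    fixed, then \<open>\<sigma>\<close> and \<open>G\<close> are exchanged for
    \<open>\<theta>\<close> and \<open>K\<close> at that family.\<close>
  have le: "X.diffusion n u x \<preceq>\<^sub>m Y.diffusion n u x" for x
  proof (rule mat_le_trans)
    show "X.diffusion n u x \<preceq>\<^sub>m \<sigma> (grid h T n) x (graphon_mix G (Y.law n) u)"
      unfolding X.diffusion_def
      by (rule CO[unfolded CO_def, THEN conjunct2, THEN conjunct2, THEN conjunct1, rule_format, OF t u famX famY order])
    show "\<sigma> (grid h T n) x (graphon_mix G (Y.law n) u) \<preceq>\<^sub>m Y.diffusion n u x"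
      unfolding Y.diffusion_def
      by (rule CO[unfolded CO_def, THEN conjunct2, THEN conjunct2, THEN conjunct2, THEN conjunct1, rule_format, OF t u famY])
  qed
  have conv: "X.diffusion n u (r *\<^sub>R x + (1 - r) *\<^sub>R y) \<preceq>\<^sub>m r *\<^sub>R X.diffusion n u x + (1 - r) *\<^sub>R X.diffusion n u y"
    if "r \<in> {0..1}" for x y r
    unfolding X.diffusion_def
    by (rule CO[unfolded CO_def, THEN conjunct2, THEN conjunct1, rule_format, OF t GX.graphon_mix_measures2[OF u] that])
  have "\<exists>c. (\<forall>x. norm (X.drift n x) \<le> c * (1 + norm x)) \<and> (\<forall>x. onorm ((*v) (X.diffusion n u x)) \<le> c * (1 + norm x))"
  proof (rule X.growth[OF famX])
    fix c assume 1: "\<And>x. norm (X.drift n x) \<le> c * (1 + norm x)"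
      and 2: "\<And>u x. u \<in> {0..1} \<Longrightarrow> onorm ((*v) (X.diffusion n u x)) \<le> c * (1 + norm x)"
    show ?thesis by (intro exI[of _ c] conjI allI 1 2 u)
  qed
  then obtain c where c: "\<And>x. norm (X.drift n x) \<le> c * (1 + norm x)"
      "\<And>x. onorm ((*v) (X.diffusion n u x)) \<le> c * (1 + norm x)"
    by metis
  let ?g = "euler_step n (X.drift n) (X.diffusion n u) (X.sd n) f"
  \<comment> \<open>This function is only integrated along the path of \<open>Y\<close> and its
    convexity is never asked for. Drift and step size are common to the two schemes.\<close>
  let ?g' = "euler_step n (X.drift n) (Y.diffusion n u) (X.sd n) f"
  have g: "path_class (Suc n) ?g"
    by (rule path_class_euler_step[OF X.sd_pos[OF n] f c X.drift_affine conv])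
  have mono: "?g x \<le> ?g' x" for x
    by (rule euler_step_mono[OF X.sd_pos[OF n] f c le])
  have "(\<integral>\<omega>. f (X.path (Suc n) u \<omega>) \<partial>P) = (\<integral>\<omega>. ?g (X.path n u \<omega>) \<partial>P)"
    by (rule X.integral_path_Suc[OF f u n])
  also have "\<dots> \<le> (\<integral>\<omega>. ?g (Y.path n u \<omega>) \<partial>P)" by (rule Suc.IH[OF n' u g])
  also have "\<dots> \<le> (\<integral>\<omega>. ?g' (Y.path n u \<omega>) \<partial>P)"
    by (rule integral_mono[OF Y.path_class_integrable[OF g u n'] Y.integral_path_Suc(2)[OF f u n] mono])
  also have "\<dots> = (\<integral>\<omega>. f (Y.path (Suc n) u \<omega>) \<partial>P)"
    by (rule Y.integral_path_Suc(1)[OF f u n, symmetric])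
  finally show ?case .
qed

section \<open>Extracting the hypotheses of the two schemes from (RD) and from the independence of
  the sources\<close>

lemma families_of_second_moment:
  fixes X\<^sub>0 :: "real \<Rightarrow> 'w \<Rightarrow> real^'d"
  assumes m: "(\<lambda>u. distr P borel (X\<^sub>0 u)) \<in> unit_borel \<rightarrow>\<^sub>M prob_algebra borel"
    and X\<^sub>0: "\<And>u. u \<in> {0..1} \<Longrightarrow> X\<^sub>0 u \<in> borel_measurable P"
    and b: "(SUP u\<in>{0..1}. \<integral>\<^sup>+\<omega>. ennreal ((norm (X\<^sub>0 u \<omega>))\<^sup>2) \<partial>P) < \<infinity>"
  shows "(\<lambda>u. distr P borel (X\<^sub>0 u)) \<in> families"
proof (rule familiesI)
  let ?S = "SUP u\<in>{0..1}. \<integral>\<^sup>+\<omega>. ennreal ((norm (X\<^sub>0 u \<omega>))\<^sup>2) \<partial>P"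
  show "(\<lambda>u. distr P borel (X\<^sub>0 u)) \<in> unit_leb \<rightarrow>\<^sub>M prob_algebra borel"
    using m by (simp add: measurable_cong_sets[OF sets_unit_leb refl])
  fix v :: real assume v: "v \<in> {0..1}"
  have "moment2 (distr P borel (X\<^sub>0 v)) = (\<integral>\<^sup>+\<omega>. ennreal ((norm (X\<^sub>0 v \<omega>))\<^sup>2) \<partial>P)"
    using X\<^sub>0[OF v] by (simp add: nn_integral_distr)
  also have "\<dots> \<le> ?S" using v by (rule SUP_upper)
  also have "?S = ennreal (enn2real ?S)" using b by simp
  finally show "moment2 (distr P borel (X\<^sub>0 v)) \<le> ennreal (enn2real ?S)" .
qed

lemma SUP_SUP_bound:
  fixes f :: "real \<Rightarrow> real \<Rightarrow> real"
  assumes "(SUP t\<in>{0..}. SUP u\<in>{0..1::real}. ennreal (f t u)) < \<infinity>"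
  obtains \<kappa> where "\<And>t u. 0 \<le> t \<Longrightarrow> u \<in> {0..1} \<Longrightarrow> f t u \<le> \<kappa>"
proof
  let ?S = "SUP t\<in>{0..}. SUP u\<in>{0..1::real}. ennreal (f t u)"
  fix t u :: real assume tu: "0 \<le> t" "u \<in> {0..1}"
  have "ennreal (f t u) \<le> (SUP u\<in>{0..1::real}. ennreal (f t u))" using tu(2) by (rule SUP_upper)
  also have "\<dots> \<le> ?S" by (rule SUP_upper) (use tu in simp)
  also have "?S = ennreal (enn2real ?S)" using assms by simp
  finally show "f t u \<le> enn2real ?S" by (subst (asm) ennreal_le_iff) auto
qed

lemma indep_sources_product:
  assumes P: "prob_space P" and ind: "indep_sources P X\<^sub>0 Y\<^sub>0 B" and u: "u \<in> {0..1}"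
    and N: "N \<in> sets (vimage_algebra (space P) (\<lambda>\<omega>. \<lambda>t\<in>{0..}. B u t \<omega>) (PiM {0..} (\<lambda>_. borel)))"
  shows "A \<in> sets (vimage_algebra (space P) (X\<^sub>0 u) borel) \<Longrightarrow> measure P (A \<inter> N) = measure P A * measure P N"
    and "A \<in> sets (vimage_algebra (space P) (Y\<^sub>0 u) borel) \<Longrightarrow> measure P (A \<inter> N) = measure P A * measure P N"
proof -
  note D = prob_space.indep_setsD[OF P ind[unfolded indep_sources_def, THEN conjunct2]]
  show "measure P (A \<inter> N) = measure P A * measure P N" if A: "A \<in> sets (vimage_algebra (space P) (X\<^sub>0 u) borel)"
    using D[of "{InitX u, Noise u}" "case_source (\<lambda>_. A) (\<lambda>_. A) (\<lambda>_. N)"] A N u by (simp add: image_iff)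
  show "measure P (A \<inter> N) = measure P A * measure P N" if A: "A \<in> sets (vimage_algebra (space P) (Y\<^sub>0 u) borel)"
    using D[of "{InitY u, Noise u}" "case_source (\<lambda>_. A) (\<lambda>_. A) (\<lambda>_. N)"] A N u by (simp add: image_iff)
qed

lemma RD_lipschitz:
  assumes "RD x\<^sub>0 P G K b \<sigma> \<theta> X\<^sub>0 Y\<^sub>0"
  shows "\<exists>L. (\<forall>t x y. \<forall>\<mu>\<in>measures2. \<forall>\<nu>\<in>measures2. 0 \<le> t \<longrightarrow>
        max (norm (b t x - b t y))
          (max (onorm ((*v) (\<sigma> t x \<mu> - \<sigma> t y \<nu>))) (onorm ((*v) (\<theta> t x \<mu> - \<theta> t y \<nu>))))
        \<le> L * (norm (x - y) + WOP2 x\<^sub>0 \<mu> \<nu>)) \<and> 0 < L"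
  using assms unfolding RD_def by (elim conjE exE) (intro exI conjI, assumption+)

theorem theorem3p7:
  fixes P :: "'w measure" and Fil :: "real \<Rightarrow> 'w measure"
    and G K :: "real \<Rightarrow> real \<Rightarrow> real"
    and b :: "real \<Rightarrow> real^'d \<Rightarrow> real^'d"
    and \<sigma> \<theta> :: "real \<Rightarrow> real^'d \<Rightarrow> (real^'d) measure \<Rightarrow> real^'q^'d"
    and X\<^sub>0 Y\<^sub>0 :: "real \<Rightarrow> 'w \<Rightarrow> real^'d"
    and B :: "real \<Rightarrow> real \<Rightarrow> 'w \<Rightarrow> real^'q"
    and X Y :: "real \<Rightarrow> real \<Rightarrow> 'w \<Rightarrow> real^'d"
    and x\<^sub>0 :: "real^'d" and l h T :: real
    and F :: "(nat \<Rightarrow> real^'d) \<Rightarrow> real"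
  assumes "filtered_prob_space P Fil"
    and "\<forall>u\<in>{0..1}. std_brownian P (B u)"
    and "indep_sources P X\<^sub>0 Y\<^sub>0 B"
    and "graphon G" and "graphon K"
    and "RD x\<^sub>0 P G K b \<sigma> \<theta> X\<^sub>0 Y\<^sub>0"
    and "CO P G K b \<sigma> \<theta> X\<^sub>0 Y\<^sub>0"
    and "l > 0" and "h > 0" and "T > 0"
    and "euler_scheme P h G b \<sigma> B X\<^sub>0 X"
    and "euler_scheme P h K b \<theta> B Y\<^sub>0 Y"
    and "convex_path_functional F"
    and "quadratic_growth l h F"
  shows "\<forall>u\<in>{0..1}.
    (\<integral>\<omega>. F (sampled_path T h (\<lambda>t. X u t \<omega>)) \<partial>P) \<le> (\<integral>\<omega>. F (sampled_path T h (\<lambda>t. Y u t \<omega>)) \<partial>P)"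
proof
  fix u :: real assume u: "u \<in> {0..1}"
  have P: "prob_space P" using assms(1) by (simp add: filtered_prob_space_def)
  have init: "X\<^sub>0 v \<in> borel_measurable P" "Y\<^sub>0 v \<in> borel_measurable P" if "v \<in> {0..1}" for v
    using assms(3) that by (auto simp: indep_sources_def)
  have affine: "\<exists>l c. linear l \<and> (\<forall>x. b t x = l x + c)" if "0 \<le> t" for t
    using assms(7) that unfolding CO_def by blast
  from RD_lipschitz[OF assms(6)] obtain L where
    RD: "(\<forall>t x y. \<forall>\<mu>\<in>measures2. \<forall>\<nu>\<in>measures2. 0 \<le> t \<longrightarrow>
        max (norm (b t x - b t y))
          (max (onorm ((*v) (\<sigma> t x \<mu> - \<sigma> t y \<nu>))) (onorm ((*v) (\<theta> t x \<mu> - \<theta> t y \<nu>))))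
        \<le> L * (norm (x - y) + WOP2 x\<^sub>0 \<mu> \<nu>)) \<and> 0 < L" ..
  note L = RD[THEN conjunct2] and lip = RD[THEN conjunct1, rule_format]
  have lip\<sigma>: "onorm ((*v) (\<sigma> t x \<mu> - \<sigma> t y \<nu>)) \<le> L * (norm (x - y) + WOP2 x\<^sub>0 \<mu> \<nu>)"
    and lip\<theta>: "onorm ((*v) (\<theta> t x \<mu> - \<theta> t y \<nu>)) \<le> L * (norm (x - y) + WOP2 x\<^sub>0 \<mu> \<nu>)"
    if "0 \<le> t" "\<mu> \<in> measures2" "\<nu> \<in> measures2" for t x y \<mu> \<nu>
    using lip[OF that(2,3,1), of x y] by simp_all
  have laws: "(\<lambda>u. distr P borel (X\<^sub>0 u)) \<in> families" "(\<lambda>u. distr P borel (Y\<^sub>0 u)) \<in> families"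
    using assms(6) init unfolding RD_def by (auto intro!: families_of_second_moment)
  have bound: "(SUP t\<in>{0..}. SUP u\<in>{0..1}. ennreal (onorm ((*v) (\<sigma> t 0 (graphon_mix G (\<lambda>_. return borel 0) u))))) < \<infinity>"
      "(SUP t\<in>{0..}. SUP u\<in>{0..1}. ennreal (onorm ((*v) (\<theta> t 0 (graphon_mix K (\<lambda>_. return borel 0) u))))) < \<infinity>"
    using assms(6) unfolding RD_def by simp_all
  obtain \<kappa> where \<kappa>: "\<And>t u. 0 \<le> t \<Longrightarrow> u \<in> {0..1} \<Longrightarrow> onorm ((*v) (\<sigma> t 0 (graphon_mix G (\<lambda>_. return borel 0) u))) \<le> \<kappa>"
    using SUP_SUP_bound[OF bound(1)] by blast
  obtain \<kappa>' where \<kappa>': "\<And>t u. 0 \<le> t \<Longrightarrow> u \<in> {0..1} \<Longrightarrow> onorm ((*v) (\<theta> t 0 (graphon_mix K (\<lambda>_. return borel 0) u))) \<le> \<kappa>'"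
    using SUP_SUP_bound[OF bound(2)] by blast
  have EX: "euler x\<^sub>0 P G b \<sigma> X\<^sub>0 B X h T L \<kappa>"
    by (rule euler.intro)
       (use P assms init affine lip\<sigma> laws \<kappa> L indep_sources_product(1)[OF P assms(3)] in auto)
  have EY: "euler x\<^sub>0 P K b \<theta> Y\<^sub>0 B Y h T L \<kappa>'"
    by (rule euler.intro)
       (use P assms init affine lip\<theta> laws \<kappa>' L indep_sources_product(2)[OF P assms(3)] in auto)
  let ?M = "num_steps T h"
  \<comment> \<open>Sampled paths are constant from index \<open>?M\<close> on, so \<open>F\<close>
    may be evaluated on the path frozen there.\<close>
  let ?f = "\<lambda>x. F (\<lambda>i. x (min i ?M))"
  have stop: "grid h T (min (min i ?M) ?M) = grid h T i" for i
    using grid_after[OF assms(9,10)] by (cases "i \<le> ?M") (auto simp: min_def)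
  have "(\<integral>\<omega>. ?f (euler.path X h T ?M u \<omega>) \<partial>P) \<le> (\<integral>\<omega>. ?f (euler.path Y h T ?M u \<omega>) \<partial>P)"
    by (rule euler_path_convex_order[OF EX EY assms(7) order_refl u path_class_stopped[OF assms(13,14,8,9)]])
  moreover have "sampled_path T h x = (\<lambda>i. x (grid h T i))" for x :: "real \<Rightarrow> real^'d"
    using sampled_path_grid[OF assms(9,10)] by blast
  ultimately show "(\<integral>\<omega>. F (sampled_path T h (\<lambda>t. X u t \<omega>)) \<partial>P) \<le> (\<integral>\<omega>. F (sampled_path T h (\<lambda>t. Y u t \<omega>)) \<partial>P)"
    by (simp only: euler.path_def[OF EX] euler.path_def[OF EY] stop)
qed

end
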